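(* Let $u(t,i)=u_i(t)$ be a solution of $$\dot u_i(t)=d'_i(u_{i+1}(t)-u_i(t))+d_i(u_{i-1}(t)-u_i(t))+f(i,u_i(t)),\qquad t>0,\ i\in\mathbf Z,$$ with $0\le u(0,i)\le 1$ for all $i$ and $\{i\in\mathbf Z: u(0,i)\ne 0\}$ nonempty and finite. Let $\underline{\omega},\overline{\omega}$ be the two speeds defined in the context. Then 1) for any $\omega>\overline{\omega}$, $\lim_{t\to+\infty}\sup_{i\ge \omega t}|u(t,i)|=0$; 2) for any $0\le\omega<\underline{\omega}$, $\lim_{t\to+\infty}\sup_{0\le i\le \omega t}|u(t,i)-1|=0$.
   Context: Standing assumptions. $(d_i)_{i\in\mathbf Z}$, $(d'_i)_{i\in\mathbf Z}$ are real sequences with $0<\inf_i d_i\le\sup_i d_i<\infty$ and $0<\inf_i d'_i\le\sup_i d'_i<\infty$. The function $f:\mathbf Z\times[0,1]\to\mathbf R$ satisfies: $f(i,0)=f(i,1)=0$ for all $i$; $0<\inf_j f(j,s)\le f(i,s)\le f'_s(i,0)s$ for all $i\in\mathbf Z$ and $s\in(0,1)$; for some Hölder exponent $\gamma\in(0,1]$, $\sup_i\|f(i,\cdot)\|_{C^{1+\gamma}([0,1])}<\infty$; and $\liminf_{|i|\to\infty}\big(f'_s(i,0)-(\sqrt{d'_i}-\sqrt{d_i})^2\big)>0$. Here $f'_s(i,0)$ is the derivative of $s\mapsto f(i,s)$ at $s=0$. Solutions $u$ take values in $[0,1]$. Operators. For $n\in\mathbf Z$ let $X_n$ be the set of functions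 $[n,+\infty)\cap\mathbf Z\to\mathbf R$; $X_{-\infty}$ is the set of functions $\mathbf Z\to\mathbf R$. Let $(\mathcal L\phi)_i=d'_i(\phi_{i+1}-\phi_i)+d_i(\phi_{i-1}-\phi_i)+f'_s(i,0)\phi_i$, mapping $X_n$ to $X_{n+1}$ (and $X_{-\infty}$ to itself), and for $p\in\mathbf R$, $(L_p\phi)_i=e^{-pi}(\mathcal L(e^{p\cdot}\phi))_i$, where $(e^{p\cdot}\phi)_j=e^{pj}\phi_j$. Generalized principal eigenvalues. For $n\in\{-\infty\}\cup\mathbf Z$ let $I_n=(n,+\infty)\cap\mathbf Z$. For $n\in\mathbf Z$, $\mathcal A_n$ is the set of $\phi\in X_n$ with $\phi_i>0$ for $i\ge n$, $\lim_{i\to+\infty}\frac{\ln\phi_i}{i}=0$, and both sequences $\big(\frac{\phi_{i+1}-\phi_i}{\phi_i}\big)_{i\ge n}$, $\big(\frac{\phi_{i+1}-\phi_i}{\phi_{i+1}}\big)_{i\ge n}$ bounded. $\mathcal A_{-\infty}$ is the set of $\phi\in X_{-\infty}$ with $\phi_i>0$ for all $i$, $\lim_{|i|\to\infty}\frac{\ln\phi_i}{i}=0$, and $\big(\frac{\phi_{i\pm1}-\phi_i}{\phi_i}\big)_{i\in\mathbf Z}$ bounded. Define $$\underline{\lambda_1}(p,n)=\sup\{\lambda:\exists\phi\in\mathcal A_n,\ (L_p\phi)_i\ge\lambda\phi_i\ \forall i\in I_n\},\quad \overline{\lambda_1}(p,n)=\inf\{\lambda:\exists\phi\in\mathcal A_n,\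 (L_p\phi)_i\le\lambda\phi_i\ \forall i\in I_n\}.$$ $\underline{\lambda_1}(p,n)$ is nondecreasing and $\overline{\lambda_1}(p,n)$ nonincreasing in $n$. Speeds. $\underline H(p)=\lim_{n\to+\infty}\underline{\lambda_1}(p,n)$, $\overline H(p)=\lim_{n\to+\infty}\overline{\lambda_1}(p,n)$, and $\underline{\omega}=\min_{p>0}\frac{\underline H(-p)}{p}$, $\overline{\omega}=\min_{p>0}\frac{\overline H(-p)}{p}$. *)

theory Defs
  imports "HOL-Analysis.Analysis"
begin

text \<open>The reaction term is a total function \<open>f :: int \<Rightarrow> real \<Rightarrow> real\<close> of which only the restriction to
  the interval from 0 to 1 matters: derivatives in the second variable are taken within
  \<open>{0..1}\<close>, hence one-sided at the end points.\<close>

definition deriv_s :: "(int \<Rightarrow> real \<Rightarrow> real) \<Rightarrow> int \<Rightarrow> real \<Rightarrow> real" where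
  "deriv_s f i s = vector_derivative (f i) (at s within {0..1})"

text \<open>\<open>sup\<^sub>i \<parallel>f(i,\<cdot>)\<parallel> < \<infinity>\<close> in \<open>C\<^bsup>1+\<gamma>\<^esup>([0,1])\<close>; for \<open>\<gamma> = 1\<close> this is \<open>C\<^bsup>1,1\<^esup>\<close>. Continuity of the
  derivative follows from the Hoelder bound.\<close>

definition uniformly_C1_holder :: "real \<Rightarrow> (int \<Rightarrow> real \<Rightarrow> real) \<Rightarrow> bool" where
  "uniformly_C1_holder \<gamma> f \<longleftrightarrow>
     (\<forall>i. \<forall>s\<in>{0..1}. f i differentiable (at s within {0..1})) \<and>
     (\<exists>K. \<forall>i. (\<forall>s\<in>{0..1}. \<bar>f i s\<bar> \<le> K) \<and>
              (\<forall>s\<in>{0..1}. \<bar>deriv_s f i s\<bar> \<le> K) \<and>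
              (\<forall>s\<in>{0..1}. \<forall>t\<in>{0..1}. \<bar>deriv_s f i s - deriv_s f i t\<bar> \<le> K * \<bar>s - t\<bar> powr \<gamma>))"

definition lin_op :: "(int \<Rightarrow> real) \<Rightarrow> (int \<Rightarrow> real) \<Rightarrow> (int \<Rightarrow> real \<Rightarrow> real) \<Rightarrow>
    (int \<Rightarrow> real) \<Rightarrow> int \<Rightarrow> real" where
  "lin_op d d' f \<phi> i =
     d' i * (\<phi> (i + 1) - \<phi> i) + d i * (\<phi> (i - 1) - \<phi> i) + deriv_s f i 0 * \<phi> i"

definition lin_op_p :: "(int \<Rightarrow> real) \<Rightarrow> (int \<Rightarrow> real) \<Rightarrow> (int \<Rightarrow> real \<Rightarrow> real) \<Rightarrow> real \<Rightarrow>
    (int \<Rightarrow> real) \<Rightarrow> int \<Rightarrow> real" where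
  "lin_op_p d d' f p \<phi> i =
     exp (- p * real_of_int i) * lin_op d d' f (\<lambda>j. exp (p * real_of_int j) * \<phi> j) i"

text \<open>A function on \<open>[n,\<infinity>) \<inter> \<int>\<close> is represented by a total function on the integers whose values
  below \<open>n\<close> are irrelevant: they are used neither in the following set nor by
  the operators above at the indices \<open>i > n\<close>.\<close>

definition test_funs :: "int \<Rightarrow> (int \<Rightarrow> real) set" where
  "test_funs n = {\<phi>. (\<forall>i\<ge>n. \<phi> i > 0) \<and>
     ((\<lambda>i. ln (\<phi> i) / real_of_int i) \<longlongrightarrow> 0) at_top \<and>
     bounded ((\<lambda>i. (\<phi> (i + 1) - \<phi> i) / \<phi> i) ` {n..}) \<and>
     bounded ((\<lambda>i. (\<phi> (i + 1) - \<phi> i) / \<phi> (i + 1)) ` {n..})}"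

definition lambda_lower :: "(int \<Rightarrow> real) \<Rightarrow> (int \<Rightarrow> real) \<Rightarrow> (int \<Rightarrow> real \<Rightarrow> real) \<Rightarrow>
    real \<Rightarrow> int \<Rightarrow> real" where
  "lambda_lower d d' f p n =
     Sup {l. \<exists>\<phi>\<in>test_funs n. \<forall>i>n. lin_op_p d d' f p \<phi> i \<ge> l * \<phi> i}"

definition lambda_upper :: "(int \<Rightarrow> real) \<Rightarrow> (int \<Rightarrow> real) \<Rightarrow> (int \<Rightarrow> real \<Rightarrow> real) \<Rightarrow>
    real \<Rightarrow> int \<Rightarrow> real" where
  "lambda_upper d d' f p n =
     Inf {l. \<exists>\<phi>\<in>test_funs n. \<forall>i>n. lin_op_p d d' f p \<phi> i \<le> l * \<phi> i}"

definition H_lower :: "(int \<Rightarrow> real) \<Rightarrow> (int \<Rightarrow> real) \<Rightarrow> (int \<Rightarrow> real \<Rightarrow> real) \<Rightarrow> real \<Rightarrow> real" where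
  "H_lower d d' f p = Lim at_top (\<lambda>n. lambda_lower d d' f p n)"

definition H_upper :: "(int \<Rightarrow> real) \<Rightarrow> (int \<Rightarrow> real) \<Rightarrow> (int \<Rightarrow> real \<Rightarrow> real) \<Rightarrow> real \<Rightarrow> real" where
  "H_upper d d' f p = Lim at_top (\<lambda>n. lambda_upper d d' f p n)"

text \<open>The speeds are minima, not merely infima, hence \<open>LEAST\<close>.\<close>

definition speed_lower :: "(int \<Rightarrow> real) \<Rightarrow> (int \<Rightarrow> real) \<Rightarrow> (int \<Rightarrow> real \<Rightarrow> real) \<Rightarrow> real" where
  "speed_lower d d' f = (LEAST w. \<exists>p>0. w = H_lower d d' f (- p) / p)"

definition speed_upper :: "(int \<Rightarrow> real) \<Rightarrow> (int \<Rightarrow> real) \<Rightarrow> (int \<Rightarrow> real \<Rightarrow> real) \<Rightarrow> real" where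
  "speed_upper d d' f = (LEAST w. \<exists>p>0. w = H_upper d d' f (- p) / p)"

text \<open>Classical solutions with values in \<open>[0,1]\<close>; continuity at \<open>t = 0\<close> ties the solution to its
  initial datum \<open>u 0\<close>.\<close>

definition is_solution :: "(int \<Rightarrow> real) \<Rightarrow> (int \<Rightarrow> real) \<Rightarrow> (int \<Rightarrow> real \<Rightarrow> real) \<Rightarrow>
    (real \<Rightarrow> int \<Rightarrow> real) \<Rightarrow> bool" where
  "is_solution d d' f u \<longleftrightarrow>
     (\<forall>t\<ge>0. \<forall>i. 0 \<le> u t i \<and> u t i \<le> 1) \<and>
     (\<forall>i. continuous_on {0..} (\<lambda>t. u t i)) \<and>
     (\<forall>t>0. \<forall>i. ((\<lambda>\<tau>. u \<tau> i) has_real_derivative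
        (d' i * (u t (i + 1) - u t i) + d i * (u t (i - 1) - u t i) + f i (u t i))) (at t))"

end

theory Submission
  imports Defs
begin

text \<open>Above the upper speed, a test function \<open>\<phi>\<close> for the upper eigenvalue turns
  \<open>exp (l t - p i) \<phi>\<^sub>i\<close> into a supersolution of the linearised equation.

  Below the lower speed, suppose that \<open>u\<close> decays exponentially along some ray
  \<open>i = w t\<close>. Its exponential rate depends only on \<open>i / t\<close> in the limit, and penalising it by a
  parabola in \<open>i / t\<close> produces a nearby ray where a smooth profile with some exponent \<open>q\<close> touches
  the rate from below. A test function for the lower eigenvalue at \<open>q\<close>, with a Gaussian cut-off
  at the scale of \<open>t\<close>, is a subsolution growing faster than this profile, a contradiction. Hence
  \<open>u\<close> is subexponential along the ray. Since the condition on the limit inferior makes small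
  bumps of uniformly bounded width grow exponentially, \<open>u\<close> is bounded away from 0 behind the ray
  after a proportionally small delay, and the reaction then drives it to 1.\<close>

text \<open>Below the lower speed, the difficulty is that test functions for different exponents are
  unrelated, so no single front profile can be assembled from them. The penalisation selects one
  exponent \<open>q\<close>, over which there is no control. What closes the argument is that
  \<open>w < speed_lower\<close> means w p < H(-p) for every p > 0, where H is
  \<open>H_lower\<close>; together with H \<ge> \<delta> > 0 this gives H(q) + q w > 0 for every
  real \<open>q\<close>. Hence a subsolution with exponent \<open>q\<close> does not decay along the
  ray, whereas the contact with \<open>u\<close> decays there at a rate \<mu> > 0. All errors are
  paid from \<mu>: the Hoelder error of the reaction (\<open>u\<close> is exponentially small at the
  contact), the cut-off (it changes the ratio of neighbouring values by a factor near 1), and the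
  test function (its subexponential size disappears at the scale of \<open>t\<close>). The
  eigenvalues see only sites far to the right, so sites near the origin and to its left need the
  separate persistence argument. Every comparison takes place on a finite window, whose boundary
  values must be controlled by hand.\<close>

section \<open>Conjugated operator and subexponential test functions\<close>

lemma lin_op_p_eq:
  "lin_op_p d d' f p \<phi> i = d' i * exp p * \<phi> (i + 1) + d i * exp (- p) * \<phi> (i - 1)
     - (d i + d' i - deriv_s f i 0) * \<phi> i"
proof -
  have 1: "exp (- p * real_of_int i) * exp (p * real_of_int (i + 1)) = exp p"
    and 2: "exp (- p * real_of_int i) * exp (p * real_of_int (i - 1)) = exp (- p)"
    and 3: "exp (- p * real_of_int i) * exp (p * real_of_int i) = 1"
    by (simp_all add: exp_add [symmetric] algebra_simps)
  have "lin_op_p d d' f p \<phi> i =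
      d' i * ((exp (- p * real_of_int i) * exp (p * real_of_int (i + 1))) * \<phi> (i + 1)
        - (exp (- p * real_of_int i) * exp (p * real_of_int i)) * \<phi> i)
    + d i * ((exp (- p * real_of_int i) * exp (p * real_of_int (i - 1))) * \<phi> (i - 1)
        - (exp (- p * real_of_int i) * exp (p * real_of_int i)) * \<phi> i)
    + deriv_s f i 0 * ((exp (- p * real_of_int i) * exp (p * real_of_int i)) * \<phi> i)"
    unfolding lin_op_p_def lin_op_def by (simp only: algebra_simps)
  then show ?thesis unfolding 1 2 3 by (simp add: algebra_simps)
qed

lemma one_in_test_funs: "(\<lambda>_. 1) \<in> test_funs n"
  by (simp add: test_funs_def image_constant_conv)

lemma test_funs_mono: "n \<le> n' \<Longrightarrow> test_funs n \<subseteq> test_funs n'"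
proof -
  assume "n \<le> n'"
  then have "g ` {n'..} \<subseteq> g ` {n..}" for g :: "int \<Rightarrow> real" by (intro image_mono) simp
  then show ?thesis
    using \<open>n \<le> n'\<close> unfolding test_funs_def by (auto intro: bounded_subset)
qed

lemma test_funs_pos: "\<phi> \<in> test_funs n \<Longrightarrow> n \<le> i \<Longrightarrow> 0 < \<phi> i"
  by (simp add: test_funs_def)

lemma test_funs_subexponential:
  assumes "\<phi> \<in> test_funs n" "0 < \<eta>"
  shows "\<exists>k\<ge>1. \<forall>i\<ge>k. \<bar>ln (\<phi> i)\<bar> \<le> \<eta> * real_of_int i"
proof -
  have "((\<lambda>i. ln (\<phi> i) / real_of_int i) \<longlongrightarrow> 0) at_top"
    using assms by (simp add: test_funs_def)
  then have "\<forall>\<^sub>F i in at_top. \<bar>ln (\<phi> i) / real_of_int i\<bar> < \<eta>"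
    using assms(2) by (auto simp: tendsto_iff dist_real_def)
  then obtain k where k: "\<And>i. i \<ge> k \<Longrightarrow> \<bar>ln (\<phi> i) / real_of_int i\<bar> < \<eta>"
    unfolding eventually_at_top_linorder by blast
  have "\<bar>ln (\<phi> i)\<bar> \<le> \<eta> * real_of_int i" if "i \<ge> max k 1" for i
    using k[of i] that by (auto simp: abs_divide field_simps)
  then show ?thesis by (intro exI[of _ "max k 1"]) auto
qed

lemma geometric_lower:
  fixes \<phi> :: "int \<Rightarrow> real"
  assumes "\<And>i. i \<ge> k \<Longrightarrow> \<rho> * \<phi> i \<le> \<phi> (i + 1)" "0 < \<rho>" "\<And>i. i \<ge> k \<Longrightarrow> 0 < \<phi> i" "i \<ge> k"
  shows "ln (\<phi> k) + ln \<rho> * real_of_int (i - k) \<le> ln (\<phi> i)"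
  using assms(4)
proof (induction i rule: int_ge_induct)
  case (step i)
  have "ln \<rho> + ln (\<phi> i) = ln (\<rho> * \<phi> i)"
    using assms(2) assms(3)[of i] step by (simp add: ln_mult)
  also have "\<dots> \<le> ln (\<phi> (i + 1))"
    using assms(1)[of i] assms(2) assms(3)[of i] assms(3)[of "i+1"] step
    by (subst ln_le_cancel_iff) auto
  finally show ?case using step by (simp add: algebra_simps)
qed simp

text \<open>Ratios bounded below by some \<rho> > 1 would make \<open>ln (\<phi> i)\<close> grow
  linearly, against its sublinearity.\<close>

lemma test_funs_ratio_ge:
  assumes "\<phi> \<in> test_funs n" "n \<le> k" "\<And>i. i \<ge> k \<Longrightarrow> \<rho> * \<phi> i \<le> \<phi> (i + 1)"
  shows "\<rho> \<le> 1"
proof (rule ccontr)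
  assume "\<not> \<rho> \<le> 1"
  then have \<rho>: "\<rho> > 1" by simp
  define \<eta> where "\<eta> = ln \<rho> / 2"
  have \<eta>: "\<eta> > 0" using \<rho> by (simp add: \<eta>_def)
  obtain k' where k': "k' \<ge> 1" "\<And>i. i \<ge> k' \<Longrightarrow> \<bar>ln (\<phi> i)\<bar> \<le> \<eta> * real_of_int i"
    using test_funs_subexponential[OF assms(1) \<eta>] by blast
  define c where "c = ln (\<phi> k) - 2 * \<eta> * real_of_int k"
  have pos: "\<And>i. i \<ge> k \<Longrightarrow> 0 < \<phi> i" using assms(1,2) by (auto intro: test_funs_pos)
  obtain i where i: "i \<ge> max k k'" "real_of_int i > - c / \<eta>"
    by (metis ex_less_of_int less_le_trans linorder_linear max.cobounded1 max.cobounded2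
        max_def of_int_le_iff)
  have "c + 2 * \<eta> * real_of_int i \<le> ln (\<phi> i)"
    using geometric_lower[of k \<rho> \<phi> i] assms(3) pos \<rho> i
    by (simp add: c_def \<eta>_def algebra_simps)
  also have "\<dots> \<le> \<eta> * real_of_int i" using k'(2)[of i] i by auto
  finally have "\<eta> * real_of_int i \<le> - c" by simp
  with i(2) \<eta> show False by (simp add: field_simps)
qed

lemma test_funs_ratio_le:
  assumes "\<phi> \<in> test_funs n" "n \<le> k" "\<And>i. i \<ge> k \<Longrightarrow> \<phi> (i + 1) \<le> \<rho> * \<phi> i"
  shows "1 \<le> \<rho>"
proof (rule ccontr)
  assume "\<not> 1 \<le> \<rho>"
  then have \<rho>: "\<rho> < 1" by simp
  have pos: "\<And>i. i \<ge> k \<Longrightarrow> 0 < \<phi> i" using assms(1,2) by (auto intro: test_funs_pos)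
  have "0 < \<rho> * \<phi> k" using assms(3)[of k] pos[of "k+1"] by linarith
  then have \<rho>0: "0 < \<rho>" using pos[of k] by (simp add: zero_less_mult_iff)
  define \<eta> where "\<eta> = - ln \<rho> / 2"
  have \<eta>: "\<eta> > 0" using \<rho> \<rho>0 by (simp add: \<eta>_def)
  obtain k' where k': "k' \<ge> 1" "\<And>i. i \<ge> k' \<Longrightarrow> \<bar>ln (\<phi> i)\<bar> \<le> \<eta> * real_of_int i"
    using test_funs_subexponential[OF assms(1) \<eta>] by blast
  define c where "c = - ln (\<phi> k) - 2 * \<eta> * real_of_int k"
  obtain i where i: "i \<ge> max k k'" "real_of_int i > - c / \<eta>"
    by (metis ex_less_of_int less_le_trans linorder_linear max.cobounded1 max.cobounded2
        max_def of_int_le_iff)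
  \<comment> \<open>The reciprocal of \<phi> then grows geometrically, so the linear lower bound
    applies to \<open>- ln (\<phi> i)\<close>.\<close>
  have step: "inverse \<rho> * inverse (\<phi> i) \<le> inverse (\<phi> (i + 1))" if "i \<ge> k" for i
    using assms(3)[OF that] pos[of i] pos[of "i+1"] that \<rho>0 by (auto simp: field_simps)
  have "c + 2 * \<eta> * real_of_int i \<le> - ln (\<phi> i)"
    using geometric_lower[of k "inverse \<rho>" "\<lambda>i. inverse (\<phi> i)" i] step \<rho>0 i pos[of i] pos[of k] pos
    by (simp add: c_def \<eta>_def algebra_simps ln_inverse)
  also have "\<dots> \<le> \<eta> * real_of_int i" using k'(2)[of i] i by auto
  finally have "\<eta> * real_of_int i \<le> - c" by simp
  with i(2) \<eta> show False by (simp add: field_simps)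
qed

section \<open>Monotone limits and attainment of the minimal slope\<close>

lemma incseq_int_Lim:
  fixes F :: "int \<Rightarrow> real"
  assumes "mono F" "bdd_above (range F)"
  shows "Lim at_top F = (SUP n. F n)"
proof -
  have "(F \<longlongrightarrow> (SUP n. F n)) at_top"
  proof (rule order_tendstoI)
    fix a assume "a < (SUP n. F n)"
    then obtain n where "a < F n" using assms(2) by (auto simp: less_cSUP_iff)
    then show "\<forall>\<^sub>F n in at_top. a < F n"
      using monoD[OF assms(1)] unfolding eventually_at_top_linorder by (meson less_le_trans)
  next
    fix a assume "(SUP n. F n) < a"
    then show "\<forall>\<^sub>F n in at_top. F n < a"
      using cSUP_upper[OF UNIV_I assms(2)] by (meson always_eventually le_less_trans)
  qed
  then show ?thesis by (rule tendsto_Lim[rotated]) simp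
qed

lemma decseq_int_Lim:
  fixes F :: "int \<Rightarrow> real"
  assumes "antimono F" "bdd_below (range F)"
  shows "Lim at_top F = (INF n. F n)"
proof -
  have "(F \<longlongrightarrow> (INF n. F n)) at_top"
  proof (rule order_tendstoI)
    fix a assume "(INF n. F n) < a"
    then obtain n where "F n < a" using assms(2) by (auto simp: cINF_less_iff)
    then show "\<forall>\<^sub>F n in at_top. F n < a"
      using antimonoD[OF assms(1)] unfolding eventually_at_top_linorder by (meson le_less_trans)
  next
    fix a assume "a < (INF n. F n)"
    then show "\<forall>\<^sub>F n in at_top. a < F n"
      using cINF_lower[OF assms(2) UNIV_I] by (meson always_eventually less_le_trans)
  qed
  then show ?thesis by (rule tendsto_Lim[rotated]) simp
qed

text \<open>The positive lower bound makes G(-p)/p blow up as p tends to 0, the exponential growth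
  does so at infinity, and the first assumption gives continuity, so the minimum is taken on a
  compact interval.\<close>

lemma min_slope_attained:
  fixes G :: "real \<Rightarrow> real"
  assumes loglip: "\<And>p q. G q + C \<le> exp \<bar>q - p\<bar> * (G p + C)"
    and lower: "0 < \<delta>" "\<And>p. \<delta> \<le> G p"
    and growth: "0 < m" "\<And>p. 0 < p \<Longrightarrow> m * exp p - C \<le> G (- p)"
  shows "\<exists>p>0. \<forall>q>0. G (- p) / p \<le> G (- q) / q"
proof -
  have cont: "continuous_on UNIV G"
    unfolding continuous_on_def
  proof safe
    fix p :: real
    have "((\<lambda>q. exp \<bar>q - p\<bar> * (G p + C) - C) \<longlongrightarrow> exp \<bar>p - p\<bar> * (G p + C) - C) (at p)"
      by (intro tendsto_intros)
    then have up: "((\<lambda>q. exp \<bar>q - p\<bar> * (G p + C) - C) \<longlongrightarrow> G p) (at p)" by simp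
    have "((\<lambda>q. exp (- \<bar>p - q\<bar>) * (G p + C) - C) \<longlongrightarrow> exp (- \<bar>p - p\<bar>) * (G p + C) - C) (at p)"
      by (intro tendsto_intros)
    then have lo: "((\<lambda>q. exp (- \<bar>p - q\<bar>) * (G p + C) - C) \<longlongrightarrow> G p) (at p)" by simp
    show "(G \<longlongrightarrow> G p) (at p)"
    proof (rule tendsto_sandwich[OF _ _ lo up]; rule always_eventually; intro allI)
      fix q show "exp (- \<bar>p - q\<bar>) * (G p + C) - C \<le> G q"
        using loglip[of p q] by (simp add: exp_minus field_simps)
      show "G q \<le> exp \<bar>q - p\<bar> * (G p + C) - C"
        using loglip[of q p] by simp
    qed
  qed
  define A where "A = G (- 1)"
  have A: "A > 0" using lower(1) lower(2)[of "- 1"] by (simp add: A_def)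
  \<comment> \<open>Outside \<open>{a..b}\<close> the quotient is at least \<open>A\<close>, its
    value at 1, and 1 lies in the interval.\<close>
  define a where "a = min 1 (\<delta> / A)"
  define b where "b = max 1 (2 * (A + \<bar>C\<bar>) / m)"
  have a: "0 < a" "a \<le> 1" using lower A by (auto simp: a_def)
  have "continuous_on {a..b} (\<lambda>q. G (- q) / q)"
    using a by (intro continuous_intros continuous_on_compose2[OF cont]) auto
  then obtain p where p: "p \<in> {a..b}" "\<And>q. q \<in> {a..b} \<Longrightarrow> G (- p) / p \<le> G (- q) / q"
    using continuous_attains_inf[of "{a..b}"] a by (force simp: b_def)
  have p1: "G (- p) / p \<le> A" using p(2)[of 1] a by (simp add: A_def b_def)
  have "G (- p) / p \<le> G (- q) / q" if q: "q > 0" for q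
  proof -
    consider "q \<in> {a..b}" | "q < a" | "q > b" by fastforce
    then show ?thesis
    proof cases
      case 1 then show ?thesis by (rule p(2))
    next
      case 2
      then have "q \<le> \<delta> / A" by (simp add: a_def)
      then have "A * q \<le> \<delta>" using A by (simp add: field_simps)
      then have "A * q \<le> G (- q)" using lower(2)[of "- q"] by linarith
      then have "A \<le> G (- q) / q" using q by (simp add: field_simps)
      then show ?thesis using p1 by simp
    next
      case 3
      then have q1: "q \<ge> 1" "q \<ge> 2 * (A + \<bar>C\<bar>) / m" by (auto simp: b_def)
      then have "A + \<bar>C\<bar> \<le> m * q / 2" using growth(1) by (simp add: field_simps)
      then have "(A + \<bar>C\<bar>) * q \<le> m * q / 2 * q" using q by (simp add: mult_right_mono)
      also have "\<dots> = m * (q\<^sup>2 / 2)" by (simp add: power2_eq_square)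
      also have "\<dots> \<le> m * exp q"
        using exp_lower_Taylor_quadratic[of q] growth(1) q by (intro mult_left_mono) auto
      also have "\<dots> \<le> G (- q) + \<bar>C\<bar> * q"
      proof -
        have "\<bar>C\<bar> * 1 \<le> \<bar>C\<bar> * q" using q1 by (intro mult_left_mono) auto
        then show ?thesis using growth(2)[OF q] by linarith
      qed
      finally have "A * q \<le> G (- q)" by (simp add: algebra_simps)
      then have "A \<le> G (- q) / q" using q by (simp add: field_simps)
      then show ?thesis using p1 by simp
    qed
  qed
  then show ?thesis using p(1) a by (intro exI[of _ p]) auto
qed

section \<open>Touching principle and auxiliary computations\<close>

text \<open>At the first time some component reaches 0 its derivative is positive, so it was
  negative just before, which contradicts the choice of that time. Finiteness of \<open>I\<close>
  makes the set of bad times closed, so a first one exists.\<close>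

lemma first_touch:
  fixes w :: "real \<Rightarrow> 'a \<Rightarrow> real"
  assumes fin: "finite I"
    and cont: "\<And>i. i \<in> I \<Longrightarrow> continuous_on {t0..t1} (\<lambda>t. w t i)"
    and init: "\<And>i. i \<in> I \<Longrightarrow> 0 < w t0 i"
    and touch: "\<And>t i. \<lbrakk>t0 < t; t \<le> t1; i \<in> I; w t i = 0; \<And>j. j \<in> I \<Longrightarrow> 0 \<le> w t j\<rbrakk>
      \<Longrightarrow> \<exists>D>0. ((\<lambda>\<tau>. w \<tau> i) has_real_derivative D) (at t)"
    and t: "t \<in> {t0..t1}" and i: "i \<in> I"
  shows "0 < w t i"
proof (rule ccontr)
  assume neg: "\<not> 0 < w t i"
  define B where "B = (\<Union>i\<in>I. {t0..t1} \<inter> (\<lambda>t. w t i) -` {..0})"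
  have "closed B"
    unfolding B_def using fin
    by (intro closed_UN ballI continuous_closed_preimage cont) auto
  moreover have "t \<in> B" using neg t i by (auto simp: B_def intro!: bexI[of _ i])
  moreover have bdd: "bdd_below B" by (auto simp: B_def intro!: bdd_belowI[of _ t0])
  ultimately have "Inf B \<in> B" by (intro closed_contains_Inf) auto
  define T where "T = Inf B"
  obtain k where k: "k \<in> I" "w T k \<le> 0" and T: "t0 \<le> T" "T \<le> t1"
    using \<open>Inf B \<in> B\<close> by (auto simp: B_def T_def)
  have T0: "t0 < T" using T init[OF k(1)] k(2) by (cases "T = t0") auto
  have before: "T \<le> s" if "t0 \<le> s" "s \<le> t1" "j \<in> I" "w s j \<le> 0" for s j
    unfolding T_def using that by (intro cInf_lower[OF _ bdd]) (auto simp: B_def)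
  have nonneg: "0 \<le> w T j" if j: "j \<in> I" for j
  proof (rule ccontr)
    assume neg: "\<not> 0 \<le> w T j"
    obtain s where s: "t0 \<le> s" "s \<le> T" "w s j = 0"
      using IVT2'[of "\<lambda>t. w t j" T 0 t0] neg init[OF j] T
        continuous_on_subset[OF cont[OF j], of "{t0..T}"] by auto
    then show False using before[of s j] neg j T by auto
  qed
  then have "w T k = 0" using k by (simp add: order_antisym)
  then obtain D where "D > 0" "((\<lambda>\<tau>. w \<tau> k) has_real_derivative D) (at T)"
    using touch[OF T0 T(2) k(1)] nonneg by blast
  then obtain e where e: "e > 0" "\<And>h. 0 < h \<Longrightarrow> h < e \<Longrightarrow> w (T - h) k < w T k"
    using DERIV_pos_inc_left by blast
  define h where "h = min (e / 2) ((T - t0) / 2)"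
  have "0 < h" "h < e" "h < T - t0" using e T0 by (auto simp: h_def min_def)
  then show False using e(2)[of h] before[of "T - h" k] k T \<open>w T k = 0\<close> by auto
qed

text \<open>The shooting solution in \<open>growing_bump_exists\<close>. Index 0 is the site just
  left of the bump, with boundary value 0; index 1 is the left end, so indices are shifted by one
  against sites.\<close>

fun three_term :: "(nat \<Rightarrow> real) \<Rightarrow> (nat \<Rightarrow> real) \<Rightarrow> nat \<Rightarrow> real" where
  "three_term \<alpha> \<beta> 0 = 0"
| "three_term \<alpha> \<beta> (Suc 0) = 1"
| "three_term \<alpha> \<beta> (Suc (Suc k)) = \<alpha> k * three_term \<alpha> \<beta> (Suc k) - \<beta> k * three_term \<alpha> \<beta> k"

text \<open>Compares a parabola centred on the moving ray at time \<open>t\<close> with one centred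
  on a fixed site at time \<open>s\<close>: \<tau> is the time difference and \<open>e\<close> the
  offset of that site from the ray. The factor 4 combines 2 from splitting the square with 2 from t
  \<ge> s/2.\<close>

lemma quadratic_drift:
  fixes j e \<tau> w s t \<theta> \<eta> :: real
  assumes "0 < s" "s / 2 \<le> t" "0 \<le> \<tau>" "\<tau> \<le> \<theta> * s" "\<bar>e\<bar> \<le> \<eta> * s" "0 \<le> \<eta>" "\<eta> \<le> 1"
  shows "(j + e + w * \<tau>)\<^sup>2 / t \<le> 4 * (j\<^sup>2 / s) + 8 * \<eta> * s + 8 * w\<^sup>2 * \<theta> * \<tau>"
proof -
  have "(j + e + w * \<tau>)\<^sup>2 \<le> 2 * j\<^sup>2 + 4 * e\<^sup>2 + 4 * (w * \<tau>)\<^sup>2"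
    using zero_le_power2[of "j - (e + w * \<tau>)"] zero_le_power2[of "e - w * \<tau>"]
    by (simp add: power2_sum power2_diff algebra_simps)
  also have "e\<^sup>2 \<le> \<eta> * s\<^sup>2"
  proof -
    have "e\<^sup>2 \<le> (\<eta> * s)\<^sup>2" using power_mono[OF assms(5), of 2] by simp
    also have "\<dots> = \<eta> * (\<eta> * s\<^sup>2)" by (simp add: power2_eq_square)
    also have "\<dots> \<le> 1 * (\<eta> * s\<^sup>2)" using assms by (intro mult_right_mono) auto
    finally show ?thesis by simp
  qed
  also have "(w * \<tau>)\<^sup>2 \<le> w\<^sup>2 * (\<theta> * s * \<tau>)"
    using mult_right_mono[OF assms(4) assms(3)]
    unfolding power_mult_distrib by (intro mult_left_mono) (auto simp: power2_eq_square)
  finally have "(j + e + w * \<tau>)\<^sup>2 \<le> 2 * j\<^sup>2 + 4 * (\<eta> * s\<^sup>2) + 4 * (w\<^sup>2 * (\<theta> * s * \<tau>))" by simp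
  then have "(j + e + w * \<tau>)\<^sup>2 / t \<le> (2 * j\<^sup>2 + 4 * (\<eta> * s\<^sup>2) + 4 * (w\<^sup>2 * (\<theta> * s * \<tau>))) / (s / 2)"
    using assms by (intro frac_le order_trans[OF zero_le_power2]) auto
  also have "\<dots> = 4 * (j\<^sup>2 / s) + 8 * \<eta> * s + 8 * w\<^sup>2 * \<theta> * \<tau>"
    using assms(1) by (simp add: field_simps power2_eq_square)
  finally show ?thesis .
qed

section \<open>Generalized principal eigenvalues\<close>

text \<open>Only the linearisation at 0 enters the eigenvalues. \<open>\<delta>\<close> and
  \<open>N\<close> quantify the condition on the limit inferior; \<open>K\<close> bounds
  \<open>r\<close> here and is also the Hoelder constant in \<open>kpp_solution\<close>.\<close>

locale kpp_medium =
  fixes d d' :: "int \<Rightarrow> real" and f :: "int \<Rightarrow> real \<Rightarrow> real" and m M K \<delta> :: real and N :: int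
  assumes m_pos: "0 < m"
    and d_ge: "\<And>i. m \<le> d i" and d_le: "\<And>i. d i \<le> M"
    and d'_ge: "\<And>i. m \<le> d' i" and d'_le: "\<And>i. d' i \<le> M"
    and r_nonneg: "\<And>i. 0 \<le> deriv_s f i 0" and r_le: "\<And>i. deriv_s f i 0 \<le> K"
    and \<delta>_pos: "0 < \<delta>"
    and gap: "\<And>i. N \<le> \<bar>i\<bar> \<Longrightarrow> \<delta> \<le> deriv_s f i 0 - (sqrt (d' i) - sqrt (d i))\<^sup>2"
begin

abbreviation r where "r i \<equiv> deriv_s f i 0"

lemma d_pos: "0 < d i" and d'_pos: "0 < d' i"
  using m_pos d_ge[of i] d'_ge[of i] by linarith+

lemma M_pos: "0 < M"
  using d_pos d_le less_le_trans by blast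

lemma diag_le: "d i + d' i - r i \<le> 2 * M"
  using d_le[of i] d'_le[of i] r_nonneg[of i] by linarith

lemma diag_gap:
  assumes "N \<le> \<bar>i\<bar>"
  shows "d i + d' i - r i \<le> 2 * (sqrt (d i) * sqrt (d' i)) - \<delta>"
proof -
  have "(sqrt (d' i) - sqrt (d i))\<^sup>2 = d' i + d i - 2 * (sqrt (d i) * sqrt (d' i))"
    using d_pos[of i] d'_pos[of i] by (simp add: power2_diff)
  then show ?thesis using gap[OF assms] by linarith
qed

text \<open>Here \<open>x\<close> is a ratio of consecutive values. With \<open>diag_gap\<close> it
  says that no constant ratio makes the operator value drop below \<delta> at sites beyond
  \<open>N\<close>.\<close>

lemma amgm:
  assumes "0 < x"
  shows "2 * (sqrt (d i) * sqrt (d' i)) \<le> d' i * x + d i / x"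
proof -
  have "0 \<le> (sqrt (d' i) * x - sqrt (d i))\<^sup>2 / x" using assms by simp
  also have "\<dots> = (d' i * x\<^sup>2 + d i - 2 * x * (sqrt (d i) * sqrt (d' i))) / x"
    using d_pos[of i] d'_pos[of i] by (simp add: power2_diff power_mult_distrib algebra_simps)
  also have "\<dots> = d' i * x + d i / x - 2 * (sqrt (d i) * sqrt (d' i))"
    using assms by (simp add: field_simps power2_eq_square)
  finally show ?thesis by simp
qed

text \<open>Let x and x' be the ratios before and after site \<open>i\<close>. The hypothesis bounds
  d' x' + d/x above, while \<open>amgm\<close> and the gap bound d' x + d/x below; subtracting
  leaves d' (x' - x) \<le> -(\<delta> - l).\<close>

lemma ratio_step:
  assumes "N \<le> \<bar>i\<bar>" "0 < y0" "0 < y1" "l \<le> \<delta>"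
    and "d' i * y2 + d i * y0 \<le> (l + (d i + d' i - r i)) * y1"
  shows "y2 / y1 \<le> y1 / y0 - (\<delta> - l) / M"
proof -
  have "d' i * (y2 / y1) + d i / (y1 / y0) = (d' i * y2 + d i * y0) / y1"
    using assms by (simp add: field_simps)
  also have "\<dots> \<le> l + (d i + d' i - r i)"
    using assms by (simp add: divide_le_eq)
  also have "\<dots> \<le> l - \<delta> + (d' i * (y1 / y0) + d i / (y1 / y0))"
    using diag_gap[OF assms(1)] amgm[of "y1 / y0" i] assms by auto
  finally have "d' i * (y2 / y1) \<le> d' i * (y1 / y0) - (\<delta> - l)" by simp
  then have "y2 / y1 \<le> y1 / y0 - (\<delta> - l) / d' i"
    using d'_pos[of i] by (simp add: field_simps)
  moreover have "(\<delta> - l) / M \<le> (\<delta> - l) / d' i"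
    using d'_pos[of i] d'_le[of i] assms by (intro divide_left_mono) (auto simp: M_pos)
  ultimately show ?thesis by simp
qed

text \<open>The eigenvalue shifted by \<open>2 * M\<close> controls the off-diagonal part, which is
  nonnegative and hence loses at most the factor \<open>exp (- h)\<close>. The factors \<alpha>,
  \<beta> come from a change of exponent or from the Gaussian cut-off.\<close>

lemma perturb_lower:
  assumes "l * \<phi> i \<le> lin_op_p d d' f p \<phi> i"
    and "0 \<le> \<phi> (i - 1)" "0 \<le> \<phi> i" "0 \<le> \<phi> (i + 1)" "0 \<le> h" "exp (- h) \<le> \<alpha>" "exp (- h) \<le> \<beta>"
  shows "(exp (- h) * (l + 2 * M) - 2 * M) * \<phi> i
     \<le> d' i * exp p * \<alpha> * \<phi> (i + 1) + d i * exp (- p) * \<beta> * \<phi> (i - 1) - (d i + d' i - r i) * \<phi> i"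
proof -
  define c where "c = d i + d' i - r i"
  have c: "c \<le> 2 * M" unfolding c_def by (rule diag_le)
  have "0 \<le> ((1 - exp (- h)) * (2 * M - c)) * \<phi> i"
    using c assms by (intro mult_nonneg_nonneg) auto
  then have "(exp (- h) * (l + 2 * M) - 2 * M) * \<phi> i \<le> exp (- h) * (l * \<phi> i + c * \<phi> i) - c * \<phi> i"
    by (simp add: algebra_simps)
  also have "\<dots> \<le> exp (- h) * (d' i * exp p * \<phi> (i + 1) + d i * exp (- p) * \<phi> (i - 1)) - c * \<phi> i"
    using assms(1) unfolding lin_op_p_eq c_def[symmetric]
    by (intro diff_right_mono mult_left_mono) auto
  also have "\<dots> \<le> (\<alpha> * (d' i * exp p * \<phi> (i + 1)) + \<beta> * (d i * exp (- p) * \<phi> (i - 1))) - c * \<phi> i"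
    using assms d_pos[of i] d'_pos[of i] unfolding distrib_left
    by (intro diff_right_mono add_mono mult_right_mono) auto
  finally show ?thesis by (simp add: c_def algebra_simps)
qed

lemma perturb_upper:
  assumes "lin_op_p d d' f p \<phi> i \<le> l * \<phi> i"
    and "0 \<le> \<phi> (i - 1)" "0 \<le> \<phi> i" "0 \<le> \<phi> (i + 1)" "0 \<le> h" "\<alpha> \<le> exp h" "\<beta> \<le> exp h"
  shows "d' i * exp p * \<alpha> * \<phi> (i + 1) + d i * exp (- p) * \<beta> * \<phi> (i - 1) - (d i + d' i - r i) * \<phi> i
     \<le> (exp h * (l + 2 * M) - 2 * M) * \<phi> i"
proof -
  define c where "c = d i + d' i - r i"
  have c: "c \<le> 2 * M" unfolding c_def by (rule diag_le)
  have "d' i * exp p * \<alpha> * \<phi> (i + 1) + d i * exp (- p) * \<beta> * \<phi> (i - 1) - c * \<phi> i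
      = (\<alpha> * (d' i * exp p * \<phi> (i + 1)) + \<beta> * (d i * exp (- p) * \<phi> (i - 1))) - c * \<phi> i"
    by (simp add: algebra_simps)
  also have "\<dots> \<le> exp h * (d' i * exp p * \<phi> (i + 1) + d i * exp (- p) * \<phi> (i - 1)) - c * \<phi> i"
    using assms d_pos[of i] d'_pos[of i] unfolding distrib_left
    by (intro diff_right_mono add_mono mult_right_mono) auto
  also have "\<dots> \<le> exp h * (l * \<phi> i + c * \<phi> i) - c * \<phi> i"
    using assms(1) unfolding lin_op_p_eq c_def[symmetric]
    by (intro diff_right_mono mult_left_mono) auto
  also have "0 \<le> ((exp h - 1) * (2 * M - c)) * \<phi> i"
    using c assms by (intro mult_nonneg_nonneg) auto
  then have "exp h * (l * \<phi> i + c * \<phi> i) - c * \<phi> i \<le> (exp h * (l + 2 * M) - 2 * M) * \<phi> i"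
    by (simp add: algebra_simps)
  finally show ?thesis by (simp add: c_def)
qed

section \<open>Sets of admissible eigenvalue bounds and their dependence on the exponent\<close>

definition lower_set :: "real \<Rightarrow> int \<Rightarrow> real set" where
  "lower_set p n = {l. \<exists>\<phi>\<in>test_funs n. \<forall>i>n. lin_op_p d d' f p \<phi> i \<ge> l * \<phi> i}"

definition upper_set :: "real \<Rightarrow> int \<Rightarrow> real set" where
  "upper_set p n = {l. \<exists>\<phi>\<in>test_funs n. \<forall>i>n. lin_op_p d d' f p \<phi> i \<le> l * \<phi> i}"

lemma lower_set_mono: "n \<le> n' \<Longrightarrow> lower_set p n \<subseteq> lower_set p n'"
  unfolding lower_set_def by (auto intro!: bexI dest: subsetD[OF test_funs_mono])

lemma upper_set_mono: "n \<le> n' \<Longrightarrow> upper_set p n \<subseteq> upper_set p n'"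
  unfolding upper_set_def by (auto intro!: bexI dest: subsetD[OF test_funs_mono])

lemma lower_set_const:
  assumes "\<And>i. i > n \<Longrightarrow> l \<le> d' i * exp p + d i * exp (- p) - (d i + d' i - r i)"
  shows "l \<in> lower_set p n"
  unfolding lower_set_def using assms one_in_test_funs
  by (auto simp: lin_op_p_eq intro!: bexI[of _ "\<lambda>_. 1"])

text \<open>The constant test function already gives exponential growth as p tends to minus
  infinity, which keeps the minimising exponents of the speeds bounded.\<close>

lemma growth_in_lower_set: "m * exp (- p) - 2 * M \<in> lower_set p n"
proof (rule lower_set_const)
  fix i
  have "m * exp (- p) \<le> d i * exp (- p)" using d_ge by simp
  moreover have "0 \<le> d' i * exp p" using d'_pos[of i] by simp
  ultimately show "m * exp (- p) - 2 * M \<le> d' i * exp p + d i * exp (- p) - (d i + d' i - r i)"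
    using diag_le[of i] by linarith
qed

text \<open>\<open>amgm\<close> with \<open>x = exp p\<close>, for the constant test function. This
  makes \<open>H_lower\<close> at least \<delta>, hence positive, at every exponent.\<close>

lemma \<delta>_in_lower_set: "\<delta> \<in> lower_set p (max n (max N 0))"
proof (rule lower_set_const)
  fix i assume "i > max n (max N 0)"
  then have "N \<le> \<bar>i\<bar>" by auto
  then show "\<delta> \<le> d' i * exp p + d i * exp (- p) - (d i + d' i - r i)"
    using diag_gap[of i] amgm[of "exp p" i] by (simp add: exp_minus divide_inverse)
qed

lemma upper_set_nonempty: "upper_set p n \<noteq> {}"
proof -
  have "M * exp p + M * exp (- p) + K \<in> upper_set p n"
    unfolding upper_set_def
  proof (safe intro!: bexI[of _ "\<lambda>_. 1"] one_in_test_funs)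
    fix i
    have "d' i * exp p \<le> M * exp p" "d i * exp (- p) \<le> M * exp (- p)"
      using d_le d'_le by simp_all
    then show "lin_op_p d d' f p (\<lambda>_. 1) i \<le> (M * exp p + M * exp (- p) + K) * 1"
      using r_le[of i] d_pos[of i] d'_pos[of i] unfolding lin_op_p_eq mult_1_right by linarith
  qed
  then show ?thesis by blast
qed

text \<open>A larger value would force either the forward or the backward ratios of the
  test function to be at least 2 from some point on.\<close>

lemma lower_set_bounded:
  assumes "l \<in> lower_set p n"
  shows "l \<le> K + 4 * (M * exp \<bar>p\<bar>)"
proof (rule ccontr)
  assume "\<not> ?thesis"
  then have l: "4 * (M * exp \<bar>p\<bar>) < l - K" by simp
  obtain \<phi> where \<phi>: "\<phi> \<in> test_funs n" "\<And>i. i > n \<Longrightarrow> l * \<phi> i \<le> lin_op_p d d' f p \<phi> i"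
    using assms by (auto simp: lower_set_def)
  note pos = test_funs_pos[OF \<phi>(1)]
  have step: "4 * \<phi> i \<le> \<phi> (i + 1) + \<phi> (i - 1)" if "i > n" for i
  proof -
    have p: "0 < \<phi> i" "0 < \<phi> (i + 1)" "0 < \<phi> (i - 1)" using that by (auto intro!: pos)
    have "(4 * (M * exp \<bar>p\<bar>)) * \<phi> i \<le> (l - K) * \<phi> i"
      using l p by (intro mult_right_mono) auto
    also have "\<dots> \<le> l * \<phi> i - (r i - d i - d' i) * \<phi> i"
    proof -
      have "(r i - d i - d' i) * \<phi> i \<le> K * \<phi> i"
        using r_le[of i] d_pos[of i] d'_pos[of i] p by (intro mult_right_mono) auto
      then show ?thesis by (simp add: algebra_simps)
    qed
    also have "\<dots> \<le> d' i * exp p * \<phi> (i + 1) + d i * exp (- p) * \<phi> (i - 1)"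
      using \<phi>(2)[OF that] unfolding lin_op_p_eq by (simp add: algebra_simps)
    also have "\<dots> \<le> (M * exp \<bar>p\<bar>) * \<phi> (i + 1) + (M * exp \<bar>p\<bar>) * \<phi> (i - 1)"
      using p d_le d'_le d_pos[of i] d'_pos[of i] M_pos
      by (intro add_mono mult_right_mono mult_mono) auto
    finally have "(M * exp \<bar>p\<bar>) * (4 * \<phi> i) \<le> (M * exp \<bar>p\<bar>) * (\<phi> (i + 1) + \<phi> (i - 1))"
      by (simp add: algebra_simps)
    then show ?thesis using M_pos by (subst (asm) mult_le_cancel_left_pos) auto
  qed
  show False
  \<comment> \<open>If some forward ratio reaches 2, \<open>step\<close> makes the next one at least
    7/2, so all later ones are at least 2. If none does, \<open>step\<close> gives \<phi>(i) \<ge> 4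
    \<phi>(i+1) - \<phi>(i+2) > 2 \<phi>(i+1) throughout.\<close>
  proof (cases "\<exists>k\<ge>n. 2 * \<phi> k \<le> \<phi> (k + 1)")
    case True
    then obtain k where k: "k \<ge> n" "2 * \<phi> k \<le> \<phi> (k + 1)" by blast
    have "2 * \<phi> i \<le> \<phi> (i + 1)" if "i \<ge> k" for i
      using that
    proof (induction i rule: int_ge_induct)
      case (step i)
      then show ?case using \<open>\<And>i. i > n \<Longrightarrow> 4 * \<phi> i \<le> \<phi> (i + 1) + \<phi> (i - 1)\<close>[of "i + 1"] k pos[of i] pos[of "i+1"] by auto
    qed (use k in auto)
    then show False using test_funs_ratio_ge[OF \<phi>(1) k(1), of 2] by auto
  next
    case False
    have "\<phi> (i + 1) \<le> (1/2) * \<phi> i" if "i \<ge> n" for i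
    proof -
      have "\<phi> (i + 1 + 1) < 2 * \<phi> (i + 1)" using False that by (smt (verit))
      then show ?thesis using step[of "i + 1"] that by auto
    qed
    then show False using test_funs_ratio_le[OF \<phi>(1) order_refl, of "1/2"] by auto
  qed
qed

text \<open>For l < \<delta>, \<open>ratio_step\<close> would lower the ratios of
  \<open>exp (p i) \<phi>\<^sub>i\<close> by a fixed amount at every step, and they would become
  negative.\<close>

lemma upper_set_ge_\<delta>:
  assumes "l \<in> upper_set p n"
  shows "\<delta> \<le> l"
proof (rule ccontr)
  assume "\<not> \<delta> \<le> l"
  then have l: "l < \<delta>" by simp
  obtain \<phi> where \<phi>: "\<phi> \<in> test_funs n" "\<And>i. i > n \<Longrightarrow> lin_op_p d d' f p \<phi> i \<le> l * \<phi> i"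
    using assms by (auto simp: upper_set_def)
  note pos = test_funs_pos[OF \<phi>(1)]
  define x where "x i = exp p * \<phi> (i + 1) / \<phi> i" for i
  define k where "k = max n (max N 0)"
  have k: "k \<ge> n" "k \<ge> N" "k \<ge> 0" by (auto simp: k_def)
  have xpos: "0 < x i" if "i \<ge> k" for i
    using that k by (auto simp: x_def intro!: divide_pos_pos mult_pos_pos pos)
  have step: "x (i + 1) \<le> x i - (\<delta> - l) / M" if "i \<ge> k" for i
  proof -
    have p: "0 < \<phi> i" "0 < \<phi> (i + 1)" using that k by (auto intro!: pos)
    have "d' (i + 1) * (exp p * \<phi> (i + 1 + 1)) + d (i + 1) * (exp (- p) * \<phi> i)
        \<le> (l + (d (i + 1) + d' (i + 1) - r (i + 1))) * \<phi> (i + 1)"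
      using \<phi>(2)[of "i + 1"] that k unfolding lin_op_p_eq by (simp add: algebra_simps)
    then have "exp p * \<phi> (i + 1 + 1) / \<phi> (i + 1) \<le> \<phi> (i + 1) / (exp (- p) * \<phi> i) - (\<delta> - l) / M"
      using p l that k by (intro ratio_step[of "i + 1"]) auto
    then show ?thesis by (simp add: x_def exp_minus field_simps)
  qed
  have "x i \<le> x k - (\<delta> - l) / M * real_of_int (i - k)" if "i \<ge> k" for i
    using that
  proof (induction i rule: int_ge_induct)
    case (step i)
    have "(\<delta> - l) / M * real_of_int (i + 1 - k) = (\<delta> - l) / M * real_of_int (i - k) + (\<delta> - l) / M"
    proof -
      have e: "real_of_int (i + 1 - k) = real_of_int (i - k) + 1" by simp
      show ?thesis unfolding e distrib_left by simp
    qed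
    then show ?case
      using step \<open>\<And>i. i \<ge> k \<Longrightarrow> x (i + 1) \<le> x i - (\<delta> - l) / M\<close>[of i] by linarith
  qed simp
  moreover obtain j :: nat where "x k / ((\<delta> - l) / M) < real j"
    using reals_Archimedean2 by blast
  then have "x k < (\<delta> - l) / M * real j" using l M_pos by (simp add: field_simps)
  ultimately show False using xpos[of "k + int j"] by (smt (verit) of_int_of_nat_eq of_nat_0_le_iff)
qed

text \<open>Dropping the forward term turns the eigenvalue inequality into a lower bound for forward
  ratios, and such a bound cannot exceed 1.\<close>

lemma upper_set_growth:
  assumes "l \<in> upper_set p n"
  shows "m * exp (- p) - 2 * M \<le> l"
proof -
  obtain \<phi> where \<phi>: "\<phi> \<in> test_funs n" "\<And>i. i > n \<Longrightarrow> lin_op_p d d' f p \<phi> i \<le> l * \<phi> i"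
    using assms by (auto simp: upper_set_def)
  note pos = test_funs_pos[OF \<phi>(1)]
  have l: "0 < l + 2 * M" using upper_set_ge_\<delta>[OF assms] \<delta>_pos M_pos by linarith
  have "m * exp (- p) / (l + 2 * M) * \<phi> i \<le> \<phi> (i + 1)" if "i \<ge> n" for i
  proof -
    have p: "0 < \<phi> i" "0 < \<phi> (i + 1)" "0 < \<phi> (i + 1 + 1)" using that by (auto intro!: pos)
    have "m * exp (- p) * \<phi> i \<le> d (i + 1) * exp (- p) * \<phi> i"
      using d_ge p by simp
    also have "\<dots> \<le> d' (i + 1) * exp p * \<phi> (i + 1 + 1) + d (i + 1) * exp (- p) * \<phi> i"
      using d'_pos[of "i + 1"] p by simp
    also have "\<dots> \<le> (l + (d (i + 1) + d' (i + 1) - r (i + 1))) * \<phi> (i + 1)"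
      using \<phi>(2)[of "i + 1"] that unfolding lin_op_p_eq by (simp add: algebra_simps)
    also have "\<dots> \<le> (l + 2 * M) * \<phi> (i + 1)"
      using diag_le[of "i + 1"] p by (intro mult_right_mono) auto
    finally show ?thesis using l by (simp add: field_simps)
  qed
  then have "m * exp (- p) / (l + 2 * M) \<le> 1"
    using test_funs_ratio_ge[OF \<phi>(1) order_refl] by blast
  then show ?thesis using l by (simp add: field_simps)
qed

text \<open>The same \<phi> serves at exponent \<open>q\<close>: the off-diagonal weights shrink by
  at most \<open>exp (- \<bar>q - p\<bar>)\<close>.\<close>

lemma lower_set_loglip:
  assumes "l \<in> lower_set p n"
  shows "exp (- \<bar>q - p\<bar>) * (l + 2 * M) - 2 * M \<in> lower_set q n"
proof -
  obtain \<phi> where \<phi>: "\<phi> \<in> test_funs n" "\<And>i. i > n \<Longrightarrow> l * \<phi> i \<le> lin_op_p d d' f p \<phi> i"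
    using assms by (auto simp: lower_set_def)
  note pos = test_funs_pos[OF \<phi>(1)]
  have "(exp (- \<bar>q - p\<bar>) * (l + 2 * M) - 2 * M) * \<phi> i \<le> lin_op_p d d' f q \<phi> i" if "i > n" for i
  proof -
    have e: "exp p * exp (q - p) = exp q" "exp (- p) * exp (- (q - p)) = exp (- q)"
      by (simp_all add: exp_add[symmetric])
    show ?thesis
      using perturb_lower[OF \<phi>(2)[OF that], of "\<bar>q - p\<bar>" "exp (q - p)" "exp (- (q - p))"]
        pos[of i] pos[of "i - 1"] pos[of "i + 1"] that
      unfolding lin_op_p_eq mult.assoc[of "d' i"] mult.assoc[of "d i"] e by auto
  qed
  then show ?thesis using \<phi>(1) by (auto simp: lower_set_def)
qed

lemma upper_set_loglip:
  assumes "l \<in> upper_set p n"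
  shows "exp \<bar>q - p\<bar> * (l + 2 * M) - 2 * M \<in> upper_set q n"
proof -
  obtain \<phi> where \<phi>: "\<phi> \<in> test_funs n" "\<And>i. i > n \<Longrightarrow> lin_op_p d d' f p \<phi> i \<le> l * \<phi> i"
    using assms by (auto simp: upper_set_def)
  note pos = test_funs_pos[OF \<phi>(1)]
  have "lin_op_p d d' f q \<phi> i \<le> (exp \<bar>q - p\<bar> * (l + 2 * M) - 2 * M) * \<phi> i" if "i > n" for i
  proof -
    have e: "exp p * exp (q - p) = exp q" "exp (- p) * exp (- (q - p)) = exp (- q)"
      by (simp_all add: exp_add[symmetric])
    show ?thesis
      using perturb_upper[OF \<phi>(2)[OF that], of "\<bar>q - p\<bar>" "exp (q - p)" "exp (- (q - p))"]
        pos[of i] pos[of "i - 1"] pos[of "i + 1"] that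
      unfolding lin_op_p_eq mult.assoc[of "d' i"] mult.assoc[of "d i"] e by auto
  qed
  then show ?thesis using \<phi>(1) by (auto simp: upper_set_def)
qed

lemma lower_set_bdd: "bdd_above (lower_set p n)"
  using lower_set_bounded by (auto simp: bdd_above_def)

lemma upper_set_bdd: "bdd_below (upper_set p n)"
  using upper_set_ge_\<delta> by (auto simp: bdd_below_def)

lemma lower_set_nonempty: "lower_set p n \<noteq> {}"
  using growth_in_lower_set by blast

section \<open>The limits in n and the two speeds\<close>

lemma H_lower_eq: "H_lower d d' f p = (SUP n. Sup (lower_set p n))"
  and H_lower_bdd: "bdd_above (range (\<lambda>n. Sup (lower_set p n)))"
proof -
  show b: "bdd_above (range (\<lambda>n. Sup (lower_set p n)))"
    unfolding bdd_above_def using lower_set_nonempty lower_set_bounded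
    by (auto intro!: exI[of _ "K + 4 * (M * exp \<bar>p\<bar>)"] cSup_least)
  show "H_lower d d' f p = (SUP n. Sup (lower_set p n))"
    unfolding H_lower_def lambda_lower_def lower_set_def[symmetric]
    by (rule incseq_int_Lim[OF _ b])
      (auto intro!: monoI cSup_subset_mono lower_set_nonempty lower_set_bdd lower_set_mono)
qed

lemma H_upper_eq: "H_upper d d' f p = (INF n. Inf (upper_set p n))"
  and H_upper_bdd: "bdd_below (range (\<lambda>n. Inf (upper_set p n)))"
proof -
  show b: "bdd_below (range (\<lambda>n. Inf (upper_set p n)))"
    unfolding bdd_below_def using upper_set_nonempty upper_set_ge_\<delta>
    by (auto intro!: exI[of _ \<delta>] cInf_greatest)
  show "H_upper d d' f p = (INF n. Inf (upper_set p n))"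
    unfolding H_upper_def lambda_upper_def upper_set_def[symmetric]
    by (rule decseq_int_Lim[OF _ b])
      (auto intro!: antimonoI cInf_superset_mono upper_set_nonempty upper_set_bdd upper_set_mono)
qed

lemma H_lower_upper: "l \<in> lower_set p n \<Longrightarrow> l \<le> H_lower d d' f p"
  unfolding H_lower_eq
  by (rule order_trans[OF cSup_upper[OF _ lower_set_bdd] cSUP_upper[OF UNIV_I H_lower_bdd]])

lemma H_lower_least: "(\<And>l n. l \<in> lower_set p n \<Longrightarrow> l \<le> c) \<Longrightarrow> H_lower d d' f p \<le> c"
  unfolding H_lower_eq by (intro cSUP_least cSup_least lower_set_nonempty) auto

lemma H_upper_lower: "l \<in> upper_set p n \<Longrightarrow> H_upper d d' f p \<le> l"
  unfolding H_upper_eq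
  by (rule order_trans[OF cINF_lower[OF H_upper_bdd UNIV_I] cInf_lower[OF _ upper_set_bdd]])

lemma H_upper_greatest: "(\<And>l n. l \<in> upper_set p n \<Longrightarrow> c \<le> l) \<Longrightarrow> c \<le> H_upper d d' f p"
  unfolding H_upper_eq by (intro cINF_greatest cInf_greatest upper_set_nonempty) auto

lemma H_lower_witness:
  assumes "c < H_lower d d' f p"
  obtains l n where "l \<in> lower_set p n" "c < l"
  using assms H_lower_least[of p c] by force

lemma H_upper_witness:
  assumes "H_upper d d' f p < c"
  obtains l n where "l \<in> upper_set p n" "l < c"
  using assms H_upper_greatest[of p c] by force

lemma H_lower_ge_\<delta>: "\<delta> \<le> H_lower d d' f p"
  using H_lower_upper[OF \<delta>_in_lower_set[of p 0]] .

text \<open>Attainment is what gives the \<open>LEAST\<close> in the definition its meaning. The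
  dependence on the exponent passes from the sets to the limit with shift
  \<open>2 * M\<close>.\<close>

lemma speed_lower_min:
  obtains p where "0 < p" "speed_lower d d' f = H_lower d d' f (- p) / p"
    "\<And>q. 0 < q \<Longrightarrow> speed_lower d d' f \<le> H_lower d d' f (- q) / q"
proof -
  have "\<exists>p>0. \<forall>q>0. H_lower d d' f (- p) / p \<le> H_lower d d' f (- q) / q"
  proof (rule min_slope_attained[OF _ \<delta>_pos H_lower_ge_\<delta> m_pos])
    show "H_lower d d' f q + 2 * M \<le> exp \<bar>q - p\<bar> * (H_lower d d' f p + 2 * M)" for p q
    proof -
      have "H_lower d d' f q \<le> exp \<bar>q - p\<bar> * (H_lower d d' f p + 2 * M) - 2 * M"
      proof (rule H_lower_least)
        fix l n assume "l \<in> lower_set q n"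
        from H_lower_upper[OF lower_set_loglip[OF this, of p]]
        have "exp (- \<bar>q - p\<bar>) * (l + 2 * M) \<le> H_lower d d' f p + 2 * M"
          by (simp add: abs_minus_commute)
        then show "l \<le> exp \<bar>q - p\<bar> * (H_lower d d' f p + 2 * M) - 2 * M"
          by (simp add: exp_minus field_simps)
      qed
      then show ?thesis by simp
    qed
    show "m * exp p - 2 * M \<le> H_lower d d' f (- p)" for p
      using H_lower_upper[OF growth_in_lower_set[of "- p" 0]] by simp
  qed
  then obtain p where p: "0 < p" "\<And>q. 0 < q \<Longrightarrow> H_lower d d' f (- p) / p \<le> H_lower d d' f (- q) / q"
    by blast
  have "speed_lower d d' f = H_lower d d' f (- p) / p"
    unfolding speed_lower_def using p by (intro Least_equality) auto
  with p that show ?thesis by metis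
qed

lemma speed_upper_min:
  obtains p where "0 < p" "speed_upper d d' f = H_upper d d' f (- p) / p"
proof -
  have "\<exists>p>0. \<forall>q>0. H_upper d d' f (- p) / p \<le> H_upper d d' f (- q) / q"
  proof (rule min_slope_attained[OF _ \<delta>_pos _ m_pos])
    show "H_upper d d' f q + 2 * M \<le> exp \<bar>q - p\<bar> * (H_upper d d' f p + 2 * M)" for p q
    proof -
      have "exp (- \<bar>q - p\<bar>) * (H_upper d d' f q + 2 * M) - 2 * M \<le> H_upper d d' f p"
      proof (rule H_upper_greatest)
        fix l n assume "l \<in> upper_set p n"
        from H_upper_lower[OF upper_set_loglip[OF this, of q]]
        show "exp (- \<bar>q - p\<bar>) * (H_upper d d' f q + 2 * M) - 2 * M \<le> l"
          by (simp add: exp_minus field_simps)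
      qed
      then show ?thesis by (simp add: exp_minus field_simps)
    qed
    show "\<delta> \<le> H_upper d d' f p" for p by (intro H_upper_greatest upper_set_ge_\<delta>)
    show "m * exp p - 2 * M \<le> H_upper d d' f (- p)" for p
      using upper_set_growth[of _ "- p"] by (intro H_upper_greatest) auto
  qed
  then obtain p where p: "0 < p" "\<And>q. 0 < q \<Longrightarrow> H_upper d d' f (- p) / p \<le> H_upper d d' f (- q) / q"
    by blast
  have "speed_upper d d' f = H_upper d d' f (- p) / p"
    unfolding speed_upper_def using p by (intro Least_equality) auto
  with p(1) that show ?thesis by metis
qed

section \<open>Compactly supported growing bumps\<close>

text \<open>A subsolution with zero boundary values that grows at rate \<open>l\<close>. It carries
  a quantitative lower bound \<open>c\<close> at the left end because lower bounds for
  \<open>u\<close> are later read off there.\<close>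

definition growing_bump :: "real \<Rightarrow> real \<Rightarrow> int \<Rightarrow> int \<Rightarrow> (int \<Rightarrow> real) \<Rightarrow> bool" where
  "growing_bump l c a b \<psi> \<longleftrightarrow> a \<le> b \<and> c \<le> \<psi> a \<and> (\<forall>i. 0 \<le> \<psi> i \<and> \<psi> i \<le> 1) \<and>
     (\<forall>i\<in>{a..b}. 0 < \<psi> i) \<and> (\<forall>i. i < a \<or> b < i \<longrightarrow> \<psi> i = 0) \<and>
     (\<forall>i\<in>{a..b}. l * \<psi> i \<le> d' i * (\<psi> (i + 1) - \<psi> i) + d i * (\<psi> (i - 1) - \<psi> i) + r i * \<psi> i)"

text \<open>Shooting: solve the eigenvalue recursion for \<open>\<delta>/2\<close> from the left end. By the gap condition
  the ratios of consecutive values decrease at a uniform rate, so the solution changes sign after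
  a uniformly bounded number of steps and can be cut off there.\<close>

lemma growing_bump_exists:
  "\<exists>L::nat. \<exists>c>0. \<exists>l>0. \<forall>a. (\<forall>i\<in>{a..a + int L}. N \<le> \<bar>i\<bar>) \<longrightarrow>
     (\<exists>b \<psi>. b \<le> a + int L \<and> growing_bump l c a b \<psi>)"
proof -
  \<comment> \<open>\<open>B\<close> bounds \<alpha>, hence the first ratio and all growth factors.
    \<open>L\<close> is large enough for a ratio at most \<open>B\<close> that falls by \<epsilon>
    per step to reach 0 within L - 1 steps; dividing by \<open>B ^ L\<close> brings all values below
    1.\<close>
  define B where "B = max 1 ((\<delta> / 2 + 2 * M) / m)"
  define \<epsilon> where "\<epsilon> = \<delta> / 2 / M"
  define L where "L = Suc (nat \<lceil>B / \<epsilon>\<rceil>)"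
  have \<epsilon>: "\<epsilon> > 0" using \<delta>_pos M_pos by (simp add: \<epsilon>_def)
  have B: "B \<ge> 1" by (simp add: B_def)
  have BL: "B ^ L > 0" using B by simp
  have L: "B \<le> \<epsilon> * real (L - 1)"
  proof -
    have "B / \<epsilon> \<le> real (L - 1)" by (simp add: L_def le_nat_iff) linarith
    then show ?thesis using \<epsilon> by (simp add: field_simps)
  qed
  have main: "\<exists>b \<psi>. b \<le> a + int L \<and> growing_bump (\<delta> / 2) (1 / B ^ L) a b \<psi>"
    if far: "\<forall>i\<in>{a..a + int L}. N \<le> \<bar>i\<bar>" for a
  proof -
    define p where "p k = a + int k" for k :: nat
    define \<alpha> where "\<alpha> k = (\<delta> / 2 + (d (p k) + d' (p k) - r (p k))) / d' (p k)" for k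
    define \<beta> where "\<beta> k = d (p k) / d' (p k)" for k
    define y where "y = three_term \<alpha> \<beta>"
    have y0: "y 0 = 0" "y (Suc 0) = 1" by (simp_all add: y_def)
    have ySS: "y (Suc (Suc k)) = \<alpha> k * y (Suc k) - \<beta> k * y k" for k by (simp add: y_def)
    have rec: "d' (p k) * y (Suc (Suc k)) + d (p k) * y k
        = (\<delta> / 2 + (d (p k) + d' (p k) - r (p k))) * y (Suc k)" for k
      using d'_pos[of "p k"] by (simp add: ySS \<alpha>_def \<beta>_def field_simps)
    have \<beta>: "\<beta> k \<ge> 0" for k using d_pos[of "p k"] d'_pos[of "p k"] by (simp add: \<beta>_def)
    have \<alpha>: "\<alpha> k \<le> B" for k
    proof -
      have "\<alpha> k \<le> (\<delta> / 2 + 2 * M) / d' (p k)"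
        unfolding \<alpha>_def using diag_le[of "p k"] d'_pos[of "p k"] by (intro divide_right_mono) auto
      also have "\<dots> \<le> (\<delta> / 2 + 2 * M) / m"
        using d'_ge[of "p k"] m_pos \<delta>_pos M_pos by (intro divide_left_mono) auto
      finally show ?thesis by (simp add: B_def)
    qed
    have "\<exists>k\<le>L. y (Suc k) \<le> 0"
    proof (rule ccontr)
      assume "\<not> ?thesis"
      then have pos: "\<And>k. k \<le> L \<Longrightarrow> 0 < y (Suc k)" by (meson not_le)
      have "y (Suc (Suc k)) / y (Suc k) \<le> B - \<epsilon> * real k" if "k < L" for k
        using that
      proof (induction k)
        case 0
        then show ?case using \<alpha>[of 0] by (simp add: ySS y0)
      next
        case (Suc k)
        have "y (Suc (Suc (Suc k))) / y (Suc (Suc k)) \<le> y (Suc (Suc k)) / y (Suc k) - (\<delta> - \<delta> / 2) / M"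
          using Suc.prems far \<delta>_pos rec[of "Suc k"] pos[of k] pos[of "Suc k"]
          by (intro ratio_step[of "p (Suc k)"]) (auto simp: p_def)
        also have "(\<delta> - \<delta> / 2) / M = \<epsilon>" by (simp add: \<epsilon>_def)
        finally show ?case using Suc by (simp add: algebra_simps)
      qed
      from this[of "L - 1"] have "y (Suc L) / y L \<le> 0"
        using L by (simp add: L_def)
      moreover have "Suc (L - 1) = L" by (simp add: L_def)
      then have "0 < y (Suc L)" "0 < y L"
        using pos[OF order_refl] pos[OF diff_le_self, of 1] by auto
      ultimately show False by (simp add: divide_le_0_iff)
    qed
    then obtain k0 where k0: "k0 \<le> L" "y (Suc k0) \<le> 0" "\<And>k. k < k0 \<Longrightarrow> 0 < y (Suc k)"
      using exists_least_iff[of "\<lambda>k. y (Suc k) \<le> 0"] by (meson dual_order.trans not_le linorder_le_less_linear less_imp_le)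
    have k0pos: "k0 > 0" using k0(2) y0 by (cases k0) auto
    have ynn: "0 \<le> y k" if "k \<le> k0" for k
      using that k0(3)[of "k - 1"] y0 by (cases k) auto
    have ybd: "y (Suc k) \<le> B ^ k" if "k < k0" for k
      using that
    proof (induction k)
      case (Suc k)
      have "y (Suc (Suc k)) \<le> B * y (Suc k)"
        using mult_nonneg_nonneg[OF \<beta>[of k] ynn[of k]] mult_right_mono[OF \<alpha>[of k] ynn[of "Suc k"]]
          Suc.prems unfolding ySS by simp
      also have "\<dots> \<le> B * B ^ k" using Suc B by (intro mult_left_mono) auto
      finally show ?case by simp
    qed (use y0 in simp)
    \<comment> \<open>Sites a to b carry the positive values \<open>y 1\<close> to
      \<open>y k0\<close>; the first nonpositive one, \<open>y (Suc k0)\<close>, belongs to site b +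
      1.\<close>
    define b where "b = a + int k0 - 1"
    define \<psi> where "\<psi> i = (if a \<le> i \<and> i \<le> b then y (Suc (nat (i - a))) / B ^ L else 0)" for i
    have in_range: "nat (i - a) < k0" if "a \<le> i" "i \<le> b" for i using that by (auto simp: b_def)
    have "growing_bump (\<delta> / 2) (1 / B ^ L) a b \<psi>"
      unfolding growing_bump_def
    proof (intro conjI allI ballI impI)
      show "a \<le> b" using k0pos by (simp add: b_def)
      then show "1 / B ^ L \<le> \<psi> a" by (simp add: \<psi>_def y0)
      show "0 \<le> \<psi> i" for i
        using in_range[of i] ynn[of "Suc (nat (i - a))"] BL by (auto simp: \<psi>_def)
      show "\<psi> i \<le> 1" for i
      proof (cases "a \<le> i \<and> i \<le> b")
        case True
        have "y (Suc (nat (i - a))) \<le> B ^ nat (i - a)" using True in_range by (intro ybd) auto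
        also have "\<dots> \<le> B ^ L"
          using True in_range[of i] k0(1) B by (intro power_increasing) auto
        finally show ?thesis using True BL by (simp add: \<psi>_def)
      qed (auto simp: \<psi>_def)
      show "0 < \<psi> i" if "i \<in> {a..b}" for i
        using that in_range[of i] k0(3)[of "nat (i - a)"] BL by (simp add: \<psi>_def)
      show "\<psi> i = 0" if "i < a \<or> b < i" for i using that by (auto simp: \<psi>_def)
      show "\<delta> / 2 * \<psi> i \<le> d' i * (\<psi> (i + 1) - \<psi> i) + d i * (\<psi> (i - 1) - \<psi> i) + r i * \<psi> i"
        if i: "i \<in> {a..b}" for i
      proof -
        define k where "k = nat (i - a)"
        have k: "i = p k" "k < k0" using i in_range[of i] by (auto simp: k_def p_def)
        have 1: "\<psi> i = y (Suc k) / B ^ L" using i by (simp add: \<psi>_def k_def)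
        have 2: "\<psi> (i - 1) = y k / B ^ L"
        proof (cases k)
          case 0
          then show ?thesis using k y0 by (simp add: \<psi>_def p_def)
        next
          case (Suc j)
          then have "i - 1 = p j" using k by (simp add: p_def)
          then show ?thesis using Suc k by (simp add: \<psi>_def p_def b_def)
        qed
        \<comment> \<open>At the right end the cut-off replaces a nonpositive value by 0, which can
          only help a subsolution.\<close>
        have 3: "y (Suc (Suc k)) / B ^ L \<le> \<psi> (i + 1)"
        proof (cases "Suc k < k0")
          case True
          have "i + 1 = p (Suc k)" using k by (simp add: p_def)
          moreover have "nat (p (Suc k) - a) = Suc k" by (simp add: p_def nat_add_distrib)
          ultimately show ?thesis using True by (simp add: \<psi>_def) (simp add: p_def b_def)
        next
          case False
          then have "Suc k = k0" using k by simp
          then show ?thesis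
            using k0(2) BL k by (auto simp: \<psi>_def p_def b_def divide_le_0_iff)
        qed
        have "\<delta> / 2 * \<psi> i = (d' i * y (Suc (Suc k)) + d i * y k - (d i + d' i - r i) * y (Suc k)) / B ^ L"
          unfolding 1 using rec[of k] k(1) by (simp add: algebra_simps)
        also have "\<dots> = d' i * (y (Suc (Suc k)) / B ^ L) + d i * \<psi> (i - 1) - (d i + d' i - r i) * \<psi> i"
          unfolding 1 2 by (simp add: diff_divide_distrib add_divide_distrib)
        also have "\<dots> \<le> d' i * \<psi> (i + 1) + d i * \<psi> (i - 1) - (d i + d' i - r i) * \<psi> i"
          using mult_left_mono[OF 3, of "d' i"] d'_pos[of i] by simp
        finally show ?thesis by (simp add: algebra_simps)
      qed
    qed
    moreover have "b \<le> a + int L" using k0 by (simp add: b_def)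
    ultimately show ?thesis by blast
  qed
  show ?thesis
    using main BL \<delta>_pos by (intro exI[of _ L] exI[of _ "1 / B ^ L"] conjI exI[of _ "\<delta> / 2"]) auto
qed

end

section \<open>Comparison and the two spreading estimates\<close>

text \<open>\<open>f_ge\<close> is the Hoelder bound on the derivative at 0 after one application of
  the mean value theorem. \<open>f_away\<close> makes the positivity of the reaction uniform on
  compact subintervals of (0,1) and in the site.\<close>

locale kpp_solution = kpp_medium +
  fixes \<gamma> :: real and u :: "real \<Rightarrow> int \<Rightarrow> real"
  assumes \<gamma>_pos: "0 < \<gamma>"
    and f_nonneg: "\<And>i s. 0 \<le> s \<Longrightarrow> s \<le> 1 \<Longrightarrow> 0 \<le> f i s"
    and f_le: "\<And>i s. 0 \<le> s \<Longrightarrow> s \<le> 1 \<Longrightarrow> f i s \<le> deriv_s f i 0 * s"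
    and f_ge: "\<And>i s. 0 \<le> s \<Longrightarrow> s \<le> 1 \<Longrightarrow> (deriv_s f i 0 - K * s powr \<gamma>) * s \<le> f i s"
    and f_away: "\<And>a b. 0 < a \<Longrightarrow> b < 1 \<Longrightarrow> \<exists>c>0. \<forall>i. \<forall>s\<in>{a..b}. c \<le> f i s"
    and u_nonneg: "\<And>t i. 0 \<le> t \<Longrightarrow> 0 \<le> u t i" and u_le_1: "\<And>t i. 0 \<le> t \<Longrightarrow> u t i \<le> 1"
    and u_cont: "\<And>i. continuous_on {0..} (\<lambda>t. u t i)"
    and u_deriv: "\<And>t i. 0 < t \<Longrightarrow> ((\<lambda>\<tau>. u \<tau> i) has_real_derivative
        (d' i * (u t (i + 1) - u t i) + d i * (u t (i - 1) - u t i) + f i (u t i))) (at t)"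
    and u_init: "\<exists>i. 0 < u 0 i" "finite {i. u 0 i \<noteq> 0}"
begin

section \<open>Comparison on finite windows\<close>

text \<open>The inequality is demanded only where \<open>u\<close> and \<open>v\<close> coincide.
  There the reaction terms agree, and any knowledge about the range of \<open>u\<close> may be used
  for \<open>v\<close>.\<close>

lemma strict_subsolution_below:
  assumes S: "0 \<le> S"
    and dv: "\<And>t i. ((\<lambda>\<tau>. v \<tau> i) has_real_derivative v' t i) (at t)"
    and sub: "\<And>t i. \<lbrakk>S < t; t \<le> T; a \<le> i; i \<le> b; u t i = v t i\<rbrakk> \<Longrightarrow>
      v' t i < d' i * (v t (i + 1) - v t i) + d i * (v t (i - 1) - v t i) + f i (v t i)"
    and init: "\<And>i. a \<le> i \<Longrightarrow> i \<le> b \<Longrightarrow> v S i < u S i"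
    and bdry: "\<And>t. S \<le> t \<Longrightarrow> t \<le> T \<Longrightarrow> v t (a - 1) \<le> u t (a - 1)"
      "\<And>t. S \<le> t \<Longrightarrow> t \<le> T \<Longrightarrow> v t (b + 1) \<le> u t (b + 1)"
    and t: "S \<le> t" "t \<le> T" and i: "a \<le> i" "i \<le> b"
  shows "v t i < u t i"
proof -
  have "0 < u t i - v t i"
  proof (rule first_touch[where I = "{a..b}" and w = "\<lambda>t i. u t i - v t i"])
    show "continuous_on {S..T} (\<lambda>t. u t i - v t i)" for i
      using S by (intro continuous_on_diff continuous_on_subset[OF u_cont]
          continuous_at_imp_continuous_on ballI DERIV_isCont[OF dv]) auto
    show "\<exists>D>0. ((\<lambda>\<tau>. u \<tau> i - v \<tau> i) has_real_derivative D) (at t)"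
      if t: "S < t" "t \<le> T" "i \<in> {a..b}" "u t i - v t i = 0"
        and nn: "\<And>j. j \<in> {a..b} \<Longrightarrow> 0 \<le> u t j - v t j" for t i
    proof -
      have R: "v t (i + 1) \<le> u t (i + 1)" using nn[of "i + 1"] bdry(2)[of t] t by (cases "i = b") auto
      have L: "v t (i - 1) \<le> u t (i - 1)" using nn[of "i - 1"] bdry(1)[of t] t by (cases "i = a") auto
      have eq: "u t i = v t i" using t by simp
      have "v' t i < d' i * (v t (i + 1) - v t i) + d i * (v t (i - 1) - v t i) + f i (v t i)"
        using t eq by (intro sub) auto
      also have "\<dots> \<le> d' i * (u t (i + 1) - u t i) + d i * (u t (i - 1) - u t i) + f i (u t i)"
        unfolding eq using R L d_pos[of i] d'_pos[of i] by (intro add_mono mult_left_mono) auto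
      finally show ?thesis
        using u_deriv[of t i] dv[of i t] t S
        by (intro exI[of _ "d' i * (u t (i + 1) - u t i) + d i * (u t (i - 1) - u t i) + f i (u t i) - v' t i"]
            conjI DERIV_diff) auto
    qed
  qed (use init t i in auto)
  then show ?thesis by simp
qed

lemma strict_supersolution_above:
  assumes S: "0 \<le> S"
    and dv: "\<And>t i. ((\<lambda>\<tau>. v \<tau> i) has_real_derivative v' t i) (at t)"
    and super: "\<And>t i. \<lbrakk>S < t; t \<le> T; a \<le> i; i \<le> b; u t i = v t i\<rbrakk> \<Longrightarrow>
      d' i * (v t (i + 1) - v t i) + d i * (v t (i - 1) - v t i) + r i * v t i < v' t i"
    and init: "\<And>i. a \<le> i \<Longrightarrow> i \<le> b \<Longrightarrow> u S i < v S i"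
    and bdry: "\<And>t. S \<le> t \<Longrightarrow> t \<le> T \<Longrightarrow> u t (a - 1) \<le> v t (a - 1)"
      "\<And>t. S \<le> t \<Longrightarrow> t \<le> T \<Longrightarrow> u t (b + 1) \<le> v t (b + 1)"
    and t: "S \<le> t" "t \<le> T" and i: "a \<le> i" "i \<le> b"
  shows "u t i < v t i"
proof -
  have "0 < v t i - u t i"
  proof (rule first_touch[where I = "{a..b}" and w = "\<lambda>t i. v t i - u t i"])
    show "continuous_on {S..T} (\<lambda>t. v t i - u t i)" for i
      using S by (intro continuous_on_diff continuous_on_subset[OF u_cont]
          continuous_at_imp_continuous_on ballI DERIV_isCont[OF dv]) auto
    show "\<exists>D>0. ((\<lambda>\<tau>. v \<tau> i - u \<tau> i) has_real_derivative D) (at t)"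
      if t: "S < t" "t \<le> T" "i \<in> {a..b}" "v t i - u t i = 0"
        and nn: "\<And>j. j \<in> {a..b} \<Longrightarrow> 0 \<le> v t j - u t j" for t i
    proof -
      have R: "u t (i + 1) \<le> v t (i + 1)" using nn[of "i + 1"] bdry(2)[of t] t by (cases "i = b") auto
      have L: "u t (i - 1) \<le> v t (i - 1)" using nn[of "i - 1"] bdry(1)[of t] t by (cases "i = a") auto
      have eq: "v t i = u t i" using t by simp
      have "d' i * (u t (i + 1) - u t i) + d i * (u t (i - 1) - u t i) + f i (u t i)
          \<le> d' i * (v t (i + 1) - v t i) + d i * (v t (i - 1) - v t i) + r i * v t i"
        unfolding eq using R L d_pos[of i] d'_pos[of i] t S u_nonneg u_le_1
        by (intro add_mono mult_left_mono f_le) auto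
      also have "\<dots> < v' t i" using t eq by (intro super) auto
      finally show ?thesis
        using u_deriv[of t i] dv[of i t] t S
        by (intro exI[of _ "v' t i - (d' i * (u t (i + 1) - u t i) + d i * (u t (i - 1) - u t i) + f i (u t i))"]
            conjI DERIV_diff) auto
    qed
  qed (use init t i in auto)
  then show ?thesis by simp
qed

section \<open>Extinction ahead of the upper speed\<close>

text \<open>To compare on a half-line with finite windows, \<epsilon> exp(\<Lambda> t + i) is added:
  it exceeds 1 at a distant right end, and \<epsilon> tends to 0 afterwards.\<close>

lemma supersolution_bound:
  assumes \<phi>: "\<phi> \<in> test_funs n" "\<And>i. i > n \<Longrightarrow> lin_op_p d d' f (- p) \<phi> i \<le> l * \<phi> i"
    and l: "0 \<le> l"
  shows "\<exists>C>0. \<forall>t\<ge>0. \<forall>i\<ge>n. u t i \<le> C * exp (l * t - p * real_of_int i) * \<phi> i"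
proof -
  note pos = test_funs_pos[OF \<phi>(1)]
  define g where "g i = exp (- p * real_of_int i) * \<phi> i" for i
  have g: "0 < g i" if "i \<ge> n" for i using pos[OF that] by (simp add: g_def)
  have Lg: "d' i * (g (i + 1) - g i) + d i * (g (i - 1) - g i) + r i * g i \<le> l * g i" if "i > n" for i
  proof -
    have eq: "lin_op_p d d' f (- p) \<phi> i
        = exp (p * real_of_int i) * (d' i * (g (i + 1) - g i) + d i * (g (i - 1) - g i) + r i * g i)"
      by (simp add: lin_op_p_def lin_op_def g_def)
    have "l * \<phi> i = exp (p * real_of_int i) * (l * g i)"
      by (simp add: g_def exp_minus)
    with \<phi>(2)[OF that] show ?thesis unfolding eq by (simp only: mult_le_cancel_left_pos exp_gt_zero)
  qed
  \<comment> \<open>Including \<open>n\<close> makes C g(n) \<ge> 1, so the supersolution dominates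
    \<open>u\<close> at the left boundary at all times.\<close>
  define S where "S = {n} \<union> ({i. u 0 i \<noteq> 0} \<inter> {n..})"
  have S: "finite S" "S \<noteq> {}" using u_init by (auto simp: S_def)
  define C where "C = Max ((\<lambda>i. 1 / g i) ` S)"
  have C: "1 / g i \<le> C" if "i \<in> S" for i unfolding C_def using S that by (intro Max_ge) auto
  have C0: "C > 0" using C[of n] g[of n] by (auto simp: S_def intro: less_le_trans[rotated])
  \<comment> \<open>Large enough for the added exponential to be a strict supersolution at every
    site.\<close>
  define \<Lambda> where "\<Lambda> = M * exp 1 + M + K + 1"
  have bound: "u t i \<le> C * exp (l * t) * g i + \<epsilon> * exp (\<Lambda> * t + real_of_int i)"
    if \<epsilon>: "\<epsilon> > 0" and t: "t \<ge> 0" and i: "i \<ge> n" for \<epsilon> t i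
  proof -
    define v where "v t i = C * exp (l * t) * g i + \<epsilon> * exp (\<Lambda> * t + real_of_int i)" for t i
    define b where "b = max i (\<lceil>- ln \<epsilon>\<rceil>)"
    have \<Lambda>: "\<Lambda> > 0" using M_pos r_nonneg[of 0] r_le[of 0] by (simp add: \<Lambda>_def add_pos_nonneg)
    have vn: "1 \<le> v t n" if "t \<ge> 0" for t
    proof -
      have "1 \<le> C * g n" using C[of n] g[of n] by (simp add: S_def field_simps)
      also have "\<dots> \<le> C * g n * exp (l * t)"
        using mult_left_mono[of 1 "exp (l * t)" "C * g n"] C0 g[of n] l that by simp
      finally show ?thesis using \<epsilon> by (simp add: v_def algebra_simps add_increasing2)
    qed
    show ?thesis
    proof (cases "i = n")
      case True
      then show ?thesis using vn[OF t] u_le_1[OF t, of i] by (simp add: v_def)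
    next
      case False
      have "u t i < v t i"
      proof (rule strict_supersolution_above[where a = "n + 1" and b = b and v = v and S = 0 and T = t
            and v' = "\<lambda>t i. C * (l * exp (l * t)) * g i + \<epsilon> * (\<Lambda> * exp (\<Lambda> * t + real_of_int i))"])
        show "((\<lambda>\<tau>. v \<tau> i) has_real_derivative
            C * (l * exp (l * t)) * g i + \<epsilon> * (\<Lambda> * exp (\<Lambda> * t + real_of_int i))) (at t)" for t i
          unfolding v_def by (auto intro!: derivative_eq_intros)
        show "d' i * (v t (i + 1) - v t i) + d i * (v t (i - 1) - v t i) + r i * v t i
            < C * (l * exp (l * t)) * g i + \<epsilon> * (\<Lambda> * exp (\<Lambda> * t + real_of_int i))"
          if "n + 1 \<le> i" for t i
        proof -
          define E where "E = exp (\<Lambda> * t + real_of_int i)"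
          have E: "exp (\<Lambda> * t + real_of_int (i + 1)) = E * exp 1"
            "exp (\<Lambda> * t + real_of_int (i - 1)) = E * exp (- 1)" "0 < E"
            by (simp_all add: E_def exp_add[symmetric])
          have "d' i * (v t (i + 1) - v t i) + d i * (v t (i - 1) - v t i) + r i * v t i
              = C * exp (l * t) * (d' i * (g (i + 1) - g i) + d i * (g (i - 1) - g i) + r i * g i)
              + \<epsilon> * E * (d' i * exp 1 + d i * exp (- 1) - (d i + d' i) + r i)"
            unfolding v_def E E_def[symmetric] by (simp add: algebra_simps)
          also have "\<dots> < C * exp (l * t) * (l * g i) + \<epsilon> * E * \<Lambda>"
          proof (rule add_le_less_mono)
            show "C * exp (l * t) * (d' i * (g (i + 1) - g i) + d i * (g (i - 1) - g i) + r i * g i)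
               \<le> C * exp (l * t) * (l * g i)"
              using Lg[of i] that C0 by (intro mult_left_mono) auto
            have "d' i * exp 1 \<le> M * exp 1" using d'_le by simp
            moreover have "d i * exp (- 1) \<le> M * 1"
              using d_le[of i] d_pos[of i] by (intro mult_mono) auto
            ultimately have "d' i * exp 1 + d i * exp (- 1) - (d i + d' i) + r i < \<Lambda>"
              using r_le[of i] d_pos[of i] d'_pos[of i] unfolding \<Lambda>_def by linarith
            then show "\<epsilon> * E * (d' i * exp 1 + d i * exp (- 1) - (d i + d' i) + r i) < \<epsilon> * E * \<Lambda>"
              using \<epsilon> E by simp
          qed
          finally show ?thesis by (simp add: E_def algebra_simps)
        qed
        show "u 0 j < v 0 j" if j: "n + 1 \<le> j" for j
        proof (cases "u 0 j = 0")
          case True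
          then show ?thesis using C0 g[of j] j \<epsilon> by (auto simp: v_def intro!: add_nonneg_pos)
        next
          case False
          then have "1 \<le> C * g j" using C[of j] g[of j] j by (simp add: S_def field_simps)
          then show ?thesis using u_le_1[of 0 j] \<epsilon> by (simp add: v_def add_strict_increasing2 add_le_less_mono le_less_trans)
        qed
        show "u t (n + 1 - 1) \<le> v t (n + 1 - 1)" if "0 \<le> t" for t
          using vn[OF that] u_le_1[OF that, of n] by simp
        show "u t (b + 1) \<le> v t (b + 1)" if t: "0 \<le> t" for t
        proof -
          have "- ln \<epsilon> \<le> real_of_int (b + 1)" by (simp add: b_def) linarith
          then have "1 \<le> exp (ln \<epsilon> + (\<Lambda> * t + real_of_int (b + 1)))"
            using \<Lambda> t by (simp add: add.commute add.left_commute)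
              (metis add.commute add.left_commute add_increasing2 mult_nonneg_nonneg less_imp_le diff_0 diff_le_eq)
          also have "\<dots> = \<epsilon> * exp (\<Lambda> * t + real_of_int (b + 1))"
            using \<epsilon> by (subst exp_add) simp
          also have "\<dots> \<le> v t (b + 1)"
          proof -
            have "0 < g (b + 1)" using i by (intro g) (auto simp: b_def)
            then show ?thesis using C0 by (simp add: v_def)
          qed
          finally show ?thesis using u_le_1[OF t, of "b + 1"] by simp
        qed
      qed (use t i False in \<open>auto simp: b_def\<close>)
      then show ?thesis by (simp add: v_def)
    qed
  qed
  have "u t i \<le> C * exp (l * t - p * real_of_int i) * \<phi> i" if "t \<ge> 0" "i \<ge> n" for t i
  proof -
    have "u t i \<le> C * exp (l * t) * g i"
    proof (rule field_le_epsilon)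
      fix e :: real assume "e > 0"
      then show "u t i \<le> C * exp (l * t) * g i + e"
        using bound[of "e / exp (\<Lambda> * t + real_of_int i)", OF _ that] by simp
    qed
    then show ?thesis by (simp add: g_def exp_diff exp_minus divide_inverse)
  qed
  then show ?thesis using C0 by blast
qed

lemma spreading_upper:
  assumes "speed_upper d d' f < \<omega>"
  shows "((\<lambda>t. SUP i\<in>{i. real_of_int i \<ge> \<omega> * t}. \<bar>u t i\<bar>) \<longlongrightarrow> 0) at_top"
proof -
  obtain p where p: "0 < p" "speed_upper d d' f = H_upper d d' f (- p) / p"
    using speed_upper_min by blast
  have "H_upper d d' f (- p) < \<omega> * p" using assms p by (simp add: field_simps)
  then obtain l n where l: "l \<in> upper_set (- p) n" "l < \<omega> * p" by (rule H_upper_witness)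
  then obtain \<phi> where \<phi>: "\<phi> \<in> test_funs n" "\<And>i. i > n \<Longrightarrow> lin_op_p d d' f (- p) \<phi> i \<le> l * \<phi> i"
    by (auto simp: upper_set_def)
  have l0: "0 < l" using upper_set_ge_\<delta>[OF l(1)] \<delta>_pos by simp
  then have \<omega>: "0 < \<omega>" using l(2) p(1) by (smt (verit) zero_less_mult_pos2)
  obtain C where C: "C > 0" "\<And>t i. t \<ge> 0 \<Longrightarrow> i \<ge> n \<Longrightarrow> u t i \<le> C * exp (l * t - p * real_of_int i) * \<phi> i"
    using supersolution_bound[OF \<phi>] l0 by force
  \<comment> \<open>The factor exp(\<eta> i) from \<phi> must leave the bound decreasing in i
    (\<eta> < p) and use at most half of the margin \<omega> p - l at i = \<omega> t.\<close>
  define \<eta> where "\<eta> = min (p / 2) ((\<omega> * p - l) / (2 * \<omega>))"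
  have \<eta>: "0 < \<eta>" "\<eta> < p" "\<eta> * \<omega> \<le> (\<omega> * p - l) / 2"
    using p(1) l(2) \<omega> by (auto simp: \<eta>_def min_def field_simps)
  obtain k where k: "k \<ge> 1" "\<And>i. i \<ge> k \<Longrightarrow> \<bar>ln (\<phi> i)\<bar> \<le> \<eta> * real_of_int i"
    using test_funs_subexponential[OF \<phi>(1) \<eta>(1)] by blast
  define c where "c = (\<omega> * p - l) / 2"
  have c: "c > 0" using l by (simp add: c_def)
  have est: "u t i \<le> C * exp (- (c * t))" if t: "t \<ge> 0" "\<omega> * t \<ge> real_of_int (max n k)" "real_of_int i \<ge> \<omega> * t" for t i
  proof -
    have i: "i \<ge> n" "i \<ge> k" using that by linarith+
    have "\<phi> i \<le> exp (\<eta> * real_of_int i)"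
      using k(2)[OF i(2)] test_funs_pos[OF \<phi>(1) i(1)] by (metis abs_le_D1 exp_le_cancel_iff exp_ln)
    then have "u t i \<le> C * exp (l * t - p * real_of_int i) * exp (\<eta> * real_of_int i)"
      using C(2)[OF t(1) i(1)] C(1) by (smt (verit) exp_gt_zero mult_left_mono mult_pos_pos)
    also have "\<dots> = C * exp (l * t - (p - \<eta>) * real_of_int i)"
      by (simp add: exp_add[symmetric] algebra_simps)
    also have "\<dots> \<le> C * exp (- (c * t))"
    proof -
      have "(p - \<eta>) * (\<omega> * t) \<le> (p - \<eta>) * real_of_int i" using \<eta> t by (intro mult_left_mono) auto
      moreover have "\<eta> * \<omega> * t \<le> c * t" unfolding c_def using \<eta> t by (intro mult_right_mono) auto
      moreover have "c * t + c * t = (\<omega> * p - l) * t" by (simp add: c_def field_simps)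
      ultimately have "l * t - (p - \<eta>) * real_of_int i \<le> - (c * t)" by (simp add: algebra_simps)
      then show ?thesis using C(1) by simp
    qed
    finally show ?thesis .
  qed
  have ev: "\<forall>\<^sub>F t in at_top. t \<ge> 0 \<and> \<omega> * t \<ge> real_of_int (max n k)"
    using eventually_ge_at_top[of "max 0 (real_of_int (max n k) / \<omega>)"]
    by eventually_elim (use \<omega> in \<open>auto simp: field_simps\<close>)
  have ne: "{i. real_of_int i \<ge> \<omega> * t} \<noteq> {}" for t
    using ex_le_of_int by auto
  show ?thesis
  proof (rule tendsto_sandwich[where f = "\<lambda>_. 0" and h = "\<lambda>t. C * exp (- (c * t))"])
    show "\<forall>\<^sub>F t in at_top. 0 \<le> (SUP i\<in>{i. real_of_int i \<ge> \<omega> * t}. \<bar>u t i\<bar>)"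
      using ev
    proof eventually_elim
      case (elim t)
      obtain i where i: "i \<in> {i. real_of_int i \<ge> \<omega> * t}" using ne by blast
      have "bdd_above ((\<lambda>i. \<bar>u t i\<bar>) ` {i. real_of_int i \<ge> \<omega> * t})"
        using elim u_nonneg u_le_1 by (auto intro!: bdd_aboveI[of _ 1])
      from cSUP_upper[OF i this] show ?case by (rule order_trans[rotated]) simp
    qed
    show "\<forall>\<^sub>F t in at_top. (SUP i\<in>{i. real_of_int i \<ge> \<omega> * t}. \<bar>u t i\<bar>) \<le> C * exp (- (c * t))"
      using ev
    proof eventually_elim
      case (elim t)
      then show ?case using est[of t] u_nonneg by (intro cSUP_least ne) auto
    qed
    have "((\<lambda>t. exp (- (c * t))) \<longlongrightarrow> 0) at_top"
      using c by (intro filterlim_compose[OF exp_at_bot] filterlim_uminus_at_bot_at_top[THEN filterlim_compose]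
          filterlim_tendsto_pos_mult_at_top[OF tendsto_const] filterlim_ident)
    then show "((\<lambda>t. C * exp (- (c * t))) \<longlongrightarrow> 0) at_top"
      by (rule tendsto_mult_right_zero)
  qed simp
qed

section \<open>A priori lower bounds for the solution\<close>

lemma K_nonneg: "0 \<le> K"
  using r_nonneg[of 0] r_le[of 0] by linarith

lemma small_power:
  assumes "0 < c"
  obtains s0 where "0 < s0" "s0 \<le> 1" "\<And>s. 0 \<le> s \<Longrightarrow> s \<le> s0 \<Longrightarrow> K * s powr \<gamma> < c"
proof
  define b where "b = c / (K + 1)"
  have b: "0 < b" using assms K_nonneg by (simp add: b_def)
  define s0 where "s0 = min 1 (b powr (1 / \<gamma>))"
  show "0 < s0" "s0 \<le> 1" using b by (auto simp: s0_def)
  fix s :: real assume s: "0 \<le> s" "s \<le> s0"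
  have "s powr \<gamma> \<le> (b powr (1 / \<gamma>)) powr \<gamma>"
    using s \<gamma>_pos by (intro powr_mono2) (auto simp: s0_def)
  also have "\<dots> = b" using b \<gamma>_pos by (simp add: powr_powr)
  finally have "K * s powr \<gamma> \<le> K * b" using K_nonneg by (intro mult_left_mono)
  also have "\<dots> < (K + 1) * b" using b by simp
  also have "\<dots> = c" using K_nonneg by (simp add: b_def)
  finally show "K * s powr \<gamma> < c" .
qed

abbreviation rhs :: "real \<Rightarrow> int \<Rightarrow> real" where
  "rhs t i \<equiv> d' i * (u t (i + 1) - u t i) + d i * (u t (i - 1) - u t i) + f i (u t i)"

lemma rhs_ge:
  assumes "0 \<le> t" "e = 1 \<or> e = - 1"
  shows "m * u t (i - e) \<le> 2 * M * u t i + rhs t i"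
proof -
  have 1: "0 \<le> (2 * M - (d i + d' i)) * u t i"
    using d_le[of i] d'_le[of i] u_nonneg[OF assms(1)] by (intro mult_nonneg_nonneg) auto
  have 2: "0 \<le> f i (u t i)" using u_nonneg u_le_1 assms by (intro f_nonneg) auto
  have 3: "m * u t (i + 1) \<le> d' i * u t (i + 1)" "m * u t (i - 1) \<le> d i * u t (i - 1)"
    using d_ge d'_ge u_nonneg[OF assms(1)] by (auto intro!: mult_right_mono)
  have 4: "0 \<le> m * u t (i + 1)" "0 \<le> m * u t (i - 1)"
    using m_pos u_nonneg[OF assms(1)] by simp_all
  from assms(2) show ?thesis using 1 2 3 4 by (auto simp: algebra_simps)
qed

text \<open>The integrating factor \<open>exp (2 * M * t)\<close> absorbs the loss at site
  \<open>i\<close>; what remains is the inflow from the neighbour \<open>i - e\<close>.\<close>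

lemma weighted_lower:
  assumes t: "0 \<le> S" "S \<le> t" and e: "e = 1 \<or> e = - 1"
    and G: "\<And>s. (G has_real_derivative G' s) (at s)"
    and G': "\<And>s. S < s \<Longrightarrow> s < t \<Longrightarrow> G' s \<le> exp (2 * M * s) * (m * u s (i - e))"
    and init: "G S \<le> exp (2 * M * S) * u S i"
  shows "G t \<le> exp (2 * M * t) * u t i"
proof -
  have "exp (2 * M * S) * u S i - G S \<le> exp (2 * M * t) * u t i - G t"
  proof (rule DERIV_nonneg_imp_increasing_open[OF t(2)])
    fix s assume s: "S < s" "s < t"
    have "((\<lambda>s. exp (2 * M * s) * u s i - G s) has_real_derivative
        exp (2 * M * s) * (2 * M * u s i + rhs s i) - G' s) (at s)"
      using s t by (auto intro!: derivative_eq_intros u_deriv G simp: algebra_simps)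
    moreover have "exp (2 * M * s) * (m * u s (i - e)) \<le> exp (2 * M * s) * (2 * M * u s i + rhs s i)"
      using rhs_ge[of s e i] e s t by (intro mult_left_mono) auto
    then have "0 \<le> exp (2 * M * s) * (2 * M * u s i + rhs s i) - G' s"
      using G'[OF s] by linarith
    ultimately show "\<exists>y. ((\<lambda>s. exp (2 * M * s) * u s i - G s) has_real_derivative y) (at s) \<and> 0 \<le> y"
      by blast
  next
    show "continuous_on {S..t} (\<lambda>s. exp (2 * M * s) * u s i - G s)"
      using t by (intro continuous_intros continuous_on_subset[OF u_cont]
          continuous_at_imp_continuous_on ballI DERIV_isCont[OF G]) auto
  qed
  with init show ?thesis by simp
qed

text \<open>Each jump in direction \<open>e\<close> integrates the previous bound once more, which
  produces the Taylor terms of the exponential.\<close>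

lemma iterated_lower:
  assumes a: "0 \<le> a" "a \<le> u 0 i0" and e: "e = 1 \<or> e = - 1" and t: "0 \<le> t"
  shows "a * ((m * t) ^ k / fact k) \<le> exp (2 * M * t) * u t (i0 + e * int k)"
  using t
proof (induction k arbitrary: t)
  case 0
  show ?case
    using weighted_lower[of 0 t e "\<lambda>_. a" "\<lambda>_. 0" i0] 0 a e m_pos u_nonneg by simp
next
  case (Suc k)
  show ?case
  proof (rule weighted_lower[where S = 0 and e = e and G' = "\<lambda>s. m * (a * ((m * s) ^ k / fact k))"])
    show "((\<lambda>s. a * ((m * s) ^ Suc k / fact (Suc k))) has_real_derivative
        m * (a * ((m * s) ^ k / fact k))) (at s)" for s
    proof -
      have "((\<lambda>s. a * ((m * s) ^ Suc k / fact (Suc k))) has_real_derivative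
          a * ((real (Suc k) * (m * s) ^ k * m) / fact (Suc k))) (at s)"
        by (auto intro!: derivative_eq_intros simp del: fact_Suc power_Suc of_nat_Suc)
      moreover have "real (Suc k) / fact (Suc k) = 1 / fact k"
        by (simp add: field_simps del: of_nat_Suc)
      then have "a * ((real (Suc k) * (m * s) ^ k * m) / fact (Suc k)) = m * (a * ((m * s) ^ k / fact k))"
        by (simp add: field_simps del: of_nat_Suc)
      ultimately show ?thesis by (simp only:)
    qed
    show "m * (a * ((m * s) ^ k / fact k)) \<le> exp (2 * M * s) * (m * u s (i0 + e * int (Suc k) - e))"
      if "0 < s" for s
    proof -
      have "i0 + e * int (Suc k) - e = i0 + e * int k" by (simp add: algebra_simps)
      then show ?thesis using mult_left_mono[OF Suc.IH[of s], of m] that m_pos by (simp add: algebra_simps)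
    qed
  qed (use Suc.prems e u_nonneg in auto)
qed

lemma u_pos:
  assumes "0 < t"
  shows "0 < u t i"
proof -
  obtain i0 where i0: "0 < u 0 i0" using u_init by blast
  define e :: int where "e = (if i0 \<le> i then 1 else - 1)"
  define k where "k = nat \<bar>i - i0\<bar>"
  have ik: "i = i0 + e * int k" by (simp add: e_def k_def)
  have "u 0 i0 * ((m * t) ^ k / fact k) \<le> exp (2 * M * t) * u t i"
    unfolding ik using i0 assms by (intro iterated_lower) (auto simp: e_def)
  moreover have "0 < u 0 i0 * ((m * t) ^ k / fact k)" using i0 m_pos assms by simp
  ultimately have "0 < exp (2 * M * t) * u t i" by linarith
  then show ?thesis by (simp add: zero_less_mult_iff)
qed

text \<open>Inside a cone the number of jumps k is at most W1 t, and k! \<le> (W1 t)^k makes the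
  k-th Taylor term only exponentially small. This keeps the exponential rate of \<open>u\<close>
  bounded below.\<close>

lemma u_exponential_lower:
  assumes "0 < W"
  obtains C T where "0 < C" "1 \<le> T" "\<And>t i. T \<le> t \<Longrightarrow> \<bar>real_of_int i\<bar> \<le> W * t \<Longrightarrow> exp (- (C * t)) \<le> u t i"
proof -
  obtain i0 where i0: "0 < u 0 i0" using u_init by blast
  \<comment> \<open>The 1 pays for the distance of \<open>i0\<close> from the origin; adding
    \<open>m\<close> makes the logarithm of \<open>W1 / m\<close> nonnegative.\<close>
  define W1 where "W1 = W + 1 + m"
  have W1: "m \<le> W1" "0 < W1" using assms m_pos by (auto simp: W1_def)
  define C where "C = 2 * M + W1 * ln (W1 / m) - ln (u 0 i0)"
  have lnu: "ln (u 0 i0) \<le> 0" using i0 u_le_1[of 0 i0] by simp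
  have lnW: "0 \<le> ln (W1 / m)" using W1 m_pos by simp
  have C: "0 < C"
    using M_pos lnu mult_nonneg_nonneg[OF less_imp_le[OF W1(2)] lnW] by (simp add: C_def)
  define T where "T = max 1 \<bar>real_of_int i0\<bar>"
  have "exp (- (C * t)) \<le> u t i" if t: "T \<le> t" and i: "\<bar>real_of_int i\<bar> \<le> W * t" for t i
  proof -
    have t1: "1 \<le> t" "\<bar>real_of_int i0\<bar> \<le> t" using t by (auto simp: T_def)
    define e :: int where "e = (if i0 \<le> i then 1 else - 1)"
    define k where "k = nat \<bar>i - i0\<bar>"
    have ik: "i = i0 + e * int k" by (simp add: e_def k_def)
    have k: "real k \<le> W1 * t"
    proof -
      have "real k = \<bar>real_of_int i - real_of_int i0\<bar>" by (simp add: k_def)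
      also have "\<dots> \<le> W * t + t" using i t1 by linarith
      also have "\<dots> \<le> W1 * t" using m_pos t1 by (simp add: W1_def algebra_simps)
      finally show ?thesis .
    qed
    have "fact k \<le> real (k ^ k)" using fact_le_power[of k] by blast
    also have "\<dots> \<le> (W1 * t) ^ k" using k by (simp add: power_mono)
    finally have fk: "fact k \<le> (W1 * t) ^ k" .
    have "exp (- (W1 * t * ln (W1 / m))) \<le> exp (- (real k * ln (W1 / m)))"
      using k lnW by (simp add: mult_right_mono)
    also have "\<dots> = (m / W1) ^ k"
      using m_pos W1 by (simp add: exp_minus exp_of_nat_mult power_divide)
    also have "\<dots> = (m * t) ^ k / (W1 * t) ^ k"
      using t1 by (simp add: power_mult_distrib power_divide)
    also have "\<dots> \<le> (m * t) ^ k / fact k"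
      using fk m_pos t1 W1 by (intro divide_left_mono) auto
    finally have "u 0 i0 * exp (- (W1 * t * ln (W1 / m))) \<le> u 0 i0 * ((m * t) ^ k / fact k)"
      using i0 by (intro mult_left_mono) auto
    also have "\<dots> \<le> exp (2 * M * t) * u t i"
      unfolding ik using i0 t1 by (intro iterated_lower) (auto simp: e_def)
    finally have "exp (ln (u 0 i0) - W1 * t * ln (W1 / m) - 2 * M * t) \<le> u t i"
      using i0 by (simp add: exp_diff exp_minus exp_add field_simps)
    moreover have "- (C * t) \<le> ln (u 0 i0) - W1 * t * ln (W1 / m) - 2 * M * t"
    proof -
      have "ln (u 0 i0) * t \<le> ln (u 0 i0) * 1" using t1 lnu by (intro mult_left_mono_neg) auto
      then show ?thesis by (simp add: C_def algebra_simps)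
    qed
    ultimately show ?thesis by (meson exp_le_cancel_iff order_trans)
  qed
  then show ?thesis using that[of C T] C by (auto simp: T_def)
qed

section \<open>The exponential rate along subcritical rays\<close>

text \<open>At a fixed site the touching profile grows in time at rate z - q w, a subsolution built
  from \<open>l\<close> at rate \<nu> = l - \<mu>/2. Since l + q w > 0 and z = -\<mu>, the latter is
  faster by at least \<mu>/2. Started below the profile a time \<theta> s earlier, it nevertheless
  ends above \<open>u\<close> at the contact.\<close>

lemma touching_contradiction:
  assumes w: "0 < w" and h: "0 < h" and \<kappa>0: "0 \<le> \<kappa>0" and z: "z < 0"
    and H: "0 < H_lower d d' f q + q * w"
    and low: "\<And>\<eta>. 0 < \<eta> \<Longrightarrow> \<exists>T. \<forall>t\<ge>T. \<forall>i. \<bar>real_of_int i - w * t\<bar> \<le> h * t \<longrightarrow>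
      exp (t * (z - \<eta>) + q * (real_of_int i - w * t) - \<kappa>0 * ((real_of_int i - w * t)\<^sup>2 / t)) \<le> u t i"
    and up: "\<And>\<eta> T. 0 < \<eta> \<Longrightarrow> \<exists>t\<ge>T. \<exists>i. \<bar>real_of_int i - w * t\<bar> \<le> \<eta> * t \<and> u t i \<le> exp (t * (z + \<eta>))"
  shows False
proof -
  have "- q * w < H_lower d d' f q" using H by simp
  then obtain l n where l: "l \<in> lower_set q n" "- q * w < l" by (rule H_lower_witness)
  then obtain \<phi> where \<phi>: "\<phi> \<in> test_funs n" "\<And>i. i > n \<Longrightarrow> l * \<phi> i \<le> lin_op_p d d' f q \<phi> i"
    by (auto simp: lower_set_def)
  define \<mu> where "\<mu> = - z"
  have \<mu>: "0 < \<mu>" using z by (simp add: \<mu>_def)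
  obtain s0 where s0: "0 < s0" "s0 \<le> 1" "\<And>s. 0 \<le> s \<Longrightarrow> s \<le> s0 \<Longrightarrow> K * s powr \<gamma> < \<mu> / 8"
    using small_power[of "\<mu> / 8"] \<mu> by auto
  define B where "B = \<bar>l + 2 * M\<bar> + 1"
  have B: "0 < B" by (simp add: B_def add_nonneg_pos)
  \<comment> \<open>Loss allowed per neighbour in the cut-off: it lowers the eigenvalue by at most
    \<mu>/4. The Hoelder error takes \<mu>/8, and both fit into \<nu> = l - \<mu>/2.\<close>
  define h1 where "h1 = \<mu> / (4 * B)"
  have h1: "0 < h1" using \<mu> B by (simp add: h1_def)
  have h1l: "l - \<mu> / 4 \<le> exp (- h1) * (l + 2 * M) - 2 * M"
  proof -
    have "(1 - exp (- h1)) * (l + 2 * M) \<le> (1 - exp (- h1)) * B"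
      unfolding B_def using h1 by (intro mult_left_mono) auto
    also have "\<dots> \<le> h1 * B"
      using exp_ge_add_one_self[of "- h1"] B by (intro mult_right_mono) auto
    also have "\<dots> = \<mu> / 4" using B by (simp add: h1_def)
    finally show ?thesis by (simp add: algebra_simps)
  qed
  define \<nu> where "\<nu> = l - \<mu> / 2"
  \<comment> \<open>The 4 covers the loss in \<open>quadratic_drift\<close>; the extra 1 leaves
    j^2/s to win on the lateral boundary.\<close>
  define \<kappa> where "\<kappa> = 4 * \<kappa>0 + 1"
  have \<kappa>: "0 < \<kappa>" using \<kappa>0 by (simp add: \<kappa>_def)
  \<comment> \<open>The window has half-width about \<rho> s. The entries keep it in the cone, keep
    its sites near w s, bound the cut-off ratios, and stop exp(q j) from consuming the decay
    \<mu>.\<close>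
  define \<rho> where "\<rho> = Min {h / 16, w / 8, 1 / 4, h1 / (3 * \<kappa>), \<mu> / (16 * (\<bar>q\<bar> + 1))}"
  have "0 < \<rho>"
    unfolding \<rho>_def using h w h1 \<kappa> \<mu> by (subst Min_gr_iff) (auto simp: add_nonneg_pos)
  moreover have "\<rho> \<le> h / 16" "\<rho> \<le> w / 8" "\<rho> \<le> 1 / 4" "\<rho> \<le> h1 / (3 * \<kappa>)" "\<rho> \<le> \<mu> / (16 * (\<bar>q\<bar> + 1))"
    unfolding \<rho>_def by (rule Min_le, simp, blast)+
  ultimately have \<rho>: "0 < \<rho>" "\<rho> \<le> h / 16" "\<rho> \<le> w / 8" "\<rho> \<le> 1 / 4" "\<rho> \<le> h1 / (3 * \<kappa>)" "\<rho> \<le> \<mu> / (16 * (\<bar>q\<bar> + 1))"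
    by blast+
  \<comment> \<open>\<theta> s is the length of the time interval: t stays above s/2, the drift
    stays in the cone and costs at most \<mu>/4, and the growth at rate \<nu> keeps \<open>v\<close>
    small.\<close>
  define \<theta> where "\<theta> = Min {1 / 2, h / (8 * w), \<mu> / (32 * (\<kappa>0 * w\<^sup>2 + 1)), \<mu> / (8 * (\<bar>\<nu>\<bar> + 1))}"
  have "0 < \<theta>"
    unfolding \<theta>_def using h w \<mu> \<kappa>0 by (subst Min_gr_iff) (auto simp: add_nonneg_pos)
  moreover have "\<theta> \<le> 1 / 2" "\<theta> \<le> h / (8 * w)" "\<theta> \<le> \<mu> / (32 * (\<kappa>0 * w\<^sup>2 + 1))" "\<theta> \<le> \<mu> / (8 * (\<bar>\<nu>\<bar> + 1))"
    unfolding \<theta>_def by (rule Min_le, simp, blast)+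
  ultimately have \<theta>: "0 < \<theta>" "\<theta> \<le> 1 / 2" "\<theta> \<le> h / (8 * w)" "\<theta> \<le> \<mu> / (32 * (\<kappa>0 * w\<^sup>2 + 1))" "\<theta> \<le> \<mu> / (8 * (\<bar>\<nu>\<bar> + 1))"
    by blast+
  have \<theta>1: "w * \<theta> \<le> h / 8" using \<theta>(3) w by (simp add: field_simps)
  have \<theta>2: "8 * \<kappa>0 * w\<^sup>2 * \<theta> \<le> \<mu> / 4"
  proof -
    have p: "0 < \<kappa>0 * w\<^sup>2 + 1" using \<kappa>0 by (simp add: add_nonneg_pos)
    have "8 * (\<kappa>0 * w\<^sup>2) * \<theta> \<le> 8 * (\<kappa>0 * w\<^sup>2 + 1) * \<theta>" using \<theta>(1) by simp
    also have "\<dots> \<le> \<mu> / 4" using \<theta>(4) p by (simp add: field_simps)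
    finally show ?thesis by (simp add: algebra_simps)
  qed
  have \<theta>3: "\<bar>\<nu>\<bar> * \<theta> \<le> \<mu> / 8"
  proof -
    have "\<bar>\<nu>\<bar> * \<theta> \<le> (\<bar>\<nu>\<bar> + 1) * \<theta>" using \<theta>(1) by simp
    also have "\<dots> \<le> \<mu> / 8" using \<theta>(5) by (simp add: field_simps)
    finally show ?thesis .
  qed
  have \<rho>1: "3 * \<kappa> * \<rho> \<le> h1" using \<rho>(5) \<kappa> by (simp add: field_simps)
  have \<rho>2: "2 * \<bar>q\<bar> * \<rho> \<le> \<mu> / 8"
  proof -
    have "2 * \<bar>q\<bar> * \<rho> \<le> 2 * (\<bar>q\<bar> + 1) * \<rho>" using \<rho>(1) by simp
    also have "\<dots> \<le> \<mu> / 8" using \<rho>(6) by (simp add: field_simps)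
    finally show ?thesis .
  qed
  \<comment> \<open>Counts the errors of size \<eta> s: 2 from the raised height of \<Phi>, 1 from
    \<open>low\<close>, 2 from the values of \<phi> at i and c, then the drift and the offset of c
    from the ray.\<close>
  define E where "E = 5 + 8 * \<kappa>0 + \<bar>q\<bar>"
  have E: "0 < E" using \<kappa>0 by (simp add: E_def)
  define \<eta> where "\<eta> = Min {1 / 2, h / 8, w / 8, \<theta> * \<mu> / (8 * E), \<rho>\<^sup>2 / (2 * E), \<mu> / 32}"
  have "0 < \<eta>"
    unfolding \<eta>_def using h w \<theta>(1) \<mu> E \<rho>(1) by (subst Min_gr_iff) auto
  moreover have "\<eta> \<le> 1 / 2" "\<eta> \<le> h / 8" "\<eta> \<le> w / 8" "\<eta> \<le> \<theta> * \<mu> / (8 * E)" "\<eta> \<le> \<rho>\<^sup>2 / (2 * E)" "\<eta> \<le> \<mu> / 32"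
    unfolding \<eta>_def by (rule Min_le, simp, blast)+
  ultimately have \<eta>: "0 < \<eta>" "\<eta> \<le> 1 / 2" "\<eta> \<le> h / 8" "\<eta> \<le> w / 8" "\<eta> \<le> \<theta> * \<mu> / (8 * E)" "\<eta> \<le> \<rho>\<^sup>2 / (2 * E)" "\<eta> \<le> \<mu> / 32"
    by blast+
  have \<eta>1: "\<eta> * E \<le> \<theta> * \<mu> / 8" "\<eta> * E \<le> \<rho>\<^sup>2 / 2" using \<eta>(5,6) E by (simp_all add: field_simps)
  obtain k where k: "k \<ge> 1" "\<And>i. i \<ge> k \<Longrightarrow> \<bar>ln (\<phi> i)\<bar> \<le> \<eta> / (w + 1) * real_of_int i"
    using test_funs_subexponential[OF \<phi>(1), of "\<eta> / (w + 1)"] \<eta>(1) w by auto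
  obtain T where T: "\<And>t i. t \<ge> T \<Longrightarrow> \<bar>real_of_int i - w * t\<bar> \<le> h * t \<Longrightarrow>
      exp (t * (z - \<eta>) + q * (real_of_int i - w * t) - \<kappa>0 * ((real_of_int i - w * t)\<^sup>2 / t)) \<le> u t i"
    using low[OF \<eta>(1)] by blast
  define S where "S = Max {1, 2 * T, 1 / \<rho>, 2 * (real_of_int (max n k) + 1) / w, - 2 * ln s0 / \<mu>}"
  obtain s c where s: "s \<ge> S" and c: "\<bar>real_of_int c - w * s\<bar> \<le> \<eta> * s" "u s c \<le> exp (s * (z + \<eta>))"
    using up[OF \<eta>(1), of S] by blast
  have s1: "1 \<le> s" "2 * T \<le> s" "1 / \<rho> \<le> s" "2 * (real_of_int (max n k) + 1) / w \<le> s" "- 2 * ln s0 / \<mu> \<le> s"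
    unfolding S_def by (rule order_trans[OF Max_ge s[unfolded S_def]], simp, blast)+
  have s2: "1 \<le> \<rho> * s" using s1(3) \<rho>(1) by (simp add: field_simps)
  have s3: "real_of_int (max n k) + 1 \<le> w / 2 * s" using s1(4) w by (simp add: field_simps)
  have s4: "- (s * \<mu> / 2) \<le> ln s0" using s1(5) \<mu> by (simp add: field_simps)
  have wide: "n < i \<and> k \<le> i \<and> real_of_int i \<le> (w + 1) * s \<and> \<bar>ln (\<phi> i)\<bar> \<le> \<eta> * s"
    if i: "\<bar>real_of_int (i - c)\<bar> \<le> 2 * \<rho> * s" for i
  proof -
    have "\<bar>real_of_int i - w * s\<bar> \<le> (2 * \<rho> + \<eta>) * s"
      using i c(1) by (simp add: algebra_simps)
    also have "(2 * \<rho> + \<eta>) * s \<le> min (w / 2) 1 * s"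
      using \<rho>(3,4) \<eta>(2,4) w s1(1) \<rho>(2) \<eta>(3) by (intro mult_right_mono) auto
    finally have A: "\<bar>real_of_int i - w * s\<bar> \<le> min (w / 2) 1 * s" .
    moreover have "min (w / 2) 1 * s \<le> w / 2 * s" "min (w / 2) 1 * s \<le> 1 * s"
      using s1(1) by (intro mult_right_mono; simp)+
    ultimately have i1: "w / 2 * s \<le> real_of_int i" "real_of_int i \<le> (w + 1) * s"
      by (simp_all add: algebra_simps abs_le_iff)
    then have i2: "max n k < i" using s3 by linarith
    have "\<bar>ln (\<phi> i)\<bar> \<le> \<eta> / (w + 1) * real_of_int i" using k(2) i2 by simp
    also have "\<dots> \<le> \<eta> / (w + 1) * ((w + 1) * s)" using i1 \<eta>(1) w by (intro mult_left_mono) auto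
    also have "\<dots> = \<eta> * s" using w by (simp add: field_simps)
    finally show ?thesis using i1 i2 by auto
  qed
  have cw: "\<bar>ln (\<phi> c)\<bar> \<le> \<eta> * s" "0 < \<phi> c"
    using wide[of c] \<rho>(1) s1(1) test_funs_pos[OF \<phi>(1), of c] by auto
  \<comment> \<open>The height z + 2 \<eta> puts \<open>v s c\<close> above the bound exp(s (z +
    \<eta>)) for \<open>u s c\<close>.\<close>
  define \<Phi> where "\<Phi> t i = s * (z + 2 * \<eta>) + \<nu> * (t - s) + q * real_of_int (i - c) - \<kappa> * ((real_of_int (i - c))\<^sup>2 / s)" for t i
  define v where "v t i = exp (\<Phi> t i) * (\<phi> i / \<phi> c)" for t i
  have v_exp: "v t i = exp (\<Phi> t i + ln (\<phi> i) - ln (\<phi> c))" "0 < \<phi> i"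
    if "\<bar>real_of_int (i - c)\<bar> \<le> 2 * \<rho> * s" for t i
  proof -
    show p: "0 < \<phi> i" using wide[OF that] test_funs_pos[OF \<phi>(1), of i] by simp
    show "v t i = exp (\<Phi> t i + ln (\<phi> i) - ln (\<phi> c))"
      unfolding v_def using p cw(2) by (simp add: exp_add exp_diff)
  qed
  have lower: "v t i < u t i"
    if i: "\<bar>real_of_int (i - c)\<bar> \<le> 2 * \<rho> * s" and t: "(1 - \<theta>) * s \<le> t" "t \<le> s"
      and far: "t = (1 - \<theta>) * s \<or> \<rho> * s < \<bar>real_of_int (i - c)\<bar>" for t i
  proof -
    define j where "j = real_of_int (i - c)"
    define e where "e = real_of_int c - w * s"
    define \<tau> where "\<tau> = s - t"
    have \<tau>: "0 \<le> \<tau>" "\<tau> \<le> \<theta> * s" using t by (auto simp: \<tau>_def algebra_simps)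
    have e: "\<bar>e\<bar> \<le> \<eta> * s" using c(1) by (simp add: e_def)
    have ts: "s / 2 \<le> t"
    proof -
      have "\<theta> * s \<le> 1 / 2 * s" using \<theta>(2) s1(1) by (intro mult_right_mono) auto
      then show ?thesis using t by (simp add: algebra_simps)
    qed
    have x: "real_of_int i - w * t = j + e + w * \<tau>" by (simp add: j_def e_def \<tau>_def algebra_simps)
    have inside: "\<bar>real_of_int i - w * t\<bar> \<le> h * t"
    proof -
      have "\<bar>j + e + w * \<tau>\<bar> \<le> 2 * \<rho> * s + \<eta> * s + (w * \<theta>) * s"
      proof -
        have "w * \<tau> \<le> w * (\<theta> * s)" using \<tau> w by (intro mult_left_mono) auto
        moreover have "0 \<le> w * \<tau>" using \<tau> w by simp
        ultimately show ?thesis using i e unfolding j_def by (simp add: algebra_simps)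
      qed
      also have "\<dots> = (2 * \<rho> + \<eta> + w * \<theta>) * s" by (simp add: algebra_simps)
      also have "\<dots> \<le> (h / 2) * s" using \<rho>(2) \<eta>(3) \<theta>1 s1(1) h by (intro mult_right_mono) auto
      also have "\<dots> = h * (s / 2)" by simp
      also have "\<dots> \<le> h * t" using ts h by (intro mult_left_mono) auto
      finally show ?thesis unfolding x .
    qed
    have sq: "\<kappa>0 * ((j + e + w * \<tau>)\<^sup>2 / t) \<le> \<kappa>0 * (4 * (j\<^sup>2 / s) + 8 * \<eta> * s + 8 * w\<^sup>2 * \<theta> * \<tau>)"
      using quadratic_drift[of s t \<tau> \<theta> e \<eta> j w] s1(1) ts \<tau> e \<eta>(1,2) \<kappa>0 by (intro mult_left_mono) auto
    have qe: "- (\<bar>q\<bar> * (\<eta> * s)) \<le> q * e"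
      using mult_left_mono[OF e, of "\<bar>q\<bar>"] abs_le_iff[of "q * e" "\<bar>q\<bar> * (\<eta> * s)"] by (simp add: abs_mult)
    have \<tau>1: "\<mu> / 4 * \<tau> \<le> (\<mu> / 2 + (l + q * w) - 8 * \<kappa>0 * w\<^sup>2 * \<theta>) * \<tau>"
      using \<theta>2 l(2) \<tau>(1) by (intro mult_right_mono) auto
    \<comment> \<open>The gain over the errors comes from the time difference at the initial time
      and from the Gaussian on the lateral boundary.\<close>
    have strict: "\<eta> * E * s < \<mu> / 4 * \<tau> + j\<^sup>2 / s"
      using far
    proof
      assume "t = (1 - \<theta>) * s"
      then have "\<tau> = \<theta> * s" by (simp add: \<tau>_def algebra_simps)
      then have "\<mu> / 4 * \<tau> = \<theta> * \<mu> / 4 * s" by simp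
      moreover have "\<eta> * E * s \<le> \<theta> * \<mu> / 8 * s" using \<eta>1(1) s1(1) by (intro mult_right_mono) auto
      moreover have "\<theta> * \<mu> / 8 * s < \<theta> * \<mu> / 4 * s" using \<theta>(1) \<mu> s1(1) by simp
      moreover have "0 \<le> j\<^sup>2 / s" using s1(1) by simp
      ultimately show ?thesis by linarith
    next
      assume "\<rho> * s < \<bar>real_of_int (i - c)\<bar>"
      then have "(\<rho> * s)\<^sup>2 \<le> j\<^sup>2"
        using power_mono[of "\<rho> * s" "\<bar>j\<bar>" 2] \<rho>(1) s1(1) by (simp add: j_def)
      then have "\<rho>\<^sup>2 * s \<le> j\<^sup>2 / s" using s1(1) by (simp add: field_simps power2_eq_square)
      moreover have "\<eta> * E * s \<le> \<rho>\<^sup>2 / 2 * s" using \<eta>1(2) s1(1) by (intro mult_right_mono) auto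
      moreover have "\<rho>\<^sup>2 / 2 * s < \<rho>\<^sup>2 * s" using \<rho>(1) s1(1) by simp
      moreover have "0 \<le> \<mu> / 4 * \<tau>" using \<mu> \<tau> by simp
      ultimately show ?thesis by linarith
    qed
    have "\<Phi> t i + ln (\<phi> i) - ln (\<phi> c)
        < t * (z - \<eta>) + q * (real_of_int i - w * t) - \<kappa>0 * ((real_of_int i - w * t)\<^sup>2 / t)"
    proof -
      have t_eq: "t = s - \<tau>" by (simp add: \<tau>_def)
      have \<Phi>1: "\<Phi> t i = s * z + 2 * (\<eta> * s) - \<nu> * \<tau> + q * j - 4 * (\<kappa>0 * (j\<^sup>2 / s)) - j\<^sup>2 / s"
        unfolding \<Phi>_def j_def[symmetric] by (simp add: \<tau>_def \<kappa>_def algebra_simps add_divide_distrib)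
      have G1: "t * (z - \<eta>) + q * (j + e + w * \<tau>) = s * z - \<eta> * s + \<tau> * \<mu> + \<tau> * \<eta> + q * j + q * e + q * w * \<tau>"
        by (simp add: t_eq \<mu>_def algebra_simps)
      have Q1: "\<kappa>0 * (4 * (j\<^sup>2 / s) + 8 * \<eta> * s + 8 * w\<^sup>2 * \<theta> * \<tau>)
          = 4 * (\<kappa>0 * (j\<^sup>2 / s)) + 8 * \<kappa>0 * (\<eta> * s) + 8 * \<kappa>0 * w\<^sup>2 * \<theta> * \<tau>"
        by (simp add: algebra_simps)
      have E1: "\<eta> * E * s = 5 * (\<eta> * s) + 8 * \<kappa>0 * (\<eta> * s) + \<bar>q\<bar> * (\<eta> * s)"
        by (simp add: E_def algebra_simps)
      have T1: "(\<mu> / 2 + (l + q * w) - 8 * \<kappa>0 * w\<^sup>2 * \<theta>) * \<tau>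
          = \<tau> * \<mu> + \<nu> * \<tau> + q * w * \<tau> - 8 * \<kappa>0 * w\<^sup>2 * \<theta> * \<tau>"
        by (simp add: \<nu>_def algebra_simps)
      have p: "0 \<le> \<tau> * \<eta>" using \<tau> \<eta>(1) by simp
      have l1: "ln (\<phi> i) \<le> \<eta> * s" "- ln (\<phi> c) \<le> \<eta> * s" using wide[OF i] cw(1) by auto
      show ?thesis
        unfolding x G1 \<Phi>1 using sq[unfolded Q1] strict[unfolded E1] \<tau>1[unfolded T1] qe p l1 by linarith
    qed
    then have "v t i < exp (t * (z - \<eta>) + q * (real_of_int i - w * t) - \<kappa>0 * ((real_of_int i - w * t)\<^sup>2 / t))"
      unfolding v_exp(1)[OF i] by simp
    also have "\<dots> \<le> u t i" using T[OF _ inside] ts s1(2) by simp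
    finally show ?thesis .
  qed
  have v_small: "0 < v t i" "v t i \<le> s0"
    if i: "\<bar>real_of_int (i - c)\<bar> \<le> 2 * \<rho> * s" and t: "(1 - \<theta>) * s \<le> t" "t \<le> s" for t i
  proof -
    show "0 < v t i" using v_exp(1)[OF i] by simp
    have "\<nu> * (t - s) \<le> \<bar>\<nu>\<bar> * (\<theta> * s)"
    proof -
      have "\<nu> * (t - s) \<le> \<bar>\<nu>\<bar> * \<bar>t - s\<bar>" by (metis abs_ge_self abs_mult)
      also have "\<dots> \<le> \<bar>\<nu>\<bar> * (\<theta> * s)" using t by (intro mult_left_mono) (auto simp: algebra_simps)
      finally show ?thesis .
    qed
    also have "\<dots> \<le> \<mu> / 8 * s" using mult_right_mono[OF \<theta>3, of s] s1(1) by simp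
    finally have 1: "\<nu> * (t - s) \<le> \<mu> / 8 * s" .
    have "q * real_of_int (i - c) \<le> \<bar>q\<bar> * \<bar>real_of_int (i - c)\<bar>" by (metis abs_ge_self abs_mult)
    also have "\<dots> \<le> \<bar>q\<bar> * (2 * \<rho> * s)" using i by (intro mult_left_mono) auto
    also have "\<dots> \<le> \<mu> / 8 * s" using mult_right_mono[OF \<rho>2, of s] s1(1) by (simp add: algebra_simps)
    finally have 2: "q * real_of_int (i - c) \<le> \<mu> / 8 * s" .
    have 3: "0 \<le> \<kappa> * ((real_of_int (i - c))\<^sup>2 / s)" using \<kappa> s1(1) by simp
    have 4: "\<eta> * s \<le> \<mu> / 32 * s" using \<eta>(7) s1(1) by (intro mult_right_mono) auto
    have 5: "s * (z + 2 * \<eta>) = - (\<mu> * s) + 2 * (\<eta> * s)" by (simp add: \<mu>_def algebra_simps)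
    have 6: "0 \<le> \<mu> * s" using \<mu> s1(1) by simp
    have "\<Phi> t i + ln (\<phi> i) - ln (\<phi> c) \<le> - (s * \<mu> / 2)"
      using 1 2 3 4 6 wide[OF i] cw(1) unfolding \<Phi>_def 5 by (simp add: abs_le_iff mult.commute)
    also have "\<dots> \<le> ln s0" by (rule s4)
    finally have "v t i \<le> exp (ln s0)" unfolding v_exp(1)[OF i] by simp
    then show "v t i \<le> s0" using s0(1) by simp
  qed
  \<comment> \<open>The boundary sites c - R - 1 and c + R + 1 are farther than \<rho> s from c, and
    within 2 \<rho> s because \<rho> s \<ge> 1.\<close>
  define R where "R = \<lfloor>\<rho> * s\<rfloor>"
  have R: "real_of_int R \<le> \<rho> * s" "\<rho> * s < real_of_int R + 1" "0 \<le> R"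
    using s2 by (auto simp: R_def) 
  have near: "\<bar>real_of_int (i - c)\<bar> \<le> 2 * \<rho> * s" if "c - R - 1 \<le> i" "i \<le> c + R + 1" for i
  proof -
    have "\<bar>real_of_int (i - c)\<bar> \<le> real_of_int R + 1" using that by linarith
    then show ?thesis using R s2 by linarith
  qed
  have "v s c < u s c"
  proof (rule strict_subsolution_below[where a = "c - R" and b = "c + R" and v = v
        and S = "(1 - \<theta>) * s" and T = s and v' = "\<lambda>t i. \<nu> * v t i"])
    show "0 \<le> (1 - \<theta>) * s" "(1 - \<theta>) * s \<le> s" "s \<le> s" using \<theta>(1,2) s1(1) by (auto simp: algebra_simps)
    show "c - R \<le> c" "c \<le> c + R" using R by auto
    show "((\<lambda>\<tau>. v \<tau> i) has_real_derivative \<nu> * v t i) (at t)" for t i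
      unfolding v_def \<Phi>_def using cw(2) by (auto intro!: derivative_eq_intros)
    show "v ((1 - \<theta>) * s) i < u ((1 - \<theta>) * s) i" if "c - R \<le> i" "i \<le> c + R" for i
      using that \<theta>(1) s1(1) by (intro lower near) (auto simp: algebra_simps)
    show "v t (c - R - 1) \<le> u t (c - R - 1)" if "(1 - \<theta>) * s \<le> t" "t \<le> s" for t
      by (rule less_imp_le, rule lower, rule near) (use that R in auto)
    show "v t (c + R + 1) \<le> u t (c + R + 1)" if "(1 - \<theta>) * s \<le> t" "t \<le> s" for t
      by (rule less_imp_le, rule lower, rule near) (use that R in auto)
    show "\<nu> * v t i < d' i * (v t (i + 1) - v t i) + d i * (v t (i - 1) - v t i) + f i (v t i)"
      if t: "(1 - \<theta>) * s < t" "t \<le> s" and i: "c - R \<le> i" "i \<le> c + R" for t i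
    proof -
      define j where "j = real_of_int (i - c)"
      have j: "\<bar>j\<bar> \<le> \<rho> * s" using i R unfolding j_def by linarith
      define A where "A = exp (\<Phi> t i) / \<phi> c"
      \<comment> \<open>Ratios of the Gaussian factor at the two neighbours to its value at
        i.\<close>
      define \<alpha> where "\<alpha> = exp (- (\<kappa> * ((2 * j + 1) / s)))"
      define \<beta> where "\<beta> = exp (- (\<kappa> * ((1 - 2 * j) / s)))"
      have A: "0 < A" using cw(2) by (simp add: A_def)
      have jb: "(2 * j + 1) / s \<le> 3 * \<rho>" "(1 - 2 * j) / s \<le> 3 * \<rho>"
        using j s2 s1(1) by (auto simp: divide_le_eq abs_le_iff)
      have "\<kappa> * ((2 * j + 1) / s) \<le> \<kappa> * (3 * \<rho>)" "\<kappa> * ((1 - 2 * j) / s) \<le> \<kappa> * (3 * \<rho>)"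
        using mult_left_mono[OF jb(1), of \<kappa>] mult_left_mono[OF jb(2), of \<kappa>] \<kappa> by auto
      then have \<alpha>\<beta>: "exp (- h1) \<le> \<alpha>" "exp (- h1) \<le> \<beta>"
        using \<rho>1 by (simp_all add: \<alpha>_def \<beta>_def algebra_simps)
      have v0: "v t i = A * \<phi> i" by (simp add: v_def A_def)
      have vp: "v t (i + 1) = A * (exp q * \<alpha> * \<phi> (i + 1))"
      proof -
        have "\<Phi> t (i + 1) = \<Phi> t i + q - \<kappa> * ((2 * j + 1) / s)"
        proof -
          have "(real_of_int (i + 1 - c))\<^sup>2 / s = j\<^sup>2 / s + (2 * j + 1) / s"
            by (simp add: j_def add_divide_distrib[symmetric] power2_eq_square algebra_simps)
          then show ?thesis unfolding \<Phi>_def j_def[symmetric] by (simp add: j_def algebra_simps)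
        qed
        then have "exp (\<Phi> t (i + 1)) = exp (\<Phi> t i) * exp q * \<alpha>"
          by (simp only: \<alpha>_def exp_add[symmetric] add_uminus_conv_diff)
        then show ?thesis by (simp add: v_def A_def)
      qed
      have vm: "v t (i - 1) = A * (exp (- q) * \<beta> * \<phi> (i - 1))"
      proof -
        have "\<Phi> t (i - 1) = \<Phi> t i - q - \<kappa> * ((1 - 2 * j) / s)"
        proof -
          have "(real_of_int (i - 1 - c))\<^sup>2 / s = j\<^sup>2 / s + (1 - 2 * j) / s"
            by (simp add: j_def add_divide_distrib[symmetric] power2_eq_square algebra_simps)
          then show ?thesis unfolding \<Phi>_def j_def[symmetric] by (simp add: j_def algebra_simps)
        qed
        then have "exp (\<Phi> t (i - 1)) = exp (\<Phi> t i) * exp (- q) * \<beta>"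
          by (simp only: \<beta>_def exp_add[symmetric] add_uminus_conv_diff)
        then show ?thesis by (simp add: v_def A_def)
      qed
      have pos: "0 < \<phi> (i - 1)" "0 < \<phi> i" "0 < \<phi> (i + 1)"
        using i by (auto intro!: v_exp(2) near)
      have "n < i" using wide[OF near[of i]] i by simp
      then have "(l - \<mu> / 4) * \<phi> i \<le> d' i * exp q * \<alpha> * \<phi> (i + 1) + d i * exp (- q) * \<beta> * \<phi> (i - 1) - (d i + d' i - r i) * \<phi> i"
        using \<alpha>\<beta> h1 pos
        by (intro order_trans[OF mult_right_mono[OF h1l] perturb_lower[OF \<phi>(2)]]) auto
      then have "A * ((l - \<mu> / 4) * \<phi> i) \<le> A * (d' i * exp q * \<alpha> * \<phi> (i + 1) + d i * exp (- q) * \<beta> * \<phi> (i - 1) - (d i + d' i - r i) * \<phi> i)"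
        using A by (intro mult_left_mono) auto
      then have lin: "(l - \<mu> / 4) * v t i \<le> d' i * v t (i + 1) + d i * v t (i - 1) - (d i + d' i - r i) * v t i"
        unfolding v0 vp vm by (simp add: algebra_simps)
      have vb: "0 < v t i" "v t i \<le> s0" using v_small[OF near, of i t] i t by auto
      have "(r i - K * v t i powr \<gamma>) * v t i \<le> f i (v t i)" using vb s0(2) by (intro f_ge) auto
      moreover have "(r i - \<mu> / 8) * v t i < (r i - K * v t i powr \<gamma>) * v t i"
        using s0(3)[of "v t i"] vb by (intro mult_strict_right_mono) auto
      ultimately have "(r i - \<mu> / 8) * v t i < f i (v t i)" by simp
      moreover have "\<nu> * v t i \<le> (l - \<mu> / 4) * v t i - \<mu> / 8 * v t i"
      proof -
        have "0 \<le> \<mu> / 8 * v t i" using \<mu> vb by simp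
        then show ?thesis by (simp add: \<nu>_def algebra_simps)
      qed
      ultimately show ?thesis using lin by (simp add: algebra_simps)
    qed
  qed
  moreover have "v s c = exp (s * (z + 2 * \<eta>))" using cw(2) by (simp add: v_def \<Phi>_def)
  moreover have "exp (s * (z + \<eta>)) < exp (s * (z + 2 * \<eta>))" using s1(1) \<eta>(1) by simp
  ultimately show False using c(2) by linarith
qed

lemma speed_lower_pos: "0 < speed_lower d d' f"
proof -
  obtain p where "0 < p" "speed_lower d d' f = H_lower d d' f (- p) / p"
    using speed_lower_min by blast
  then show ?thesis using H_lower_ge_\<delta>[of "- p"] \<delta>_pos by simp
qed

text \<open>If the claim failed, the penalised exponential rate \<open>val\<close> would have a negative lower limit
  \<open>m1\<close>, approached along a nearby ray \<open>w1\<close>, where \<open>u\<close> is touched from below by a smooth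
  exponential profile. The weight \<open>\<kappa>\<close> is such that outside the cone of half-width \<open>h\<close> the penalty
  alone outweighs the crude bound \<open>- C\<close> on the rate.\<close>

lemma no_decay_on_ray:
  assumes w0: "0 < w0" "w0 < speed_lower d d' f" and \<eta>: "0 < \<eta>"
  shows "\<exists>T. \<forall>t\<ge>T. \<forall>i. \<bar>real_of_int i - w0 * t\<bar> \<le> A \<longrightarrow> exp (- (\<eta> * t)) \<le> u t i"
proof -
  \<comment> \<open>Every ray with slope within h of \<open>w0\<close> still has positive slope
    below the lower speed.\<close>
  define h where "h = min (w0 / 4) ((speed_lower d d' f - w0) / 4)"
  have "0 < h" using w0 by (simp add: h_def)
  moreover have "h \<le> w0 / 4" "h \<le> (speed_lower d d' f - w0) / 4"
    unfolding h_def by (rule min.cobounded1, rule min.cobounded2)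
  ultimately have h: "0 < h" "h \<le> w0 / 4" "h \<le> (speed_lower d d' f - w0) / 4" by blast+
  obtain C T0 where C: "0 < C" "1 \<le> T0"
    "\<And>t i. T0 \<le> t \<Longrightarrow> \<bar>real_of_int i\<bar> \<le> (w0 + 2 * h) * t \<Longrightarrow> exp (- (C * t)) \<le> u t i"
    using u_exponential_lower[of "w0 + 2 * h"] w0 h by (metis add_pos_pos mult_pos_pos zero_less_numeral)
  define \<kappa> where "\<kappa> = C / h\<^sup>2"
  have \<kappa>: "0 < \<kappa>" "\<kappa> * h\<^sup>2 = C" using C h by (auto simp: \<kappa>_def)
  define val where "val t i = ln (u t i) / t + \<kappa> * (real_of_int i / t - w0)\<^sup>2" for t i
  have u_val: "u t i = exp (t * (val t i - \<kappa> * (real_of_int i / t - w0)\<^sup>2))" if "0 < t" for t i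
    using that u_pos[of t i] by (simp add: val_def)
  have lnu: "- C \<le> ln (u t i) / t" if t: "T0 \<le> t" and i: "\<bar>real_of_int i - w0 * t\<bar> \<le> 2 * h * t" for t i
  proof -
    have t0: "0 < t" using t C by simp
    have "0 \<le> w0 * t" using w0 t0 by simp
    then have "\<bar>real_of_int i\<bar> \<le> (w0 + 2 * h) * t" using i by (simp add: algebra_simps abs_le_iff)
    then have "exp (- (C * t)) \<le> u t i" using C(3) t by blast
    then have "- (C * t) \<le> ln (u t i)" using u_pos[OF t0, of i] by (simp add: ln_ge_iff)
    then show ?thesis using t0 by (simp add: field_simps)
  qed
  \<comment> \<open>The supremum of \<open>S\<close> is the lower limit of \<open>val\<close> over
    the cone, uniform in the site.\<close>
  define S where "S = {c. \<exists>T. \<forall>t\<ge>T. \<forall>i. \<bar>real_of_int i - w0 * t\<bar> \<le> h * t \<longrightarrow> c \<le> val t i}"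
  have S_down: "c' \<in> S" if "c \<in> S" "c' \<le> c" for c c' using that by (force simp: S_def)
  have neg_in_S: "c \<in> S" if c: "c < 0" for c
  proof (rule ccontr)
    assume nS: "c \<notin> S"
    have "- C \<le> val t i" if "T0 \<le> t" "\<bar>real_of_int i - w0 * t\<bar> \<le> h * t" for t i
    proof -
      have "h * t \<le> 2 * h * t" using h that C by simp
      then show ?thesis using lnu[of t i] \<kappa> that by (auto simp: val_def intro: add_increasing2)
    qed
    then have CS: "- C \<in> S" by (auto simp: S_def)
    have bdd: "bdd_above S" using S_down nS by (intro bdd_aboveI[of _ c]) (meson not_le less_imp_le)
    define m1 where "m1 = Sup S"
    have m1: "m1 \<le> c" unfolding m1_def using CS S_down nS by (intro cSup_least) (auto, meson not_le less_imp_le)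
    have below: "m1 - e \<in> S" if "0 < e" for e
    proof -
      have "\<exists>x\<in>S. m1 - e < x" unfolding m1_def using CS bdd that by (subst less_cSup_iff[symmetric]) auto
      then show ?thesis using S_down less_imp_le by blast
    qed
    have above: "m1 + e \<notin> S" if "0 < e" for e
      using cSup_upper[OF _ bdd, of "m1 + e"] that by (auto simp: m1_def)
    have "\<exists>t i. real (Suc k) \<le> t \<and> \<bar>real_of_int i - w0 * t\<bar> \<le> h * t \<and> val t i < m1 + 1 / real (Suc k)" for k
      using above[of "1 / real (Suc k)"] by (force simp: S_def not_le)
    then obtain t i where ti: "\<And>k. real (Suc k) \<le> t k" "\<And>k. \<bar>real_of_int (i k) - w0 * t k\<bar> \<le> h * t k"
      "\<And>k. val (t k) (i k) < m1 + 1 / real (Suc k)" by metis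
    have tpos: "0 < t k" for k using ti(1)[of k] by simp
    define x where "x k = real_of_int (i k) / t k" for k
    have "x k \<in> {w0 - h..w0 + h}" for k
      using ti(2)[of k] tpos[of k] by (auto simp: x_def abs_le_iff field_simps)
    then obtain w1 \<sigma> where w1: "w1 \<in> {w0 - h..w0 + h}" and \<sigma>: "strict_mono \<sigma>" "(x \<circ> \<sigma>) \<longlonglongrightarrow> w1"
      using compact_Icc[of "w0 - h" "w0 + h"] unfolding compact_def by metis
    \<comment> \<open>Recentring the penalising parabola at the contact ray \<open>w1\<close>:
      \<open>q\<close> is its slope there and \<open>z\<close> its height.\<close>
    define z where "z = m1 - \<kappa> * (w1 - w0)\<^sup>2"
    define q where "q = - 2 * \<kappa> * (w1 - w0)"
    have expand: "z + q * (y - w1) - \<kappa> * (y - w1)\<^sup>2 = m1 - \<kappa> * (y - w0)\<^sup>2" for y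
      by (simp add: z_def q_def power2_eq_square algebra_simps)
    show False
    proof (rule touching_contradiction[where w = w1 and h = h and ?\<kappa>0.0 = \<kappa> and z = z and q = q])
      show w1pos: "0 < w1" using w1 w0 h by simp
      show "0 < h" "0 \<le> \<kappa>" using h \<kappa> by auto
      show "z < 0" using m1 c \<kappa> by (simp add: z_def) (smt (verit) mult_nonneg_nonneg zero_le_power2)
      \<comment> \<open>Negative \<open>q\<close> is the case covered by the minimality of the
        speed, with p = -q; otherwise positivity of \<open>H_lower\<close> suffices.\<close>
      show "0 < H_lower d d' f q + q * w1"
      proof (cases "0 \<le> q")
        case True
        then show ?thesis using H_lower_ge_\<delta>[of q] \<delta>_pos w1pos by (simp add: add_pos_nonneg)
      next
        case False
        have "speed_lower d d' f \<le> H_lower d d' f (- (- q)) / (- q)"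
          using speed_lower_min False by (metis neg_0_less_iff_less not_le)
        then have "speed_lower d d' f * (- q) \<le> H_lower d d' f q"
          using False by (simp add: field_simps)
        moreover have "w1 * (- q) < speed_lower d d' f * (- q)"
          using w1 h w0 False by (intro mult_strict_right_mono) auto
        ultimately show ?thesis by (simp add: algebra_simps)
      qed
      show "\<exists>T. \<forall>t\<ge>T. \<forall>i. \<bar>real_of_int i - w1 * t\<bar> \<le> h * t \<longrightarrow>
          exp (t * (z - e) + q * (real_of_int i - w1 * t) - \<kappa> * ((real_of_int i - w1 * t)\<^sup>2 / t)) \<le> u t i"
        if e: "0 < e" for e
      proof -
        obtain T where T: "\<And>t i. t \<ge> T \<Longrightarrow> \<bar>real_of_int i - w0 * t\<bar> \<le> h * t \<Longrightarrow> m1 - e \<le> val t i"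
          using below[OF e] by (auto simp: S_def)
        have "exp (t * (z - e) + q * (real_of_int i - w1 * t) - \<kappa> * ((real_of_int i - w1 * t)\<^sup>2 / t)) \<le> u t i"
          if t: "t \<ge> max T T0" and i: "\<bar>real_of_int i - w1 * t\<bar> \<le> h * t" for t i
        proof -
          have t0: "0 < t" using t C by auto
          define y where "y = real_of_int i / t"
          have iy: "real_of_int i = y * t" using t0 by (simp add: y_def)
          have "m1 - e \<le> val t i"
          proof (cases "\<bar>real_of_int i - w0 * t\<bar> \<le> h * t")
            case True
            then show ?thesis using T t by auto
          next
            case False
            have "\<bar>w1 * t - w0 * t\<bar> \<le> h * t"
              using w1 t0 unfolding left_diff_distrib[symmetric] by (simp add: abs_mult abs_le_iff)
            then have "\<bar>real_of_int i - w0 * t\<bar> \<le> 2 * h * t" using i by linarith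
            then have 1: "- C \<le> ln (u t i) / t" using lnu t by auto
            have "h * t \<le> \<bar>(y - w0) * t\<bar>" using False by (simp add: iy algebra_simps)
            then have "h \<le> \<bar>y - w0\<bar>" using t0 by (simp add: abs_mult)
            then have "h\<^sup>2 \<le> (y - w0)\<^sup>2" using power_mono[of h "\<bar>y - w0\<bar>" 2] h by simp
            then have "C \<le> \<kappa> * (y - w0)\<^sup>2" using \<kappa> mult_left_mono[of "h\<^sup>2" "(y - w0)\<^sup>2" \<kappa>] by simp
            then have "0 \<le> val t i" using 1 by (simp add: val_def y_def)
            then show ?thesis using m1 c e by simp
          qed
          have "t * (z - e) + q * (real_of_int i - w1 * t) - \<kappa> * ((real_of_int i - w1 * t)\<^sup>2 / t)
              = t * (z + q * (y - w1) - \<kappa> * (y - w1)\<^sup>2) - t * e"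
            using t0 by (simp add: iy field_simps power2_eq_square)
          also have "\<dots> = t * ((m1 - e) - \<kappa> * (y - w0)\<^sup>2)" unfolding expand by (simp add: algebra_simps)
          also have "\<dots> \<le> t * (val t i - \<kappa> * (y - w0)\<^sup>2)"
            using \<open>m1 - e \<le> val t i\<close> t0 by (intro mult_left_mono) auto
          finally show ?thesis unfolding u_val[OF t0, of i] y_def by simp
        qed
        then show ?thesis by blast
      qed
      show "\<exists>t\<ge>T. \<exists>i. \<bar>real_of_int i - w1 * t\<bar> \<le> e * t \<and> u t i \<le> exp (t * (z + e))"
        if e: "0 < e" for e T
      proof -
        \<comment> \<open>Pays both for the overshoot of \<open>val\<close> above \<open>m1\<close>
          and for the slope term q (x - w1).\<close>
        define e2 where "e2 = e / (1 + \<bar>q\<bar>)"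
        have e2: "0 < e2" "e2 * (1 + \<bar>q\<bar>) = e" using e by (auto simp: e2_def add_pos_nonneg)
        have e2e: "e2 \<le> e" using e2 by (metis abs_ge_zero le_add_same_cancel1 less_imp_le mult_left_mono mult.right_neutral)
        have "\<forall>\<^sub>F k in sequentially. dist ((x \<circ> \<sigma>) k) w1 < e2" using \<sigma>(2) e2 by (simp add: tendsto_iff)
        moreover have "\<forall>\<^sub>F k in sequentially. max T (1 / e2) \<le> real k"
          using eventually_ge_at_top[of "nat \<lceil>max T (1 / e2)\<rceil>"] by eventually_elim linarith
        ultimately have "\<forall>\<^sub>F k in sequentially. dist ((x \<circ> \<sigma>) k) w1 < e2 \<and> max T (1 / e2) \<le> real k"
          by (rule eventually_conj)
        then obtain k where k: "dist (x (\<sigma> k)) w1 < e2" "max T (1 / e2) \<le> real k"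
          unfolding eventually_sequentially by auto
        define n where "n = \<sigma> k"
        have kn: "k \<le> n" unfolding n_def using \<sigma>(1) by (rule seq_suble)
        have tn: "real k \<le> t n" using ti(1)[of n] kn by simp
        have xn: "\<bar>x n - w1\<bar> < e2" using k by (simp add: n_def dist_real_def)
        have "1 / real (Suc n) \<le> 1 / (1 / e2)" using k(2) kn e2 by (intro divide_left_mono) auto
        then have vn: "val (t n) (i n) < m1 + e2" using ti(3)[of n] by simp
        have "\<bar>real_of_int (i n) - w1 * t n\<bar> = \<bar>x n - w1\<bar> * t n"
          using tpos[of n] by (simp add: x_def abs_mult_pos[symmetric] field_simps abs_mult)
        also have "\<dots> \<le> e * t n" using xn e2e tpos[of n] by (intro mult_right_mono) auto
        finally have 1: "\<bar>real_of_int (i n) - w1 * t n\<bar> \<le> e * t n" .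
        have "q * (x n - w1) \<le> \<bar>q\<bar> * \<bar>x n - w1\<bar>" by (metis abs_ge_self abs_mult)
        also have "\<dots> \<le> \<bar>q\<bar> * e2" using xn by (intro mult_left_mono) auto
        finally have "m1 + e2 - \<kappa> * (x n - w0)\<^sup>2 \<le> z + e2 * (1 + \<bar>q\<bar>) - \<kappa> * (x n - w1)\<^sup>2"
          using expand[of "x n"] by (simp add: algebra_simps)
        also have "\<dots> \<le> z + e" using \<kappa> e2 by simp
        finally have "val (t n) (i n) - \<kappa> * (x n - w0)\<^sup>2 \<le> z + e" using vn by simp
        then have "u (t n) (i n) \<le> exp (t n * (z + e))"
          unfolding u_val[OF tpos, of n "i n"] x_def using tpos[of n] by simp
        then show ?thesis using 1 tn k(2) by (intro exI[of _ "t n"] conjI exI[of _ "i n"]) auto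
      qed
    qed
  qed
  obtain T where T: "\<And>t i. t \<ge> T \<Longrightarrow> \<bar>real_of_int i - w0 * t\<bar> \<le> h * t \<Longrightarrow> - \<eta> / 2 \<le> val t i"
    using neg_in_S[of "- \<eta> / 2"] \<eta> by (auto simp: S_def)
  have "exp (- (\<eta> * t)) \<le> u t i"
    \<comment> \<open>At distance at most A from the ray the penalty is of order 1/t^2, so it fits
      into the other half of \<eta>.\<close>
    if t: "t \<ge> Max {T, 1, \<bar>A\<bar> / h, 2 * \<kappa> * A\<^sup>2 / \<eta>}" and i: "\<bar>real_of_int i - w0 * t\<bar> \<le> A" for t i
  proof -
    have t1: "T \<le> t" "1 \<le> t" "\<bar>A\<bar> / h \<le> t" "2 * \<kappa> * A\<^sup>2 / \<eta> \<le> t" using t by auto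
    have "\<bar>A\<bar> \<le> h * t" using t1(3) h by (simp add: field_simps)
    then have v: "- \<eta> / 2 \<le> val t i" using i t1 by (intro T) auto
    define y where "y = real_of_int i / t - w0"
    have "(y * t)\<^sup>2 \<le> A\<^sup>2"
      using i t1 power_mono[of "\<bar>y * t\<bar>" A 2] by (simp add: y_def left_diff_distrib)
    then have "\<kappa> * (y * t)\<^sup>2 \<le> \<kappa> * A\<^sup>2" using \<kappa> by simp
    also have "\<dots> \<le> \<eta> / 2 * t" using t1(4) \<eta> by (simp add: field_simps)
    also have "\<dots> \<le> \<eta> / 2 * t * t" using mult_left_mono[OF t1(2), of "\<eta> / 2 * t"] t1(2) \<eta> by simp
    finally have "(\<kappa> * y\<^sup>2) * (t * t) \<le> (\<eta> / 2) * (t * t)" by (simp add: power2_eq_square algebra_simps)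
    then have "\<kappa> * y\<^sup>2 \<le> \<eta> / 2" using t1 by (subst (asm) mult_le_cancel_right_pos) auto
    then have "t * (- \<eta>) \<le> t * (val t i - \<kappa> * y\<^sup>2)" using v t1 by (intro mult_left_mono) auto
    then show ?thesis unfolding u_val[of t i, OF less_le_trans[OF zero_less_one t1(2)]] y_def
      by (simp add: mult.commute)
  qed
  then show ?thesis by blast
qed

section \<open>Growth of bumps and persistence\<close>

text \<open>Below amplitude \<epsilon> the Hoelder error is less than l/2, so any rate up to l/2 is
  admissible. Rate l/2 is used to grow, rate 0 to hold the level \<epsilon> indefinitely.\<close>

lemma bump_step:
  assumes bump: "growing_bump l c a b \<psi>" and l: "0 < l"
    and \<epsilon>: "\<epsilon> \<le> 1" "\<And>s. 0 \<le> s \<Longrightarrow> s \<le> \<epsilon> \<Longrightarrow> K * s powr \<gamma> < l / 2"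
    and \<nu>: "0 \<le> \<nu>" "\<nu> \<le> l / 2" and A: "0 < A" "A * exp (\<nu> * (T - S)) \<le> \<epsilon>"
    and S: "0 \<le> S" "\<And>i. i \<in> {a..b} \<Longrightarrow> A * \<psi> i < u S i"
    and t: "S \<le> t" "t \<le> T" and i: "i \<in> {a..b}"
  shows "A * exp (\<nu> * (t - S)) * \<psi> i < u t i"
proof -
  have \<psi>: "0 \<le> \<psi> i" "\<psi> i \<le> 1" "i \<in> {a..b} \<Longrightarrow> 0 < \<psi> i" "i < a \<or> b < i \<Longrightarrow> \<psi> i = 0" for i
    using bump unfolding growing_bump_def by blast+
  have L\<psi>: "l * \<psi> i \<le> d' i * (\<psi> (i + 1) - \<psi> i) + d i * (\<psi> (i - 1) - \<psi> i) + r i * \<psi> i" if "i \<in> {a..b}" for i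
    using bump that unfolding growing_bump_def by blast
  define v where "v t i = A * exp (\<nu> * (t - S)) * \<psi> i" for t i
  have "v t i < u t i"
  proof (rule strict_subsolution_below[where a = a and b = b and v = v and S = S and T = T and v' = "\<lambda>t i. \<nu> * v t i"])
    show "((\<lambda>\<tau>. v \<tau> i) has_real_derivative \<nu> * v t i) (at t)" for t i
      unfolding v_def by (auto intro!: derivative_eq_intros)
    show "v t (a - 1) \<le> u t (a - 1)" "v t (b + 1) \<le> u t (b + 1)" if "S \<le> t" for t
      using that S(1) u_nonneg \<psi>(4)[of "a - 1"] \<psi>(4)[of "b + 1"] by (auto simp: v_def)
    show "v S i < u S i" if "a \<le> i" "i \<le> b" for i using S(2)[of i] that by (simp add: v_def)
    show "\<nu> * v t i < d' i * (v t (i + 1) - v t i) + d i * (v t (i - 1) - v t i) + f i (v t i)"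
      if t: "S < t" "t \<le> T" and i: "a \<le> i" "i \<le> b" for t i
    proof -
      define B where "B = A * exp (\<nu> * (t - S))"
      have B: "0 < B" using A by (simp add: B_def)
      have "B \<le> A * exp (\<nu> * (T - S))" unfolding B_def using t \<nu> A by (simp add: mult_left_mono)
      then have B1: "B \<le> \<epsilon>" using A by simp
      have v: "v t j = B * \<psi> j" for j by (simp add: v_def B_def)
      have vp: "0 < v t i" unfolding v using B \<psi>(3)[of i] i by simp
      have "v t i \<le> B * 1" unfolding v using B \<psi>(2)[of i] by (intro mult_left_mono) auto
      then have v\<epsilon>: "v t i \<le> \<epsilon>" using B1 by simp
      have "B * (l * \<psi> i) \<le> B * (d' i * (\<psi> (i + 1) - \<psi> i) + d i * (\<psi> (i - 1) - \<psi> i) + r i * \<psi> i)"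
        using L\<psi>[of i] i B by (intro mult_left_mono) auto
      then have lin: "l * v t i \<le> d' i * (v t (i + 1) - v t i) + d i * (v t (i - 1) - v t i) + r i * v t i"
        unfolding v by (simp add: algebra_simps)
      have "(r i - K * v t i powr \<gamma>) * v t i \<le> f i (v t i)" using vp v\<epsilon> \<epsilon>(1) by (intro f_ge) auto
      moreover have "(r i - l / 2) * v t i < (r i - K * v t i powr \<gamma>) * v t i"
        using \<epsilon>(2)[of "v t i"] vp v\<epsilon> by (intro mult_strict_right_mono) auto
      moreover have "\<nu> * v t i \<le> l / 2 * v t i" using \<nu> vp by (intro mult_right_mono) auto
      ultimately show ?thesis using lin by (simp add: algebra_simps)
    qed
  qed (use S t i in auto)
  then show ?thesis by (simp add: v_def)
qed

text \<open>The waiting time is logarithmic in 1/A. For exponentially small A it is therefore a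
  small multiple of the elapsed time.\<close>

lemma bump_growth:
  assumes bump: "growing_bump l c a b \<psi>" and l: "0 < l"
    and \<epsilon>: "0 < \<epsilon>" "\<epsilon> \<le> 1" "\<And>s. 0 \<le> s \<Longrightarrow> s \<le> \<epsilon> \<Longrightarrow> K * s powr \<gamma> < l / 2"
    and A: "0 < A" "A \<le> \<epsilon>" and S: "0 \<le> S" "\<And>i. i \<in> {a..b} \<Longrightarrow> A * \<psi> i < u S i"
    and t: "S + 2 / l * ln (\<epsilon> / A) \<le> t"
  shows "\<epsilon> * c \<le> u t a"
proof -
  define T where "T = S + 2 / l * ln (\<epsilon> / A)"
  have ln0: "0 \<le> ln (\<epsilon> / A)" using A \<epsilon> by simp
  then have ST: "S \<le> T" using l by (simp add: T_def)
  have "l / 2 * (T - S) = ln (\<epsilon> / A)" using l by (simp add: T_def)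
  then have AT: "A * exp (l / 2 * (T - S)) = \<epsilon>" using A \<epsilon> by simp
  have 1: "\<epsilon> * \<psi> i < u T i" if "i \<in> {a..b}" for i
    using bump_step[OF bump l \<epsilon>(2,3) _ _ A(1) _ S ST order_refl that, of "l / 2"] AT l by simp
  have "\<epsilon> * exp (0 * (t - T)) * \<psi> a < u t a"
    using bump t ST S(1) l
    by (intro bump_step[OF bump l \<epsilon>(2,3) _ _ \<epsilon>(1) _ _ 1, of 0 t]) (auto simp: T_def growing_bump_def)
  moreover have "\<epsilon> * c \<le> \<epsilon> * \<psi> a" using bump \<epsilon> by (simp add: growing_bump_def)
  ultimately show ?thesis by simp
qed

text \<open>Inflow at least m \<epsilon> against loss at rate at most 2 M drives the site towards m
  \<epsilon> / (2 M); half of that is reached after time 1/M.\<close>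

lemma persistence_neighbour:
  assumes e: "e = 1 \<or> e = - 1" and \<epsilon>: "0 < \<epsilon>" and T: "\<And>t. T \<le> t \<Longrightarrow> \<epsilon> \<le> u t (i - e)"
  shows "\<exists>\<epsilon>>0. \<exists>T. \<forall>t\<ge>T. \<epsilon> \<le> u t i"
proof -
  define S where "S = max T 0"
  define c where "c = m * \<epsilon> / (2 * M)"
  have c: "0 < c" "2 * M * c = m * \<epsilon>" using m_pos M_pos \<epsilon> by (auto simp: c_def)
  have "c / 2 \<le> u t i" if t: "S + 1 / M \<le> t" for t
  proof -
    have tS: "S \<le> t" using t M_pos by (smt (verit) divide_pos_pos)
    have "c * (exp (2 * M * t) - exp (2 * M * S)) \<le> exp (2 * M * t) * u t i"
    proof (rule weighted_lower[where S = S and e = e and G' = "\<lambda>s. exp (2 * M * s) * (m * \<epsilon>)"])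
      show "((\<lambda>s. c * (exp (2 * M * s) - exp (2 * M * S))) has_real_derivative exp (2 * M * s) * (m * \<epsilon>)) (at s)" for s
        unfolding c(2)[symmetric] by (auto intro!: derivative_eq_intros)
      show "exp (2 * M * s) * (m * \<epsilon>) \<le> exp (2 * M * s) * (m * u s (i - e))" if "S < s" for s
        using T[of s] that m_pos by (simp add: S_def)
    qed (use tS e u_nonneg in \<open>auto simp: S_def\<close>)
    moreover have "2 * exp (2 * M * S) \<le> exp (2 * M * t)"
    proof -
      have "1 \<le> M * (t - S)" using t M_pos by (simp add: field_simps)
      then have "2 \<le> exp (2 * M * (t - S))" using exp_ge_add_one_self[of "2 * M * (t - S)"] by linarith
      then have "2 * exp (2 * M * S) \<le> exp (2 * M * (t - S)) * exp (2 * M * S)" by simp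
      then show ?thesis by (simp add: exp_add[symmetric] algebra_simps)
    qed
    then have "c * (exp (2 * M * t) / 2) \<le> c * (exp (2 * M * t) - exp (2 * M * S))"
      using c by (intro mult_left_mono) auto
    moreover have "c * (exp (2 * M * t) / 2) = exp (2 * M * t) * (c / 2)" by simp
    ultimately have "exp (2 * M * t) * (c / 2) \<le> exp (2 * M * t) * u t i" by linarith
    then show ?thesis by (simp only: mult_le_cancel_left_pos exp_gt_zero)
  qed
  then show ?thesis using c(1) by (intro exI[of _ "c / 2"]) auto
qed

text \<open>The constants are fixed before the site, so all sites whose window avoids the core |j| <
  N share one lower bound.\<close>

lemma persistence_far:
  obtains L :: nat and c l \<epsilon> :: real where "0 < c" "0 < l" "0 < \<epsilon>" "\<epsilon> \<le> 1"
    and "\<And>i S A t. \<lbrakk>\<forall>j\<in>{i..i + int L}. N \<le> \<bar>j\<bar>; 0 \<le> S; 0 < A; A \<le> \<epsilon>;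
      \<And>j. j \<in> {i..i + int L} \<Longrightarrow> A < u S j; S + 2 / l * ln (\<epsilon> / A) \<le> t\<rbrakk> \<Longrightarrow> \<epsilon> * c \<le> u t i"
proof -
  obtain L :: nat and c l where L: "0 < c" "0 < l"
    "\<And>a. \<forall>i\<in>{a..a + int L}. N \<le> \<bar>i\<bar> \<Longrightarrow> \<exists>b \<psi>. b \<le> a + int L \<and> growing_bump l c a b \<psi>"
    using growing_bump_exists by metis
  obtain \<epsilon> where \<epsilon>: "0 < \<epsilon>" "\<epsilon> \<le> 1" "\<And>s. 0 \<le> s \<Longrightarrow> s \<le> \<epsilon> \<Longrightarrow> K * s powr \<gamma> < l / 2"
    using small_power[of "l / 2"] L(2) by auto
  show ?thesis
  proof (rule that[OF L(1,2) \<epsilon>(1,2)])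
    fix i S A t
    assume far: "\<forall>j\<in>{i..i + int L}. N \<le> \<bar>j\<bar>" and S: "0 \<le> S" and A: "0 < A" "A \<le> \<epsilon>"
      and u: "\<And>j. j \<in> {i..i + int L} \<Longrightarrow> A < u S j" and t: "S + 2 / l * ln (\<epsilon> / A) \<le> t"
    obtain b \<psi> where b: "b \<le> i + int L" "growing_bump l c i b \<psi>" using L(3)[OF far] by blast
    show "\<epsilon> * c \<le> u t i"
    proof (rule bump_growth[OF b(2) L(2) \<epsilon> A S _ t])
      fix j assume j: "j \<in> {i..b}"
      have "\<psi> j \<le> 1" using b(2) by (simp add: growing_bump_def)
      then have "A * \<psi> j \<le> A * 1" using A by (intro mult_left_mono) auto
      then show "A * \<psi> j < u S j" using u[of j] j b(1) by auto
    qed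
  qed
qed

text \<open>Near the core the gap may fail. Those sites are reached from the right, one neighbour at
  a time; only finitely many lack the common bound, so a minimum remains positive.\<close>

lemma persistence:
  "\<exists>\<epsilon>>0. \<forall>i. \<exists>T. \<forall>t\<ge>T. \<epsilon> \<le> u t i"
proof -
  obtain L c l \<epsilon> where L: "0 < c" "0 < l" "0 < \<epsilon>" "\<epsilon> \<le> 1"
    and far: "\<And>i S A t. \<lbrakk>\<forall>j\<in>{i..i + int L}. N \<le> \<bar>j\<bar>; 0 \<le> S; 0 < A; A \<le> \<epsilon>;
      \<And>j. j \<in> {i..i + int L} \<Longrightarrow> A < u S j; S + 2 / l * ln (\<epsilon> / A) \<le> t\<rbrakk> \<Longrightarrow> \<epsilon> * c \<le> u t i"
    using persistence_far by metis
  have ev_far: "\<exists>T. \<forall>t\<ge>T. \<epsilon> * c \<le> u t i" if "\<forall>j\<in>{i..i + int L}. N \<le> \<bar>j\<bar>" for i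
  proof -
    \<comment> \<open>Time 1, since \<open>u\<close> is positive everywhere only after the initial
      time.\<close>
    define Z where "Z = Min (u 1 ` {i..i + int L})"
    define A where "A = min \<epsilon> (Z / 2)"
    have "0 < Z" unfolding Z_def using u_pos by (subst Min_gr_iff) auto
    then have A: "0 < A" "A \<le> \<epsilon>" using L by (auto simp: A_def)
    have "A < u 1 j" if "j \<in> {i..i + int L}" for j
    proof -
      have "Z \<le> u 1 j" unfolding Z_def using that by (intro Min_le) auto
      moreover have "0 < u 1 j" by (simp add: u_pos)
      moreover have "A \<le> Z / 2" unfolding A_def by (rule min.cobounded2)
      ultimately show ?thesis by linarith
    qed
    then show ?thesis using far[OF that, of 1 A] A by (metis zero_le_one)
  qed
  define P where "P i \<longleftrightarrow> (\<exists>\<epsilon>>0. \<exists>T. \<forall>t\<ge>T. \<epsilon> \<le> u t i)" for i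
  have \<epsilon>c: "0 < \<epsilon> * c" using L by simp
  have P: "P i" for i
  proof (cases "i \<le> \<bar>N\<bar>")
    case True
    then show ?thesis
    proof (induction i rule: int_le_induct)
      case base
      have "\<exists>T. \<forall>t\<ge>T. \<epsilon> * c \<le> u t \<bar>N\<bar>" by (rule ev_far) auto
      then show ?case unfolding P_def using \<epsilon>c by blast
    next
      case (step i)
      then obtain \<epsilon> T where "0 < \<epsilon>" "\<And>t. T \<le> t \<Longrightarrow> \<epsilon> \<le> u t (i - 1 - (- 1))" by (auto simp: P_def)
      then show ?case unfolding P_def by (intro persistence_neighbour[of "- 1"]) auto
    qed
  next
    case False
    then have "\<exists>T. \<forall>t\<ge>T. \<epsilon> * c \<le> u t i" by (intro ev_far) auto
    then show ?thesis unfolding P_def using \<epsilon>c by blast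
  qed
  then obtain E where E: "\<And>i. 0 < E i" "\<And>i. \<exists>T. \<forall>t\<ge>T. E i \<le> u t i" unfolding P_def by metis
  define F where "F = {- \<bar>N\<bar> - int L..\<bar>N\<bar>}"
  have F: "finite F" "F \<noteq> {}" by (auto simp: F_def)
  define \<epsilon>' where "\<epsilon>' = min (\<epsilon> * c) (Min (E ` F))"
  have "0 < Min (E ` F)" using E F by (subst Min_gr_iff) auto
  then have "0 < \<epsilon>'" using \<epsilon>c by (simp add: \<epsilon>'_def)
  moreover have "\<exists>T. \<forall>t\<ge>T. \<epsilon>' \<le> u t i" for i
  proof (cases "i \<in> F")
    case True
    then have "Min (E ` F) \<le> E i" using F by (intro Min_le) auto
    then have "\<epsilon>' \<le> E i" by (simp add: \<epsilon>'_def)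
    then show ?thesis using E(2)[of i] by (meson order_trans)
  next
    case False
    then have "\<exists>T. \<forall>t\<ge>T. \<epsilon> * c \<le> u t i" by (intro ev_far) (auto simp: F_def)
    moreover have "\<epsilon>' \<le> \<epsilon> * c" by (simp add: \<epsilon>'_def)
    ultimately show ?thesis by (meson order_trans)
  qed
  ultimately show ?thesis by blast
qed

section \<open>Uniform lower bounds and convergence to 1\<close>

text \<open>A faster subcritical ray \<open>w0\<close> passes site i at time i / w0, the ray
  \<open>w\<close> only at i / w. In between, the subexponentially small values on the faster ray
  have time to grow.\<close>

lemma lower_bound_behind_front:
  assumes w: "0 < w" "w < speed_lower d d' f"
  shows "\<exists>\<epsilon>>0. \<exists>a. \<forall>i\<ge>a. \<forall>t. real_of_int i \<le> w * t \<longrightarrow> \<epsilon> \<le> u t i"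
proof -
  obtain L c l \<epsilon> where L: "0 < c" "0 < l" "0 < \<epsilon>" "\<epsilon> \<le> 1"
    and far: "\<And>i S A t. \<lbrakk>\<forall>j\<in>{i..i + int L}. N \<le> \<bar>j\<bar>; 0 \<le> S; 0 < A; A \<le> \<epsilon>;
      \<And>j. j \<in> {i..i + int L} \<Longrightarrow> A < u S j; S + 2 / l * ln (\<epsilon> / A) \<le> t\<rbrakk> \<Longrightarrow> \<epsilon> * c \<le> u t i"
    using persistence_far by metis
  define w0 where "w0 = (w + speed_lower d d' f) / 2"
  have w0: "w < w0" "w0 < speed_lower d d' f" "0 < w0" using w by (auto simp: w0_def)
  define g where "g = 1 / w - 1 / w0"
  have g: "0 < g" using w w0 by (simp add: g_def field_simps)
  \<comment> \<open>Growing from exp(-\<eta> S) at rate l/2 then takes half of the available time i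
    g; the constants take the other half once i \<ge> a.\<close>
  define \<eta> where "\<eta> = l * w0 * g / 4"
  have \<eta>: "0 < \<eta>" using L w0 g by (simp add: \<eta>_def)
  obtain T where T: "\<And>t i. t \<ge> T \<Longrightarrow> \<bar>real_of_int i - w0 * t\<bar> \<le> real L \<Longrightarrow> exp (- (\<eta> * t)) \<le> u t i"
    using no_decay_on_ray[OF w0(3,2) \<eta>, of "real L"] by blast
  define a where "a = max \<bar>N\<bar> \<lceil>max (w0 * T) (max (w0 * (- ln \<epsilon> / \<eta>)) (4 * ln 2 / (l * g)))\<rceil>"
  have "\<epsilon> * c \<le> u t i" if i: "a \<le> i" and t: "real_of_int i \<le> w * t" for i t
  proof -
    have iN: "\<bar>N\<bar> \<le> i" and i1: "w0 * T \<le> real_of_int i" "w0 * (- ln \<epsilon> / \<eta>) \<le> real_of_int i"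
      "4 * ln 2 / (l * g) \<le> real_of_int i"
      using i by (auto simp: a_def ceiling_le_iff)
    define S where "S = real_of_int i / w0"
    have S: "T \<le> S" "- ln \<epsilon> / \<eta> \<le> S" "0 \<le> S" "w0 * S = real_of_int i"
      using i1 iN w0(3) by (auto simp: S_def pos_le_divide_eq mult.commute)
    define A where "A = exp (- (\<eta> * S)) / 2"
    have "- (\<eta> * S) \<le> ln \<epsilon>" using S(2) \<eta> by (simp add: field_simps)
    then have "exp (- (\<eta> * S)) \<le> \<epsilon>" using L(3) by (metis exp_le_cancel_iff exp_ln)
    then have A: "0 < A" "A \<le> \<epsilon>" using exp_gt_zero[of "- (\<eta> * S)"] unfolding A_def by linarith+
    show ?thesis
    proof (rule far[OF _ S(3) A])
      show "\<forall>j\<in>{i..i + int L}. N \<le> \<bar>j\<bar>" using iN by auto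
      show "A < u S j" if "j \<in> {i..i + int L}" for j
      proof -
        have "exp (- (\<eta> * S)) \<le> u S j" using that S by (intro T) auto
        then show ?thesis using exp_gt_zero[of "- (\<eta> * S)"] unfolding A_def by linarith
      qed
      have "ln A = - (\<eta> * S) - ln 2" by (simp add: A_def ln_div)
      then have "ln (\<epsilon> / A) = ln \<epsilon> + \<eta> * S + ln 2"
        using L(3) A(1) by (simp add: ln_div)
      also have "\<dots> \<le> \<eta> * S + ln 2" using L by simp
      finally have "2 / l * ln (\<epsilon> / A) \<le> 2 / l * (\<eta> * S + ln 2)" using L by (intro mult_left_mono) auto
      also have "\<dots> = real_of_int i * g / 2 + 2 * ln 2 / l"
        unfolding S(4)[symmetric] using L(2) by (simp add: \<eta>_def field_simps)
      also have "2 * ln 2 / l \<le> real_of_int i * g / 2"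
        using i1(3) L(2) g by (simp add: field_simps)
      finally have "S + 2 / l * ln (\<epsilon> / A) \<le> S + real_of_int i * g" by (simp add: mult.commute)
      also have "\<dots> = real_of_int i / w" by (simp add: g_def S_def algebra_simps)
      also have "\<dots> \<le> t" using t w by (simp add: field_simps)
      finally show "S + 2 / l * ln (\<epsilon> / A) \<le> t" .
    qed
  qed
  moreover have "0 < \<epsilon> * c" using L by simp
  ultimately show ?thesis by blast
qed

text \<open>\<epsilon> precedes R because the window size R used for convergence depends on the
  reaction above level \<epsilon>. Sites down to -R are included since windows around sites near 0
  reach there.\<close>

lemma lower_bound_region:
  assumes w: "0 < w" "w < speed_lower d d' f"
  shows "\<exists>\<epsilon>>0. \<forall>R. \<exists>T. \<forall>t\<ge>T. \<forall>i. - R \<le> i \<and> real_of_int i \<le> w * t \<longrightarrow> \<epsilon> \<le> u t i"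
proof -
  obtain \<epsilon>1 a where 1: "0 < \<epsilon>1" "\<And>i t. a \<le> i \<Longrightarrow> real_of_int i \<le> w * t \<Longrightarrow> \<epsilon>1 \<le> u t i"
    using lower_bound_behind_front[OF w] by blast
  obtain \<epsilon>2 where 2: "0 < \<epsilon>2" "\<And>i. \<exists>T. \<forall>t\<ge>T. \<epsilon>2 \<le> u t i"
    using persistence by blast
  obtain \<tau> where \<tau>: "\<And>i t. \<tau> i \<le> t \<Longrightarrow> \<epsilon>2 \<le> u t i" using 2(2) by metis
  have "\<exists>T. \<forall>t\<ge>T. \<forall>i. - R \<le> i \<and> real_of_int i \<le> w * t \<longrightarrow> min \<epsilon>1 \<epsilon>2 \<le> u t i" for R
  proof (intro exI allI impI)
    fix t i assume t: "Max (insert 0 (\<tau> ` {- R..a})) \<le> t" and i: "- R \<le> i \<and> real_of_int i \<le> w * t"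
    show "min \<epsilon>1 \<epsilon>2 \<le> u t i"
    proof (cases "a \<le> i")
      case True
      then show ?thesis using 1(2)[of i t] i by auto
    next
      case False
      then have "\<tau> i \<le> t" using t i by auto
      then show ?thesis using \<tau>[of i t] by auto
    qed
  qed
  then show ?thesis using 1(1) 2(1) by (intro exI[of _ "min \<epsilon>1 \<epsilon>2"]) auto
qed

text \<open>A downward parabola in space, rising linearly in time, lies below \<open>u\<close> on a wide
  window: wherever the two touch, \<open>u\<close> is in the range where the reaction is bounded below.\<close>

lemma convergence_behind_front:
  assumes \<omega>: "0 \<le> \<omega>" "\<omega> < speed_lower d d' f" and \<eta>: "0 < \<eta>" "\<eta> < 1"
  shows "\<exists>T. \<forall>t\<ge>T. \<forall>i. 0 \<le> i \<and> real_of_int i \<le> \<omega> * t \<longrightarrow> 1 - \<eta> \<le> u t i"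
proof -
  define w where "w = (\<omega> + speed_lower d d' f) / 2"
  have w: "0 < w" "w < speed_lower d d' f" "\<omega> < w" using \<omega> speed_lower_pos by (auto simp: w_def)
  obtain \<epsilon>1 where \<epsilon>1: "0 < \<epsilon>1"
    "\<And>R. \<exists>T. \<forall>t\<ge>T. \<forall>i. - R \<le> i \<and> real_of_int i \<le> w * t \<longrightarrow> \<epsilon>1 \<le> u t i"
    using lower_bound_region[OF w(1,2)] by blast
  define \<epsilon> where "\<epsilon> = min (\<epsilon>1 / 2) ((1 - \<eta>) / 2)"
  have "0 < \<epsilon>" using \<epsilon>1 \<eta> by (simp add: \<epsilon>_def)
  moreover have "\<epsilon> \<le> \<epsilon>1 / 2" "\<epsilon> \<le> (1 - \<eta>) / 2"
    unfolding \<epsilon>_def by (rule min.cobounded1, rule min.cobounded2)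
  ultimately have \<epsilon>: "0 < \<epsilon>" "\<epsilon> < \<epsilon>1" "\<epsilon> < 1 - \<eta>" by auto
  obtain c where c: "0 < c" "\<And>i s. s \<in> {\<epsilon>..1 - \<eta>} \<Longrightarrow> c \<le> f i s"
    using f_away[of \<epsilon> "1 - \<eta>"] \<epsilon> \<eta> by auto
  \<comment> \<open>\<open>D\<close> is the height to climb, at speed c/2 during time \<sigma>. The
    other half of the reaction pays for diffusion.\<close>
  define D where "D = 1 - \<eta> - \<epsilon>"
  have D: "0 < D" "D \<le> 1" using \<epsilon> \<eta> by (auto simp: D_def)
  define \<sigma> where "\<sigma> = 2 * D / c"
  have \<sigma>: "0 < \<sigma>" "c / 2 * \<sigma> = D" using c D by (auto simp: \<sigma>_def)
  \<comment> \<open>Wide enough for diffusion of the parabola to cost less than c/2, while its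
    edges, lower by D, never rise above \<epsilon>.\<close>
  define R where "R = \<lceil>12 * M / c\<rceil> + 1"
  have "0 < 12 * M / c" using M_pos c by simp
  then have R: "1 \<le> R" "12 * M / c < real_of_int R" unfolding R_def by linarith+
  have R': "12 * M < c * real_of_int R" using R(2) c by (simp add: field_simps)
  define \<kappa> where "\<kappa> = D / (real_of_int R)\<^sup>2"
  have \<kappa>: "0 < \<kappa>" "\<kappa> * (real_of_int R)\<^sup>2 = D" using D R by (auto simp: \<kappa>_def)
  have \<kappa>R: "\<kappa> * (2 * M * (2 * real_of_int R + 1)) < c / 2"
  proof -
    have "\<kappa> * (2 * M * (2 * real_of_int R + 1)) \<le> \<kappa> * (2 * M * (3 * real_of_int R))"
      using \<kappa> M_pos R by (intro mult_left_mono) auto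
    also have "\<kappa> * (2 * M * (3 * real_of_int R)) < c / 2"
    proof -
      have eq: "\<kappa> * (2 * M * (3 * real_of_int R)) * (2 * real_of_int R) = D * (12 * M)"
        by (simp add: \<kappa>(2)[symmetric] power2_eq_square)
      have "D * (12 * M) \<le> 1 * (12 * M)" using D M_pos by (intro mult_right_mono) auto
      also have "\<dots> < c / 2 * (2 * real_of_int R)" using R' by simp
      finally show ?thesis using R unfolding eq[symmetric] by (subst (asm) mult_less_cancel_right_pos) auto
    qed
    finally show ?thesis .
  qed
  obtain T where T: "\<And>t i. t \<ge> T \<Longrightarrow> - R \<le> i \<Longrightarrow> real_of_int i \<le> w * t \<Longrightarrow> \<epsilon>1 \<le> u t i"
    using \<epsilon>1(2)[of R] by blast
  \<comment> \<open>The second bound on \<open>t\<close> puts site i0 + R behind the ray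
    \<open>w\<close> already at time t - \<sigma>.\<close>
  have "1 - \<eta> \<le> u t i0"
    if t: "t \<ge> max (max 0 T + \<sigma>) ((real_of_int R + w * \<sigma>) / (w - \<omega>))" and i0: "0 \<le> i0" "real_of_int i0 \<le> \<omega> * t" for t i0
  proof -
    define S where "S = t - \<sigma>"
    have S: "0 \<le> S" "T \<le> S" "S \<le> t" using t \<sigma> by (auto simp: S_def)
    have "real_of_int R + w * \<sigma> \<le> t * (w - \<omega>)" using t w by (simp add: field_simps)
    then have edge: "real_of_int i0 + real_of_int R \<le> w * S" using i0 by (simp add: S_def algebra_simps)
    have region: "\<epsilon> < u s i" if "S \<le> s" "i0 - R \<le> i" "i \<le> i0 + R" for s i
    proof -
      have "real_of_int i \<le> real_of_int i0 + real_of_int R" using that by linarith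
      also have "\<dots> \<le> w * s" using edge mult_left_mono[OF that(1), of w] w by linarith
      finally have "\<epsilon>1 \<le> u s i" using that i0 S by (intro T) auto
      then show ?thesis using \<epsilon> by simp
    qed
    define v where "v s i = \<epsilon> + c / 2 * (s - S) - \<kappa> * (real_of_int (i - i0))\<^sup>2" for s i
    have "v t i0 < u t i0"
    proof (rule strict_subsolution_below[where a = "i0 - R + 1" and b = "i0 + R - 1" and v = v and S = S
          and T = t and v' = "\<lambda>s i. c / 2"])
      show "((\<lambda>\<tau>. v \<tau> i) has_real_derivative c / 2) (at s)" for s i
        unfolding v_def by (auto intro!: derivative_eq_intros)
      have edge_le: "v s i \<le> \<epsilon>" if "s \<le> t" "\<bar>i - i0\<bar> = R" for s i
      proof -
        have "c / 2 * (s - S) \<le> c / 2 * \<sigma>" using that c by (intro mult_left_mono) (auto simp: S_def)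
        moreover have "(real_of_int (i - i0))\<^sup>2 = (real_of_int R)\<^sup>2"
          using that(2) by (metis of_int_abs power2_abs)
        ultimately show ?thesis using \<kappa>(2) \<sigma>(2) by (simp add: v_def)
      qed
      show "v s (i0 - R + 1 - 1) \<le> u s (i0 - R + 1 - 1)" if "S \<le> s" "s \<le> t" for s
        using that R edge_le[of s "i0 - R"] region[of s "i0 - R"] by simp
      show "v s (i0 + R - 1 + 1) \<le> u s (i0 + R - 1 + 1)" if "S \<le> s" "s \<le> t" for s
        using that R edge_le[of s "i0 + R"] region[of s "i0 + R"] by simp
      show "v S i < u S i" if "i0 - R + 1 \<le> i" "i \<le> i0 + R - 1" for i
      proof -
        have "v S i \<le> \<epsilon>" using \<kappa> by (simp add: v_def)
        then show ?thesis using region[of S i] that by simp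
      qed
      show "c / 2 < d' i * (v s (i + 1) - v s i) + d i * (v s (i - 1) - v s i) + f i (v s i)"
        if s: "S < s" "s \<le> t" and i: "i0 - R + 1 \<le> i" "i \<le> i0 + R - 1" and eq: "u s i = v s i" for s i
      proof -
        have "\<epsilon> < v s i" using region[of s i] s i eq by simp
        moreover have "v s i \<le> 1 - \<eta>"
        proof -
          have "c / 2 * (s - S) \<le> c / 2 * \<sigma>" using s c by (intro mult_left_mono) (auto simp: S_def)
          moreover have "0 \<le> \<kappa> * (real_of_int (i - i0))\<^sup>2" using \<kappa> by simp
          ultimately show ?thesis using \<sigma>(2) by (simp add: v_def D_def)
        qed
        ultimately have fc: "c \<le> f i (v s i)" by (intro c(2)) auto
        define j where "j = real_of_int (i - i0)"
        have j: "\<bar>j\<bar> \<le> real_of_int R" using i unfolding j_def by linarith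
        have "d' i * (2 * j + 1) \<le> M * (2 * real_of_int R + 1)"
          using j d'_le[of i] d'_pos[of i] R
          by (intro order_trans[OF mult_left_mono mult_right_mono]) auto
        moreover have "d i * (1 - 2 * j) \<le> M * (2 * real_of_int R + 1)"
          using j d_le[of i] d_pos[of i] R
          by (intro order_trans[OF mult_left_mono mult_right_mono]) auto
        ultimately have "\<kappa> * (d' i * (2 * j + 1) + d i * (1 - 2 * j)) \<le> \<kappa> * (2 * M * (2 * real_of_int R + 1))"
          using \<kappa> by (intro mult_left_mono) (auto simp: algebra_simps)
        then have "\<kappa> * (d' i * (2 * j + 1) + d i * (1 - 2 * j)) < c / 2" using \<kappa>R by simp
        moreover have vd: "v s (i + 1) - v s i = - \<kappa> * (2 * j + 1)" "v s (i - 1) - v s i = - \<kappa> * (1 - 2 * j)"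
          by (simp_all add: v_def j_def power2_eq_square algebra_simps)
        ultimately show ?thesis unfolding vd using fc by (simp add: algebra_simps)
      qed
    qed (use S R in auto)
    moreover have "v t i0 = \<epsilon> + c / 2 * \<sigma>" by (simp add: v_def S_def)
    then have "v t i0 = 1 - \<eta>" unfolding \<sigma>(2) D_def by simp
    ultimately show ?thesis by simp
  qed
  then show ?thesis by blast
qed

lemma spreading_lower:
  assumes \<omega>: "0 \<le> \<omega>" "\<omega> < speed_lower d d' f"
  shows "((\<lambda>t. SUP i\<in>{i. 0 \<le> real_of_int i \<and> real_of_int i \<le> \<omega> * t}. \<bar>u t i - 1\<bar>) \<longlongrightarrow> 0) at_top"
  unfolding tendsto_iff
proof (intro allI impI)
  fix e :: real assume e: "0 < e"
  define \<eta> where "\<eta> = min (e / 2) (1 / 2)"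
  have \<eta>: "0 < \<eta>" "\<eta> < 1" "\<eta> < e" using e by (auto simp: \<eta>_def min_def)
  obtain T where T: "\<And>t i. t \<ge> T \<Longrightarrow> 0 \<le> i \<Longrightarrow> real_of_int i \<le> \<omega> * t \<Longrightarrow> 1 - \<eta> \<le> u t i"
    using convergence_behind_front[OF \<omega> \<eta>(1,2)] by blast
  show "\<forall>\<^sub>F t in at_top. dist (SUP i\<in>{i. 0 \<le> real_of_int i \<and> real_of_int i \<le> \<omega> * t}. \<bar>u t i - 1\<bar>) 0 < e"
    using eventually_ge_at_top[of "max 0 T"]
  proof eventually_elim
    case (elim t)
    define I where "I = {i. 0 \<le> real_of_int i \<and> real_of_int i \<le> \<omega> * t}"
    have 0: "0 \<in> I" using \<omega> elim by (simp add: I_def)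
    have le: "\<bar>u t i - 1\<bar> \<le> \<eta>" if "i \<in> I" for i
      using T[of t i] that elim u_le_1[of t i] by (auto simp: I_def)
    have "(SUP i\<in>I. \<bar>u t i - 1\<bar>) \<le> \<eta>" using 0 le by (intro cSUP_least) auto
    moreover have "0 \<le> (SUP i\<in>I. \<bar>u t i - 1\<bar>)"
      using cSUP_upper[OF 0, of "\<lambda>i. \<bar>u t i - 1\<bar>"] le by (force simp: bdd_above_def)
    ultimately show ?case using \<eta> by (simp add: I_def dist_real_def)
  qed
qed

end

section \<open>Passage from the hypotheses to the locale\<close>

theorem theorem2p1:
  fixes d d' :: "int \<Rightarrow> real" and f :: "int \<Rightarrow> real \<Rightarrow> real" and u :: "real \<Rightarrow> int \<Rightarrow> real"
  assumes d_bounds: "bdd_below (range d)" "0 < (INF i. d i)" "bdd_above (range d)"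
    and d'_bounds: "bdd_below (range d')" "0 < (INF i. d' i)" "bdd_above (range d')"
    and f_zero: "\<And>i. f i 0 = 0 \<and> f i 1 = 0"
    and f_inf: "\<And>s. s \<in> {0<..<1} \<Longrightarrow> bdd_below (range (\<lambda>j. f j s)) \<and> 0 < (INF j. f j s)"
    and f_KPP: "\<And>i s. s \<in> {0<..<1} \<Longrightarrow> f i s \<le> deriv_s f i 0 * s"
    and f_holder: "\<exists>\<gamma>. 0 < \<gamma> \<and> \<gamma> \<le> 1 \<and> uniformly_C1_holder \<gamma> f"
    and f_liminf: "0 < Liminf (filtercomap (\<lambda>i::int. \<bar>i\<bar>) at_top)
                        (\<lambda>i. ereal (deriv_s f i 0 - (sqrt (d' i) - sqrt (d i))\<^sup>2))"
    and sol: "is_solution d d' f u"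
    and init: "\<And>i. 0 \<le> u 0 i \<and> u 0 i \<le> 1"
    and supp: "{i. u 0 i \<noteq> 0} \<noteq> {}" "finite {i. u 0 i \<noteq> 0}"
  shows "(\<forall>\<omega>. \<omega> > speed_upper d d' f \<longrightarrow>
            ((\<lambda>t. SUP i\<in>{i. real_of_int i \<ge> \<omega> * t}. \<bar>u t i\<bar>) \<longlongrightarrow> 0) at_top) \<and>
         (\<forall>\<omega>. 0 \<le> \<omega> \<and> \<omega> < speed_lower d d' f \<longrightarrow>
            ((\<lambda>t. SUP i\<in>{i. 0 \<le> real_of_int i \<and> real_of_int i \<le> \<omega> * t}. \<bar>u t i - 1\<bar>) \<longlongrightarrow> 0) at_top)"
proof -
  obtain \<gamma> K where \<gamma>: "0 < \<gamma>" and diff: "\<And>i s. s \<in> {0..1} \<Longrightarrow> f i differentiable (at s within {0..1})"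
    and deriv_le: "\<And>i s. s \<in> {0..1} \<Longrightarrow> \<bar>deriv_s f i s\<bar> \<le> K"
    and holder: "\<And>i s t. s \<in> {0..1} \<Longrightarrow> t \<in> {0..1} \<Longrightarrow>
      \<bar>deriv_s f i s - deriv_s f i t\<bar> \<le> K * \<bar>s - t\<bar> powr \<gamma>"
    using f_holder unfolding uniformly_C1_holder_def by metis
  have K0: "0 \<le> K" using deriv_le[of 0 0] by simp
  have deriv: "(f i has_real_derivative deriv_s f i s) (at s within {0..1})" if "s \<in> {0..1}" for i s
    using diff[OF that] unfolding deriv_s_def has_real_derivative_iff_has_vector_derivative
    by (simp add: vector_derivative_works)
  have f_lipschitz: "\<bar>f i s - f i t\<bar> \<le> K * \<bar>s - t\<bar>" if "s \<in> {0..1}" "t \<in> {0..1}" for i s t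
    using field_differentiable_bound[of "{0..1}" "f i" "deriv_s f i" K s t] deriv deriv_le that
    by simp
  have f_inf_le: "(INF j. f j s) \<le> f i s" if "s \<in> {0<..<1}" for i s
    using f_inf[OF that] by (intro cINF_lower) auto
  have f_pos: "0 < f i s" if "s \<in> {0<..<1}" for i s
    using f_inf[OF that] f_inf_le[OF that, of i] by linarith
  have r_nonneg: "0 \<le> deriv_s f i 0" for i
    using f_pos[of "1/2" i] f_KPP[of "1/2" i] by simp
  obtain \<delta> where \<delta>: "0 < ereal \<delta>"
    "ereal \<delta> < Liminf (filtercomap (\<lambda>i::int. \<bar>i\<bar>) at_top) (\<lambda>i. ereal (deriv_s f i 0 - (sqrt (d' i) - sqrt (d i))\<^sup>2))"
    using ereal_dense2[OF f_liminf] by (auto simp: zero_ereal_def)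
  obtain N where N: "\<And>i. N \<le> \<bar>i\<bar> \<Longrightarrow> \<delta> < deriv_s f i 0 - (sqrt (d' i) - sqrt (d i))\<^sup>2"
    using less_LiminfD[OF \<delta>(2)] unfolding eventually_filtercomap eventually_at_top_linorder
    by auto
  define m where "m = min (INF i. d i) (INF i. d' i)"
  define M where "M = max (SUP i. d i) (SUP i. d' i)"
  interpret kpp_solution d d' f m M K \<delta> N \<gamma> u
  proof
    show "0 < m" using d_bounds d'_bounds by (simp add: m_def)
    show "m \<le> d i" "m \<le> d' i" for i
      using cINF_lower[OF d_bounds(1), of i] cINF_lower[OF d'_bounds(1), of i] by (auto simp: m_def)
    show "d i \<le> M" "d' i \<le> M" for i
      using cSUP_upper[OF _ d_bounds(3), of i] cSUP_upper[OF _ d'_bounds(3), of i] by (auto simp: M_def)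
    show "0 \<le> deriv_s f i 0" for i by (rule r_nonneg)
    show "deriv_s f i 0 \<le> K" for i using deriv_le[of 0 i] by simp
    show "0 < \<delta>" using \<delta>(1) by simp
    show "\<delta> \<le> deriv_s f i 0 - (sqrt (d' i) - sqrt (d i))\<^sup>2" if "N \<le> \<bar>i\<bar>" for i
      using N[OF that] by simp
    show "0 < \<gamma>" by (rule \<gamma>)
    fix i and s :: real
    assume s: "0 \<le> s" "s \<le> 1"
    consider "s = 0" | "s = 1" | "s \<in> {0<..<1}" using s by fastforce
    note s_cases = this
    show "0 \<le> f i s" using s_cases by cases (use f_zero f_pos[of s i] in auto)
    show "f i s \<le> deriv_s f i 0 * s" using s_cases by cases (use f_zero r_nonneg f_KPP in auto)
    show "(deriv_s f i 0 - K * s powr \<gamma>) * s \<le> f i s"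
    proof (cases "s = 0")
      case True
      then show ?thesis using f_zero by simp
    next
      case False
      have "(f i has_derivative (*) (deriv_s f i x)) (at x within {0..s})" if "0 \<le> x" "x \<le> s" for x
        using deriv[of x i] that s unfolding has_field_derivative_def
        by (auto intro: has_derivative_subset)
      then obtain x where x: "x \<in> {0<..<s}" "f i s - f i 0 = deriv_s f i x * (s - 0)"
        using mvt_simple[of 0 s "f i" "\<lambda>x. (*) (deriv_s f i x)"] s False by auto
      have "\<bar>deriv_s f i x - deriv_s f i 0\<bar> \<le> K * \<bar>x - 0\<bar> powr \<gamma>"
        using x s by (intro holder) auto
      moreover have "K * \<bar>x - 0\<bar> powr \<gamma> \<le> K * s powr \<gamma>"
        using x \<gamma> K0 by (intro mult_left_mono powr_mono2) auto
      ultimately have "deriv_s f i 0 - K * s powr \<gamma> \<le> deriv_s f i x" by linarith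
      then show ?thesis using x(2) f_zero s by (simp add: mult_right_mono)
    qed
  next
    fix a b :: real
    assume ab: "0 < a" "b < 1"
    show "\<exists>c>0. \<forall>i. \<forall>s\<in>{a..b}. c \<le> f i s"
    proof (cases "a \<le> b")
      case True
      \<comment> \<open>The infimum over sites inherits the common Lipschitz constant
        \<open>K\<close>, so it is continuous and has a positive minimum on
        \<open>{a..b}\<close>.\<close>
      define g where "g s = (INF j. f j s)" for s
      have g_le: "g s \<le> g t + K * \<bar>s - t\<bar>" if "s \<in> {a..b}" "t \<in> {a..b}" for s t
      proof -
        have "g s - K * \<bar>s - t\<bar> \<le> g t"
          unfolding g_def[of t]
        proof (rule cINF_greatest)
          fix j
          have "g s \<le> f j s" unfolding g_def using that ab by (intro f_inf_le) auto
          then show "g s - K * \<bar>s - t\<bar> \<le> f j t" using f_lipschitz[of s t j] that ab by auto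
        qed simp
        then show ?thesis by simp
      qed
      have "K-lipschitz_on {a..b} g"
      proof (rule lipschitz_onI[OF _ K0])
        fix s t assume "s \<in> {a..b}" "t \<in> {a..b}"
        then have "g s \<le> g t + K * \<bar>s - t\<bar>" "g t \<le> g s + K * \<bar>s - t\<bar>"
          using g_le[of s t] g_le[of t s] by (simp_all add: abs_minus_commute)
        then show "dist (g s) (g t) \<le> K * dist s t" unfolding dist_real_def by linarith
      qed
      then have "continuous_on {a..b} g" by (rule lipschitz_on_continuous_on)
      then obtain s where s: "s \<in> {a..b}" "\<And>t. t \<in> {a..b} \<Longrightarrow> g s \<le> g t"
        using continuous_attains_inf[of "{a..b}" g] True by auto
      have "g s \<le> f i t" if "t \<in> {a..b}" for i t
        using s(2)[OF that] f_inf_le[of t i] that ab by (auto simp: g_def)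
      moreover have "0 < g s" using f_inf[of s] s(1) ab by (auto simp: g_def)
      ultimately show ?thesis by blast
    qed (auto intro: exI[of _ 1])
  next
    show "0 \<le> u t i" "u t i \<le> 1" if "0 \<le> t" for t i
      using sol that by (auto simp: is_solution_def)
    show "continuous_on {0..} (\<lambda>t. u t i)" for i using sol by (auto simp: is_solution_def)
    show "((\<lambda>\<tau>. u \<tau> i) has_real_derivative
        (d' i * (u t (i + 1) - u t i) + d i * (u t (i - 1) - u t i) + f i (u t i))) (at t)"
      if "0 < t" for t i using sol that by (auto simp: is_solution_def)
    show "\<exists>i. 0 < u 0 i" using supp(1) init by (auto simp: order_less_le)
    show "finite {i. u 0 i \<noteq> 0}" by (rule supp(2))
  qed
  show ?thesis using spreading_upper spreading_lower by blast
qed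

end
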